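(* Let $\mathbf T,\mathbf{SL},\mathbf C,\mathbf D,\mathbf E,\overleftarrow{\mathbf E},\mathbf F,\mathbf H,\mathbf I,\mathbf J$ be the monoid varieties defined in the context. The lattice $L(\mathbf J)$ of all subvarieties of $\mathbf J$ consists of exactly the following twelve pairwise distinct varieties: $$\mathbf T,\ \mathbf{SL},\ \mathbf C,\ \mathbf D,\ \mathbf E,\ \overleftarrow{\mathbf E},\ \mathbf F,\ \mathbf E\vee\overleftarrow{\mathbf E},\ \mathbf F\vee\overleftarrow{\mathbf E},\ \mathbf H,\ \mathbf I,\ \mathbf J,$$ and its covering relations (with $\mathbf X\prec\mathbf Y$ meaning that $\mathbf Y$ covers $\mathbf X$) are exactly $$\mathbf T\prec\mathbf{SL}\prec\mathbf C\prec\mathbf D,\quad \mathbf D\prec\mathbf E,\quad \mathbf D\prec\overleftarrow{\mathbf E},\quad \mathbf E\prec\mathbf F,\quad \mathbf E\prec\mathbf E\vee\overleftarrow{\mathbf E},\quad \overleftarrow{\mathbf E}\prec\mathbf E\vee\overleftarrow{\mathbf E},$$ $$\mathbf F\prec\mathbf F\vee\overleftarrow{\mathbf E},\quad \mathbf E\vee\overleftarrow{\mathbf E}\prec\mathbf F\vee\overleftarrow{\mathbf E},\quad \mathbf F\vee\overleftarrow{\mathbf E}\prec\mathbf H\prec\mathbf I\prec\mathbf J.$$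
   Context: Monoids are considered as algebras with an associative binary operation and a nullary operation (the identity element $1$). Words are elements of the free monoid $F^1$ over a countably infinite alphabet of letters; an identity $\mathbf u\approx\mathbf v$ holds in a monoid $M$ if $\varphi(\mathbf u)=\varphi(\mathbf v)$ for every monoid homomorphism $\varphi\colon F^1\to M$ (so letters may in particular be substituted by $1$). Distinct symbols denote distinct letters. For a set $\Sigma$ of identities, $\operatorname{var}\Sigma$ is the variety of monoids defined by $\Sigma$. $\mathbf X\vee\mathbf Y$ is the join in the lattice of monoid varieties, and $\overleftarrow{\mathbf X}$ is the variety dual to $\mathbf X$, i.e. the class of all monoids anti-isomorphic to monoids from $\mathbf X$. Let $\Phi=\{xyx\approx xyx^2,\ x^2y^2\approx y^2x^2,\ xyzxy\approx yxzxy\}$. For $n\in\mathbb N$ and $\pi\in S_n$ put $$\mathbf w_n[\pi]=x\,z_{1\pi}z_{2\pi}\cdots z_{n\pi}\,x\,t_1z_1t_2z_2\cdots t_nz_n,\qquad \mathbf w_n'[\pi]=x^2\,z_{1\pi}z_{2\pi}\cdots z_{n\pi}\,t_1z_1t_2z_2\cdots t_nz_n.$$ The varieties are: - $\mathbf T$: the trivial variety of monoids; $\mathbf{SL}$: the variety of all semilattice monoids (commutative idempotent monoids); - $\mathbf C=\operatorname{var}\{x^2\approx x^3,\ xy\approx yx\}$; - $\mathbf D=\operatorname{var}\{x^2\approx x^3,\ x^2y\approx xyx\approx yx^2\}$; - $\mathbf E=\operatorname{var}\{x^2\approx x^3,\ x^2y\approx xyx,\ x^2y^2\approx y^2x^2\}$;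 - $\mathbf F=\operatorname{var}(\Phi\cup\{xyxz\approx xyxzx\})$; - $\mathbf H=\operatorname{var}(\Phi\cup\{xyxztx\approx xyxzxtx,\ x^2yty\approx xyxty\approx yx^2ty\})$; - $\mathbf I=\operatorname{var}(\Phi\cup\{xyxztx\approx xyxzxtx,\ xzxyty\approx xzyxty\})$; - $\mathbf J=\operatorname{var}(\Phi\cup\{xyxztx\approx xyxzxtx\}\cup\{\mathbf w_n[\pi]\approx\mathbf w_n'[\pi]\mid n\in\mathbb N,\ \pi\in S_n\})$. *)

theory Defs
  imports
    "HOL-Algebra.Group"
    "HOL-Combinatorics.Permutations"
    "HOL-Library.Infinite_Typeclass"
begin

(* The letters x, y, z, t, z_1, z_2, ..., t_1, t_2, ... of the identities are
   LX, LY, LZ 0, LT 0, LZ 1, LZ 2, ..., LT 1, LT 2, ...  *)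
datatype letter = LX | LY | LZ nat | LT nat

type_synonym word = "letter list"
type_synonym identity = "word \<times> word"

definition free_monoid :: "word monoid" where
  "free_monoid = \<lparr>carrier = UNIV, monoid.mult = (@), one = []\<rparr>"

(* The library's hom only asks for multiplicativity. *)
definition monoid_homs :: "('a, 'c) monoid_scheme \<Rightarrow> ('b, 'd) monoid_scheme \<Rightarrow> ('a \<Rightarrow> 'b) set" where
  "monoid_homs M N = {\<phi> \<in> hom M N. \<phi> \<one>\<^bsub>M\<^esub> = \<one>\<^bsub>N\<^esub>}"

definition holds_in :: "identity \<Rightarrow> 'a monoid \<Rightarrow> bool" where
  "holds_in e M \<longleftrightarrow> (\<forall>\<phi> \<in> monoid_homs free_monoid M. \<phi> (fst e) = \<phi> (snd e))"

(* A class of monoids is represented by its members whose carrier is a subset of a type 'a.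
   For infinite 'a nothing is lost: a variety is generated by its free monoid of countably
   infinite rank, which is countable, hence isomorphic to a monoid carried by a subset of 'a;
   so inclusions, joins and duals of varieties are detected on these members. *)
definition var :: "identity set \<Rightarrow> 'a monoid set" where
  "var \<Sigma> = {M. monoid M \<and> (\<forall>e\<in>\<Sigma>. holds_in e M)}"

definition variety :: "'a monoid set \<Rightarrow> bool" where
  "variety V \<longleftrightarrow> (\<exists>\<Sigma>. V = var \<Sigma>)"

definition subvarieties :: "'a monoid set \<Rightarrow> 'a monoid set set" where
  "subvarieties V = {X. variety X \<and> X \<subseteq> V}"

definition variety_join :: "'a monoid set \<Rightarrow> 'a monoid set \<Rightarrow> 'a monoid set" where
  "variety_join X Y = \<Inter> {V. variety V \<and> X \<subseteq> V \<and> Y \<subseteq> V}"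

definition anti_iso :: "('a, 'c) monoid_scheme \<Rightarrow> ('b, 'd) monoid_scheme \<Rightarrow> ('a \<Rightarrow> 'b) set" where
  "anti_iso M N = {f. bij_betw f (carrier M) (carrier N) \<and> f \<one>\<^bsub>M\<^esub> = \<one>\<^bsub>N\<^esub> \<and>
     (\<forall>a\<in>carrier M. \<forall>b\<in>carrier M. f (a \<otimes>\<^bsub>M\<^esub> b) = f b \<otimes>\<^bsub>N\<^esub> f a)}"

definition dual :: "'a monoid set \<Rightarrow> 'a monoid set" where
  "dual X = {M. monoid M \<and> (\<exists>N\<in>X. anti_iso M N \<noteq> {})}"

(* Covering relation of L(V), as pairs (X, Y) such that Y covers X. *)
definition covering :: "'a monoid set \<Rightarrow> ('a monoid set \<times> 'a monoid set) set" where
  "covering V = {(X, Y). X \<in> subvarieties V \<and> Y \<in> subvarieties V \<and> X \<subset> Y \<and>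
     \<not> (\<exists>Z \<in> subvarieties V. X \<subset> Z \<and> Z \<subset> Y)}"

definition Phi :: "identity set" where
  "Phi = {([LX,LY,LX], [LX,LY,LX,LX]),
          ([LX,LX,LY,LY], [LY,LY,LX,LX]),
          ([LX,LY,LZ 0,LX,LY], [LY,LX,LZ 0,LX,LY])}"

(* The words w_n[\<pi>] and w'_n[\<pi>]. *)
definition w :: "nat \<Rightarrow> (nat \<Rightarrow> nat) \<Rightarrow> word" where
  "w n \<pi> = [LX] @ map (\<lambda>i. LZ (\<pi> i)) [1..<Suc n] @ [LX] @
     concat (map (\<lambda>i. [LT i, LZ i]) [1..<Suc n])"

definition w' :: "nat \<Rightarrow> (nat \<Rightarrow> nat) \<Rightarrow> word" where
  "w' n \<pi> = [LX, LX] @ map (\<lambda>i. LZ (\<pi> i)) [1..<Suc n] @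
     concat (map (\<lambda>i. [LT i, LZ i]) [1..<Suc n])"

definition var_T :: "'a monoid set" where
  "var_T = {M. monoid M \<and> carrier M = {\<one>\<^bsub>M\<^esub>}}"

definition var_SL :: "'a monoid set" where
  "var_SL = {M. comm_monoid M \<and> (\<forall>a\<in>carrier M. a \<otimes>\<^bsub>M\<^esub> a = a)}"

definition var_C :: "'a monoid set" where
  "var_C = var {([LX,LX], [LX,LX,LX]), ([LX,LY], [LY,LX])}"

definition var_D :: "'a monoid set" where
  "var_D = var {([LX,LX], [LX,LX,LX]),
                ([LX,LX,LY], [LX,LY,LX]), ([LX,LY,LX], [LY,LX,LX])}"

definition var_E :: "'a monoid set" where
  "var_E = var {([LX,LX], [LX,LX,LX]),
                ([LX,LX,LY], [LX,LY,LX]),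
                ([LX,LX,LY,LY], [LY,LY,LX,LX])}"

definition var_F :: "'a monoid set" where
  "var_F = var (Phi \<union> {([LX,LY,LX,LZ 0], [LX,LY,LX,LZ 0,LX])})"

definition var_H :: "'a monoid set" where
  "var_H = var (Phi \<union> {([LX,LY,LX,LZ 0,LT 0,LX], [LX,LY,LX,LZ 0,LX,LT 0,LX]),
                        ([LX,LX,LY,LT 0,LY], [LX,LY,LX,LT 0,LY]),
                        ([LX,LY,LX,LT 0,LY], [LY,LX,LX,LT 0,LY])})"

definition var_I :: "'a monoid set" where
  "var_I = var (Phi \<union> {([LX,LY,LX,LZ 0,LT 0,LX], [LX,LY,LX,LZ 0,LX,LT 0,LX]),
                        ([LX,LZ 0,LX,LY,LT 0,LY], [LX,LZ 0,LY,LX,LT 0,LY])})"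

definition var_J :: "'a monoid set" where
  "var_J = var (Phi \<union> {([LX,LY,LX,LZ 0,LT 0,LX], [LX,LY,LX,LZ 0,LX,LT 0,LX])}
                    \<union> {(w n \<pi>, w' n \<pi>) | n \<pi>. n \<ge> 1 \<and> \<pi> permutes {1..n}})"

end

theory Submission
  imports Defs "HOL-Library.Countable"
begin

text \<open>
  Varieties correspond to fully invariant congruences on words. For a subvariety \<open>X\<close> of \<open>J\<close>, each of
  the nine join-irreducible varieties \<open>Y\<close> has a partner \<open>Y'\<close> such that \<open>Y \<subseteq> X\<close> fails only if
  \<open>X \<subseteq> Y'\<close>: the pairs are (SL, T), (C, SL), (D, C), (E, dual E), (dual E, F), (F, E \<open>\<or>\<close> dual E),
  (H, F \<open>\<or>\<close> dual E), (I, H) and (J, I). To see this, one describes by means of the relative order of first,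
  second and last occurrences of letters when an identity follows from the axioms of \<open>Y\<close>; deleting letters
  from an identity that violates this description leaves an identity that axiomatizes \<open>Y'\<close>.
  The inclusion \<open>Y \<subseteq> Y'\<close> fails because the axioms of \<open>Y\<close>, but not those of \<open>Y'\<close>, are contained in
  the syntactic congruence of a suitable set of words.
\<close>

subsection \<open>Fully invariant congruences and varieties\<close>

text \<open>A pair (Y, Y') makes Y' the largest subvariety of J not above Y, so \<open>X\<close> is
  pinned down by which of the nine varieties it contains. Only for D and E does this merely bound
  \<open>X\<close> by two incomparable varieties, whose intersection has to be computed
  (\<open>meet_D\<close>, \<open>meet_E\<close>). The main obstacle is completeness of the
  descriptions of identities. For H, I, J and the join of F and dual E it is proved once, by bubble
  sort on words with at most three occurrences of each letter; what varies is which swaps of first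
  and second occurrences are blocked. Beyond n = 1 the axioms w_n[\<pi>] enter only through
  \<open>pull_second\<close>, which moves a second occurrence left over letters that all occur at
  least twice. For the smaller varieties, words are padded by doubling, appending or prepending
  repeated letters until the description of a larger variety applies. Soundness enters for E, dual E
  and F, in order to treat the two joins, and comes for free: an identity of E violating its
  description would force E into dual E.\<close>

definition subst :: "(letter \<Rightarrow> word) \<Rightarrow> word \<Rightarrow> word" where
  "subst \<sigma> u = concat (map \<sigma> u)"

lemma subst_simps [simp]:
  "subst \<sigma> [] = []"
  "subst \<sigma> (c # u) = \<sigma> c @ subst \<sigma> u"
  "subst \<sigma> (u @ v) = subst \<sigma> u @ subst \<sigma> v"
  by (simp_all add: subst_def)

text \<open>It serves two purposes: derivations inside the identities \<open>eqth X\<close> of a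
  variety, and refutations by congruences \<open>syn L\<close> built from a set of words.\<close>

locale fic =
  fixes \<theta> :: "identity set"
  assumes refl_in: "(u, u) \<in> \<theta>"
    and sym_in: "(u, v) \<in> \<theta> \<Longrightarrow> (v, u) \<in> \<theta>"
    and trans_in: "(u, v) \<in> \<theta> \<Longrightarrow> (v, v') \<in> \<theta> \<Longrightarrow> (u, v') \<in> \<theta>"
    and ctxt_in: "(u, v) \<in> \<theta> \<Longrightarrow> (p @ u @ q, p @ v @ q) \<in> \<theta>"
    and subst_in: "(u, v) \<in> \<theta> \<Longrightarrow> (subst \<sigma> u, subst \<sigma> v) \<in> \<theta>"
begin

definition equ (infix "\<approx>" 50) where "u \<approx> v \<longleftrightarrow> (u, v) \<in> \<theta>"

lemma refl [simp]: "u \<approx> u"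
  by (simp add: equ_def refl_in)

lemma sym: "u \<approx> v \<Longrightarrow> v \<approx> u"
  by (simp add: equ_def sym_in)

lemma trans [trans]: "u \<approx> v \<Longrightarrow> v \<approx> v' \<Longrightarrow> u \<approx> v'"
  unfolding equ_def by (rule trans_in)

lemma eq_trans [trans]: "u = v \<Longrightarrow> v \<approx> v' \<Longrightarrow> u \<approx> v'" "u \<approx> v \<Longrightarrow> v = v' \<Longrightarrow> u \<approx> v'"
  by simp_all

lemma ctxt: "u \<approx> v \<Longrightarrow> p @ u @ q \<approx> p @ v @ q"
  by (simp add: equ_def ctxt_in)

lemma subst: "u \<approx> v \<Longrightarrow> subst \<sigma> u \<approx> subst \<sigma> v"
  by (simp add: equ_def subst_in)

lemma append_cong: "u \<approx> v \<Longrightarrow> u' \<approx> v' \<Longrightarrow> u @ u' \<approx> v @ v'"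
  using ctxt [of u v "[]" u'] ctxt [of u' v' v "[]"] trans by simp

end

definition eqth :: "'a monoid set \<Rightarrow> identity set" where
  "eqth X = {e. \<forall>M\<in>X. holds_in e M}"

lemma monoid_homs_free_iff:
  "\<phi> \<in> monoid_homs free_monoid M \<longleftrightarrow>
    (\<forall>u. \<phi> u \<in> carrier M) \<and> \<phi> [] = \<one>\<^bsub>M\<^esub> \<and> (\<forall>u v. \<phi> (u @ v) = \<phi> u \<otimes>\<^bsub>M\<^esub> \<phi> v)"
  by (auto simp: monoid_homs_def hom_def free_monoid_def Pi_def)

lemma monoid_homs_subst:
  "\<phi> \<in> monoid_homs free_monoid M \<Longrightarrow> (\<lambda>u. \<phi> (subst \<sigma> u)) \<in> monoid_homs free_monoid M"
  by (simp add: monoid_homs_free_iff)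

lemma fic_eqth: "fic (eqth X)"
proof
  fix u v p q :: word and \<sigma>
  assume "(u, v) \<in> eqth X"
  then have h: "\<phi> u = \<phi> v" if "M \<in> X" "\<phi> \<in> monoid_homs free_monoid M" for M \<phi>
    using that by (auto simp: eqth_def holds_in_def)
  show "(p @ u @ q, p @ v @ q) \<in> eqth X"
    by (auto simp: eqth_def holds_in_def dest: h) (simp add: h monoid_homs_free_iff)
  show "(subst \<sigma> u, subst \<sigma> v) \<in> eqth X"
    by (auto simp: eqth_def holds_in_def dest: h [OF _ monoid_homs_subst])
qed (auto simp: eqth_def holds_in_def; metis)+

lemma variety_imp_monoid: "variety X \<Longrightarrow> M \<in> X \<Longrightarrow> monoid M"
  by (auto simp: variety_def var_def)

lemma var_eqth: "variety X \<Longrightarrow> var (eqth X) = X"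
  by (auto simp: variety_def var_def eqth_def)

lemma variety_var [simp, intro]: "variety (var \<Sigma>)"
  by (auto simp: variety_def)

lemma subset_var_iff: "variety X \<Longrightarrow> X \<subseteq> var \<Sigma> \<longleftrightarrow> \<Sigma> \<subseteq> eqth X"
  by (auto simp: eqth_def var_def dest: variety_imp_monoid)

lemma subset_eqth_var: "\<Sigma> \<subseteq> eqth (var \<Sigma>)"
  by (auto simp: eqth_def var_def)

lemma eqth_antimono: "X \<subseteq> Y \<Longrightarrow> eqth Y \<subseteq> eqth X"
  by (auto simp: eqth_def)

lemma subset_variety_iff: "variety X \<Longrightarrow> variety Y \<Longrightarrow> X \<subseteq> Y \<longleftrightarrow> eqth Y \<subseteq> eqth X"
  by (metis subset_var_iff var_eqth)

lemma variety_join_upper: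
  "X \<subseteq> variety_join X Y" "Y \<subseteq> variety_join X Y"
  by (auto simp: variety_join_def)

lemma variety_join_least:
  "variety V \<Longrightarrow> X \<subseteq> V \<Longrightarrow> Y \<subseteq> V \<Longrightarrow> variety_join X Y \<subseteq> V"
  by (auto simp: variety_join_def)

text \<open>An upper bound \<open>V\<close> satisfies only identities common to \<open>X\<close> and
  \<open>Y\<close>; hence a monoid satisfying all common identities lies in
  \<open>V\<close>.\<close>

lemma variety_join_eq:
  fixes X Y :: "'a monoid set"
  shows "variety X \<Longrightarrow> variety Y \<Longrightarrow> variety_join X Y = var (eqth X \<inter> eqth Y)"
proof
  assume XY: "variety X" "variety Y"
  show "variety_join X Y \<subseteq> var (eqth X \<inter> eqth Y)"
    using XY by (intro variety_join_least) (simp_all add: subset_var_iff)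
  show "var (eqth X \<inter> eqth Y) \<subseteq> variety_join X Y"
    unfolding variety_join_def
  proof (rule Inter_greatest, clarify)
    fix V and M :: "'a monoid"
    assume "variety V" "X \<subseteq> V" "Y \<subseteq> V" "M \<in> var (eqth X \<inter> eqth Y)"
    moreover from this have "eqth V \<subseteq> eqth X \<inter> eqth Y"
      by (simp add: eqth_antimono)
    ultimately have "M \<in> var (eqth V)" by (auto simp: var_def)
    then show "M \<in> V" using \<open>variety V\<close> by (simp add: var_eqth)
  qed
qed

subsection \<open>Duality\<close>

definition rev_id :: "identity \<Rightarrow> identity" where
  "rev_id e = (rev (fst e), rev (snd e))"

lemma rev_id_simp [simp]: "rev_id (u, v) = (rev u, rev v)"
  by (simp add: rev_id_def)

lemma rev_id_rev_id [simp]: "rev_id (rev_id e) = e"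
  by (simp add: rev_id_def)

text \<open>\<open>f\<close> reverses products and \<open>rev\<close> reverses words, so
  \<open>f\<close> after \<phi> after \<open>rev\<close> is a homomorphism from the free monoid into
  \<open>N\<close>.\<close>

lemma holds_in_anti_iso:
  assumes M: "monoid M" and N: "monoid N" and f: "f \<in> anti_iso M N" and e: "holds_in e N"
  shows "holds_in (rev_id e) M"
  unfolding holds_in_def
proof
  fix \<phi> assume \<phi>: "\<phi> \<in> monoid_homs free_monoid M"
  define \<psi> where "\<psi> = (\<lambda>u. f (\<phi> (rev u)))"
  have "\<psi> \<in> monoid_homs free_monoid N"
    using \<phi> f unfolding monoid_homs_free_iff anti_iso_def \<psi>_def
    by (auto dest: bij_betwE)
  then have "f (\<phi> (rev (fst e))) = f (\<phi> (rev (snd e)))"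
    using e unfolding holds_in_def \<psi>_def by (rule bspec [rotated])
  moreover have "inj_on f (carrier M)" using f by (simp add: anti_iso_def bij_betw_def)
  ultimately show "\<phi> (fst (rev_id e)) = \<phi> (snd (rev_id e))"
    using \<phi> by (simp add: rev_id_def inj_on_def monoid_homs_free_iff)
qed

text \<open>The opposite monoid keeps the carrier, so the monoid that \<open>dual\<close> asks for
  is found in the same type.\<close>

definition opp :: "'a monoid \<Rightarrow> 'a monoid" where
  "opp M = \<lparr>carrier = carrier M, monoid.mult = (\<lambda>a b. b \<otimes>\<^bsub>M\<^esub> a), one = \<one>\<^bsub>M\<^esub>\<rparr>"

lemma monoid_opp: "monoid M \<Longrightarrow> monoid (opp M)"
  by (rule monoidI) (simp_all add: opp_def monoid.m_assoc monoid.m_closed monoid.one_closed)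

lemma id_anti_iso_opp: "(\<lambda>a. a) \<in> anti_iso M (opp M)" "(\<lambda>a. a) \<in> anti_iso (opp M) M"
  by (auto simp: anti_iso_def opp_def bij_betw_def)

lemma dual_var: "dual (var \<Sigma>) = var (rev_id ` \<Sigma>)"
proof (rule subset_antisym; rule subsetI)
  fix M :: "'a monoid" assume "M \<in> dual (var \<Sigma>)"
  then obtain N :: "'a monoid" and f
    where "monoid M" "monoid N" "f \<in> anti_iso M N" "\<forall>e\<in>\<Sigma>. holds_in e N"
    unfolding dual_def var_def by blast
  then show "M \<in> var (rev_id ` \<Sigma>)"
    by (auto simp: var_def intro: holds_in_anti_iso)
next
  fix M :: "'a monoid" assume M: "M \<in> var (rev_id ` \<Sigma>)"
  then have "monoid M" by (simp add: var_def)
  moreover have "opp M \<in> var \<Sigma>"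
    unfolding var_def
  proof (intro CollectI conjI ballI)
    show "monoid (opp M)" by (rule monoid_opp [OF \<open>monoid M\<close>])
    fix e assume "e \<in> \<Sigma>"
    then have "holds_in (rev_id e) M" using M by (simp add: var_def)
    then show "holds_in e (opp M)"
      using holds_in_anti_iso [OF monoid_opp [OF \<open>monoid M\<close>] \<open>monoid M\<close> id_anti_iso_opp(2)]
      by fastforce
  qed
  ultimately show "M \<in> dual (var \<Sigma>)"
    using id_anti_iso_opp(1) by (fastforce simp: dual_def)
qed

lemma subst_rev: "subst \<sigma> (rev u) = rev (subst (\<lambda>c. rev (\<sigma> c)) u)"
  by (induction u) auto

text \<open>Reversal turns a substitution into the one with reversed values
  (\<open>subst_rev\<close>). This yields a congruence for dual E from the one used for E.\<close>

lemma fic_rev: "fic \<theta> \<Longrightarrow> fic (rev_id ` \<theta>)"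
proof -
  assume "fic \<theta>"
  then interpret fic \<theta> .
  have iff: "(u, v) \<in> rev_id ` \<theta> \<longleftrightarrow> (rev u, rev v) \<in> \<theta>" for u v
    by (metis (no_types, lifting) image_iff rev_id_rev_id rev_id_simp)
  show ?thesis
  proof
    fix u v p q and \<sigma> assume "(u, v) \<in> rev_id ` \<theta>"
    then have uv: "(rev u, rev v) \<in> \<theta>" by (simp add: iff)
    show "(p @ u @ q, p @ v @ q) \<in> rev_id ` \<theta>"
      using ctxt_in [OF uv, of "rev q" "rev p"] by (simp add: iff)
    show "(subst \<sigma> u, subst \<sigma> v) \<in> rev_id ` \<theta>"
      using subst_in [OF uv, of "\<lambda>c. rev (\<sigma> c)"] by (simp add: iff subst_rev)
  qed (auto simp: iff refl_in intro: sym_in trans_in)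
qed

subsection \<open>Equational completeness\<close>

instance letter :: countable
  by countable_datatype

text \<open>The quotient of the free monoid by \<theta>, with each class named by a chosen word.
  Words are countably many, so they can be coded injectively in the infinite type
  \<open>'a\<close>.\<close>

lemma fic_is_eqth:
  assumes "fic \<theta>"
  shows "\<exists>M :: 'a::infinite monoid. monoid M \<and> (\<forall>u v. holds_in (u, v) M \<longleftrightarrow> (u, v) \<in> \<theta>)"
proof -
  interpret fic \<theta> by fact
  obtain h0 :: "nat \<Rightarrow> 'a" where h0: "inj h0"
    using infinite_countable_subset [OF infinite_UNIV] by blast
  define h :: "word \<Rightarrow> 'a" where "h = h0 \<circ> to_nat"
  have h: "inj h" unfolding h_def using h0 by (simp add: inj_compose)
  define rep where "rep u = (SOME v. u \<approx> v)" for u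
  have rep: "u \<approx> rep u" for u unfolding rep_def by (rule someI [of _ u]) simp
  have rep_eq: "rep u = rep v \<longleftrightarrow> u \<approx> v" for u v
  proof
    assume "rep u = rep v"
    then show "u \<approx> v" using rep [of u] rep [of v] by (metis sym trans)
  next
    assume "u \<approx> v"
    then have "(\<lambda>x. u \<approx> x) = (\<lambda>x. v \<approx> x)" by (metis sym trans)
    then show "rep u = rep v" by (simp add: rep_def)
  qed
  have rep_app: "rep (rep u @ rep v) = rep (u @ v)" for u v
    unfolding rep_eq by (rule append_cong) (simp_all add: rep sym)
  have rep_app1: "rep (rep u @ v) = rep (u @ v)" "rep (u @ rep v) = rep (u @ v)" for u v
    unfolding rep_eq by (auto intro: append_cong simp: rep sym)
  have rep_rep: "rep (rep u) = rep u" for u by (simp add: rep_eq rep sym)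
  define M :: "'a monoid" where "M = \<lparr>carrier = h ` range rep,
    monoid.mult = (\<lambda>a b. h (rep (inv_into UNIV h a @ inv_into UNIV h b))), one = h (rep [])\<rparr>"
  have M: "monoid M"
    by (rule monoidI) (auto simp: M_def inv_f_f [OF h] rep_app rep_app1 rep_rep)
  have univ: "(\<lambda>u. h (rep (subst \<sigma> u))) \<in> monoid_homs free_monoid M" for \<sigma>
    by (auto simp: monoid_homs_free_iff M_def inv_f_f [OF h] rep_app)
  have "holds_in (u, v) M \<longleftrightarrow> (u, v) \<in> \<theta>" for u v
  proof
    assume hold: "holds_in (u, v) M"
    have "subst (\<lambda>c. [c]) u = u" for u by (induction u) auto
    then have "h (rep u) = h (rep v)"
      using hold univ [of "\<lambda>c. [c]"] unfolding holds_in_def by fastforce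
    then show "(u, v) \<in> \<theta>" using h by (simp add: inj_eq rep_eq equ_def)
  next
    assume uv: "(u, v) \<in> \<theta>"
    show "holds_in (u, v) M"
      unfolding holds_in_def
    proof
      fix \<phi> assume \<phi>: "\<phi> \<in> monoid_homs free_monoid M"
      \<comment> \<open>Choosing a word for the value of each letter writes \<phi> as the projection
        to classes after a substitution; invariance of \<theta> under substitutions then
        applies.\<close>
      define \<sigma> where "\<sigma> c = inv_into UNIV h (\<phi> [c])" for c
      have "\<phi> u = h (rep (subst \<sigma> u))" for u
      proof (induction u)
        case Nil
        show ?case using \<phi> by (simp add: monoid_homs_free_iff M_def)
      next
        case (Cons c u)
        have "\<phi> ([c] @ u) = \<phi> [c] \<otimes>\<^bsub>M\<^esub> \<phi> u" "\<phi> [c] \<in> carrier M"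
          using \<phi> unfolding monoid_homs_free_iff by blast+
        then show ?case using Cons by (simp add: M_def inv_f_f [OF h] rep_app1 \<sigma>_def)
      qed
      then show "\<phi> (fst (u, v)) = \<phi> (snd (u, v))"
        using subst_in [OF uv, of \<sigma>] by (metis rep_eq equ_def fst_conv snd_conv)
    qed
  qed
  with M show ?thesis by blast
qed

text \<open>This reduces every non-inclusion between varieties to a computation with words.\<close>

lemma var_not_subset:
  assumes "fic \<theta>" "\<Sigma> \<subseteq> \<theta>" "e \<in> \<Sigma>'" "e \<notin> \<theta>"
  shows "\<not> (var \<Sigma> :: 'a::infinite monoid set) \<subseteq> var \<Sigma>'"
proof -
  obtain M :: "'a monoid" where "monoid M" "\<forall>u v. holds_in (u, v) M \<longleftrightarrow> (u, v) \<in> \<theta>"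
    using fic_is_eqth [OF \<open>fic \<theta>\<close>] by blast
  then have M: "monoid M" and holds: "\<And>e. holds_in e M \<longleftrightarrow> e \<in> \<theta>" by auto
  with assms have "M \<in> var \<Sigma>" "M \<notin> var \<Sigma>'" unfolding var_def mem_Collect_eq holds by blast+
  then show ?thesis by blast
qed

text \<open>The largest fully invariant congruence for which \<open>L\<close> is a union of classes.
  The substitution is quantified because compatibility with contexts alone would not give full
  invariance.\<close>

definition syn :: "word set \<Rightarrow> identity set" where
  "syn L = {(u, v). \<forall>p q \<sigma>. p @ subst \<sigma> u @ q \<in> L \<longleftrightarrow> p @ subst \<sigma> v @ q \<in> L}"

lemma subst_subst: "subst \<sigma> (subst \<tau> u) = subst (\<lambda>c. subst \<sigma> (\<tau> c)) u"
  by (induction u) auto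

lemma fic_syn: "fic (syn L)"
proof
  fix u v p q and \<sigma> assume uv: "(u, v) \<in> syn L"
  then have h: "p @ subst \<sigma> u @ q \<in> L \<longleftrightarrow> p @ subst \<sigma> v @ q \<in> L" for p q \<sigma>
    by (simp add: syn_def)
  show "(p @ u @ q, p @ v @ q) \<in> syn L"
    using h [of "p' @ subst \<sigma> p" \<sigma> "subst \<sigma> q @ q'" for p' q' \<sigma>] by (simp add: syn_def)
  show "(subst \<sigma> u, subst \<sigma> v) \<in> syn L"
    by (simp add: syn_def subst_subst h)
qed (auto simp: syn_def)

subsection \<open>Counting occurrences\<close>

abbreviation occ :: "'b list \<Rightarrow> 'b \<Rightarrow> nat" where "occ \<equiv> count_list"

abbreviation simple :: "'b list \<Rightarrow> 'b \<Rightarrow> bool" where "simple u x \<equiv> occ u x = 1"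

abbreviation multiple :: "'b list \<Rightarrow> 'b \<Rightarrow> bool" where "multiple u x \<equiv> 2 \<le> occ u x"

text \<open>\<open>cb u y x\<close> counts the occurrences of \<open>x\<close> before the first \<open>y\<close>.\<close>

primrec cb :: "'b list \<Rightarrow> 'b \<Rightarrow> 'b \<Rightarrow> nat" where
  "cb [] y x = 0"
| "cb (c # u) y x = (if c = y then 0 else (if c = x then 1 else 0) + cb u y x)"

lemma count_list_Cons: "occ (c # u) x = (if c = x then 1 else 0) + occ u x"
  by simp

declare count_list.simps(2) [simp del] count_list_Cons [simp]

lemma count_list_filter: "occ (filter P u) x = (if P x then occ u x else 0)"
  by (induction u) auto

lemma cb_append:
  "cb (p @ q) y x = (if y \<in> set p then cb p y x else occ p x + cb q y x)"
  by (induction p) auto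

lemma cb_le_count: "cb u y x \<le> occ u x"
  by (induction u) auto

lemma cb_self [simp]: "cb u x x = 0"
  by (induction u) auto

lemma cb_notin: "y \<notin> set u \<Longrightarrow> cb u y x = occ u x"
  by (induction u) auto

lemma occ_pos: "0 < occ u x \<longleftrightarrow> x \<in> set u"
  by (metis count_list_0_iff gr0I neq0_conv)

lemma count_list_ge2E:
  assumes "multiple p x"
  obtains p1 p2 p3 where "p = p1 @ x # p2 @ x # p3" "x \<notin> set p1" "x \<notin> set p2"
proof -
  have "x \<in> set p" using assms by (simp add: occ_pos [symmetric])
  then obtain p1 r where p: "p = p1 @ x # r" "x \<notin> set p1" by (meson split_list_first)
  then have "0 < occ r x" using assms by simp
  then have "x \<in> set r" by (simp add: occ_pos)
  then obtain p2 p3 where "r = p2 @ x # p3" "x \<notin> set p2" by (meson split_list_first)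
  with p that show thesis by blast
qed

text \<open>
  \<open>parted u x y\<close>: some simple letter lies after the last \<open>x\<close> and before the second \<open>y\<close>.
  \<open>spread u x\<close>: some simple letter lies between the first and the second \<open>x\<close>.
\<close>

definition parted :: "'b list \<Rightarrow> 'b \<Rightarrow> 'b \<Rightarrow> bool" where
  "parted u x y \<longleftrightarrow> (\<exists>s. simple u s \<and> \<not> cb u s x < occ u x \<and> cb u s y \<le> 1)"

definition spread :: "'b list \<Rightarrow> 'b \<Rightarrow> bool" where
  "spread u x \<longleftrightarrow> (\<exists>s. simple u s \<and> cb u s x = 1)"

text \<open>These data decide the identities of F join dual E: counts, and positions relative to
  simple letters, truncated at 2, and whether a simple letter is followed by \<open>x\<close>. H, I
  and J see in addition some of the order among multiple letters.\<close>

definition agree0 :: "'b list \<Rightarrow> 'b list \<Rightarrow> bool" where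
  "agree0 u v \<longleftrightarrow>
    (\<forall>x. min 2 (occ u x) = min 2 (occ v x)) \<and>
    (\<forall>s x. simple u s \<longrightarrow> min 2 (cb u s x) = min 2 (cb v s x) \<and>
      (cb u s x < occ u x \<longleftrightarrow> cb v s x < occ v x))"

text \<open>\<open>K1\<close> guards the comparison of the first \<open>x\<close> with the first
  \<open>y\<close>, and \<open>K2\<close> that of the first two \<open>x\<close> with the first
  \<open>y\<close>. The guards are read off \<open>u\<close> alone; this is harmless since they will
  be invariant under \<open>agree0\<close>.\<close>

definition agree ::
  "('b list \<Rightarrow> 'b \<Rightarrow> 'b \<Rightarrow> bool) \<Rightarrow> ('b list \<Rightarrow> 'b \<Rightarrow> 'b \<Rightarrow> bool) \<Rightarrow> 'b list \<Rightarrow> 'b list \<Rightarrow> bool" where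
  "agree K1 K2 u v \<longleftrightarrow> agree0 u v \<and>
    (\<forall>x y. x \<noteq> y \<longrightarrow> multiple u x \<longrightarrow> multiple u y \<longrightarrow>
      (K1 u x y \<longrightarrow> (cb u y x = 0 \<longleftrightarrow> cb v y x = 0)) \<and>
      (K2 u x y \<longrightarrow> min 2 (cb u y x) = min 2 (cb v y x)))"

lemma agree_first:
  "agree K1 K2 u v \<Longrightarrow> x \<noteq> y \<Longrightarrow> multiple u x \<Longrightarrow> multiple u y \<Longrightarrow> K1 u x y \<Longrightarrow>
    cb u y x = 0 \<longleftrightarrow> cb v y x = 0"
  by (simp add: agree_def)

lemma agree_second:
  "agree K1 K2 u v \<Longrightarrow> x \<noteq> y \<Longrightarrow> multiple u x \<Longrightarrow> multiple u y \<Longrightarrow> K2 u x y \<Longrightarrow>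
    min 2 (cb u y x) = min 2 (cb v y x)"
  by (simp add: agree_def)

lemma agree0_refl [simp]: "agree0 u u"
  by (simp add: agree0_def)

lemma min2_eq: "min 2 (a :: nat) = min 2 b \<Longrightarrow> (a = 1 \<longleftrightarrow> b = 1) \<and> (2 \<le> a \<longleftrightarrow> 2 \<le> b) \<and> (a = 0 \<longleftrightarrow> b = 0)"
  by (simp add: min_def split: if_splits)

lemma agree0_count: "agree0 u v \<Longrightarrow> min 2 (occ u x) = min 2 (occ v x)"
  unfolding agree0_def by blast

lemma agree0_simple: "agree0 u v \<Longrightarrow> simple u s \<longleftrightarrow> simple v s"
  using min2_eq [OF agree0_count [of u v s]] by blast

lemma agree0_multiple: "agree0 u v \<Longrightarrow> multiple u s \<longleftrightarrow> multiple v s"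
  using min2_eq [OF agree0_count [of u v s]] by blast

lemma agree0_cb: "agree0 u v \<Longrightarrow> simple u s \<Longrightarrow> min 2 (cb u s x) = min 2 (cb v s x)"
  unfolding agree0_def by blast

lemma agree0_after:
  "agree0 u v \<Longrightarrow> simple u s \<Longrightarrow> cb u s x < occ u x \<longleftrightarrow> cb v s x < occ v x"
  unfolding agree0_def by blast

lemma agree0_sym: "agree0 u v \<Longrightarrow> agree0 v u"
proof -
  assume uv: "agree0 u v"
  show "agree0 v u"
    unfolding agree0_def agree0_simple [OF uv, symmetric]
    using agree0_count [OF uv] agree0_cb [OF uv] agree0_after [OF uv] by metis
qed

lemma agree0_trans: "agree0 u v \<Longrightarrow> agree0 v z \<Longrightarrow> agree0 u z"
proof -
  assume uv: "agree0 u v" and vz: "agree0 v z"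
  have "simple v s" if "simple u s" for s
    using that agree0_simple [OF uv] by blast
  then show "agree0 u z"
    unfolding agree0_def
    using agree0_count [OF uv] agree0_cb [OF uv] agree0_after [OF uv]
      agree0_count [OF vz] agree0_cb [OF vz] agree0_after [OF vz] by metis
qed

text \<open>\<open>parted\<close> and \<open>spread\<close> speak only of simple letters and of data
  that \<open>agree0\<close> preserves, so guards built from them keep their truth value while a
  word is rewritten.\<close>

lemma agree0_parted: "agree0 u v \<Longrightarrow> parted u x y \<longleftrightarrow> parted v x y"
proof -
  have "parted v x y" if "agree0 u v" "parted u x y" for u v
  proof -
    from \<open>parted u x y\<close> obtain s where s: "simple u s" "\<not> cb u s x < occ u x" "cb u s y \<le> 1"
      by (auto simp: parted_def)
    then have "simple v s" "\<not> cb v s x < occ v x"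
      "min 2 (cb u s y) = min 2 (cb v s y)"
      using agree0_simple [OF \<open>agree0 u v\<close>] agree0_after [OF \<open>agree0 u v\<close>]
        agree0_cb [OF \<open>agree0 u v\<close>] by blast+
    with s show ?thesis unfolding parted_def by (intro exI [of _ s]) auto
  qed
  then show "agree0 u v \<Longrightarrow> parted u x y \<longleftrightarrow> parted v x y" using agree0_sym by blast
qed

lemma agree0_spread: "agree0 u v \<Longrightarrow> spread u x \<longleftrightarrow> spread v x"
proof -
  have "spread v x" if "agree0 u v" "spread u x" for u v
  proof -
    from \<open>spread u x\<close> obtain s where s: "simple u s" "cb u s x = 1"
      by (auto simp: spread_def)
    then have "simple v s" "min 2 (cb u s x) = min 2 (cb v s x)"
      using agree0_simple [OF \<open>agree0 u v\<close>] agree0_cb [OF \<open>agree0 u v\<close>] by blast+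
    with s show ?thesis unfolding spread_def by (intro exI [of _ s]) auto
  qed
  then show "agree0 u v \<Longrightarrow> spread u x \<longleftrightarrow> spread v x" using agree0_sym by blast
qed

text \<open>Exchanging two multiple letters moves nothing across a simple letter.\<close>

lemma agree0_swap:
  assumes "multiple (p @ x # y # q) x" "multiple (p @ x # y # q) y"
  shows "agree0 (p @ x # y # q) (p @ y # x # q)"
proof (cases "x = y")
  case False
  have c: "occ (p @ x # y # q) = occ (p @ y # x # q)" by auto
  have "cb (p @ x # y # q) s z = cb (p @ y # x # q) s z" if "s \<noteq> x" "s \<noteq> y" for s z
    using that by (auto simp: cb_append)
  moreover have "s \<noteq> x" "s \<noteq> y" if "simple (p @ x # y # q) s" for s
    using that assms by auto
  ultimately show ?thesis unfolding agree0_def c by simp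
qed simp

subsection \<open>Consequences of the axioms of J\<close>

definition ax_J :: "identity set" where
  "ax_J = Phi \<union> {([LX,LY,LX,LZ 0,LT 0,LX], [LX,LY,LX,LZ 0,LX,LT 0,LX])}
     \<union> {(w n \<pi>, w' n \<pi>) | n \<pi>. n \<ge> 1 \<and> \<pi> permutes {1..n}}"

lemma var_J_eq: "var_J = var ax_J"
  by (simp add: var_J_def ax_J_def)

lemma Phi_ax_J: "Phi \<subseteq> ax_J"
  unfolding ax_J_def by blast

text \<open>Ignoring the index lets one substitution instantiate both the axioms written with index
  0 and the case n = 1 of the w-identities, written with index 1.\<close>

definition pat :: "word \<Rightarrow> word \<Rightarrow> word \<Rightarrow> word \<Rightarrow> letter \<Rightarrow> word" where
  "pat X Y Z T l = (case l of LX \<Rightarrow> X | LY \<Rightarrow> Y | LZ _ \<Rightarrow> Z | LT _ \<Rightarrow> T)"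

lemma pat_simps [simp]:
  "pat X Y Z T LX = X" "pat X Y Z T LY = Y" "pat X Y Z T (LZ i) = Z" "pat X Y Z T (LT i) = T"
  by (simp_all add: pat_def)

text \<open>Among the subvarieties of J this identity characterizes those contained in E join dual
  E.\<close>

abbreviation id_double :: identity where
  "id_double \<equiv> ([LX,LX,LT 0,LX], [LX,LT 0,LX])"

text \<open>In the same way, this one characterizes those contained in F join dual E.\<close>

abbreviation id_swap :: identity where
  "id_swap \<equiv> ([LX,LY,LZ 0,LX,LT 0,LY], [LY,LX,LZ 0,LX,LT 0,LY])"

context fic
begin

lemma inst:
  "(u, v) \<in> \<theta> \<Longrightarrow> p @ subst (pat X Y Z T) u @ q \<approx> p @ subst (pat X Y Z T) v @ q"
  by (intro ctxt subst) (simp add: equ_def)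

end

lemma concat_map_concat_map: "concat (map f (concat (map g xs))) = concat (map (\<lambda>x. concat (map f (g x))) xs)"
  by (induction xs) auto

text \<open>Prepares the substitution into the w-identities: each pair of \<open>ps\<close> supplies
  the values of one t_i and one z_i, and \<open>r\<close> is left over.\<close>

lemma subsequence_decomposition:
  "mset W \<subseteq># mset q \<Longrightarrow> \<exists>ps r. q = concat (map (\<lambda>(t, z). t @ [z]) ps) @ r \<and> mset (map snd ps) = mset W"
proof (induction q arbitrary: W)
  case Nil
  then show ?case by (intro exI [of _ "[]"]) auto
next
  case (Cons c q)
  show ?case
  proof (cases "c \<in> set W")
    case True
    have "mset (remove1 c W) \<subseteq># mset q" using Cons.prems by (simp add: subset_eq_diff_conv)
    from Cons.IH [OF this] obtain ps r
      where "q = concat (map (\<lambda>(t, z). t @ [z]) ps) @ r" "mset (map snd ps) = mset (remove1 c W)"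
      by blast
    then show ?thesis using True by (intro exI [of _ "([], c) # ps"] exI [of _ r]) simp
  next
    case False
    have "count (mset W) a \<le> count (mset q) a" for a
      using mset_subset_eq_count [OF Cons.prems, of a] False
      by (cases "a = c") (auto simp: count_eq_zero_iff [THEN iffD2])
    then have "mset W \<subseteq># mset q" by (rule mset_subset_eqI)
    from Cons.IH [OF this] obtain ps r
      where ps: "q = concat (map (\<lambda>(t, z). t @ [z]) ps) @ r" "mset (map snd ps) = mset W"
      by blast
    show ?thesis
    proof (cases ps)
      case Nil
      then show ?thesis using ps by (intro exI [of _ "[]"] exI [of _ "c # q"]) simp
    next
      case (Cons a ps')
      then show ?thesis using ps
        by (intro exI [of _ "(c # fst a, snd a) # ps'"] exI [of _ r]) (auto split: prod.splits)
    qed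
  qed
qed

locale J_theory = fic +
  assumes J: "ax_J \<subseteq> \<theta>"
begin

lemma ax1: "p @ X @ Y @ X @ q \<approx> p @ X @ Y @ X @ X @ q"
proof -
  have "([LX,LY,LX], [LX,LY,LX,LX]) \<in> Phi" by (simp add: Phi_def)
  then show ?thesis using inst [of _ _ p X Y "[]" "[]" q] J Phi_ax_J by fastforce
qed

lemma ax2: "p @ X @ X @ Y @ Y @ q \<approx> p @ Y @ Y @ X @ X @ q"
proof -
  have "([LX,LX,LY,LY], [LY,LY,LX,LX]) \<in> Phi" by (simp add: Phi_def)
  then show ?thesis using inst [of _ _ p X Y "[]" "[]" q] J Phi_ax_J by fastforce
qed

lemma ax3: "p @ X @ Y @ Z @ X @ Y @ q \<approx> p @ Y @ X @ Z @ X @ Y @ q"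
proof -
  have "([LX,LY,LZ 0,LX,LY], [LY,LX,LZ 0,LX,LY]) \<in> Phi" by (simp add: Phi_def)
  then show ?thesis using inst [of _ _ p X Y Z "[]" q] J Phi_ax_J by fastforce
qed

lemma ax4: "p @ X @ Y @ X @ Z @ T @ X @ q \<approx> p @ X @ Y @ X @ Z @ X @ T @ X @ q"
proof -
  have "([LX,LY,LX,LZ 0,LT 0,LX], [LX,LY,LX,LZ 0,LX,LT 0,LX]) \<in> ax_J" unfolding ax_J_def by blast
  then show ?thesis using inst [of _ _ p X Y Z T q] J by fastforce
qed

lemma ax_common: "Phi \<union> {([LX,LY,LX,LZ 0,LT 0,LX], [LX,LY,LX,LZ 0,LX,LT 0,LX])} \<subseteq> \<theta>"
  using J unfolding ax_J_def by blast

lemma ax_w: "1 \<le> n \<Longrightarrow> \<pi> permutes {1..n} \<Longrightarrow> (w n \<pi>, w' n \<pi>) \<in> \<theta>"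
  using J unfolding ax_J_def by blast

lemma w1: "p @ X @ Z @ X @ T @ Z @ q \<approx> p @ X @ X @ Z @ T @ Z @ q"
  using inst [OF ax_w [of 1 id], of p X Y Z T q] by (simp add: w_def w'_def permutes_id)

text \<open>The letters of \<open>W\<close> reappear in \<open>q\<close>, possibly in another order.
  The permutation relating the two orders picks the axiom w_n[\<pi>], and the stretches of
  \<open>q\<close> between these letters are the values of the t_i.\<close>

lemma w_general:
  assumes "mset W \<subseteq># mset q"
  shows "p @ x # W @ x # q \<approx> p @ x # x # W @ q"
proof (cases "W = []")
  case False
  obtain ps r where q: "q = concat (map (\<lambda>(t, z). t @ [z]) ps) @ r" and "mset (map snd ps) = mset W"
    using subsequence_decomposition [OF assms] by blast
  then obtain f where f: "f permutes {..<length ps}" "permute_list f (map snd ps) = W"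
    by (metis mset_eq_permutation length_map)
  define n where "n = length ps"
  have n: "1 \<le> n" using f False by (cases ps) (auto simp: n_def permute_list_def)
  \<comment> \<open>\<open>f\<close> permutes 0, ..., n - 1, whereas the axioms number their letters
    from 1; hence the shift, with 0 fixed.\<close>
  define \<pi> where "\<pi> i = (case i of 0 \<Rightarrow> 0 | Suc j \<Rightarrow> Suc (f j))" for i
  have \<pi>: "\<pi> permutes {1..n}"
    unfolding permutes_def
  proof (intro conjI allI impI)
    fix i show "i \<notin> {1..n} \<Longrightarrow> \<pi> i = i"
      using f(1) by (auto simp: \<pi>_def permutes_def n_def split: nat.split)
    show "\<exists>!j. \<pi> j = i"
    proof (cases i)
      case 0
      then show ?thesis by (intro ex1I [of _ 0]) (auto simp: \<pi>_def split: nat.splits)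
    next
      case (Suc k)
      obtain j where j: "f j = k" "\<And>j'. f j' = k \<Longrightarrow> j' = j"
        using f(1) unfolding permutes_def by metis
      show ?thesis
      proof (rule ex1I [of _ "Suc j"])
        show "\<pi> (Suc j) = i" using Suc j(1) by (simp add: \<pi>_def)
        fix j' assume "\<pi> j' = i"
        then show "j' = Suc j" using Suc j(2) by (cases j') (auto simp: \<pi>_def)
      qed
    qed
  qed
  define \<sigma> where "\<sigma> l = (case l of LX \<Rightarrow> [x] | LY \<Rightarrow> [] | LZ i \<Rightarrow> [snd (ps ! (i - 1))]
    | LT i \<Rightarrow> fst (ps ! (i - 1)))" for l
  have \<sigma>: "subst \<sigma> (map (\<lambda>i. LZ (\<pi> i)) [1..<Suc n]) = W"
  proof -
    have "subst \<sigma> (map (\<lambda>i. LZ (\<pi> i)) [1..<Suc n]) = map (\<lambda>i. snd (ps ! f i)) [0..<n]"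
      unfolding subst_def One_nat_def map_Suc_upt [symmetric] map_map
      by (simp add: \<sigma>_def \<pi>_def o_def concat_map_singleton del: upt_Suc)
    also have "\<dots> = permute_list f (map snd ps)"
      using permutes_in_image [OF f(1)] by (simp add: permute_list_def n_def)
    finally show ?thesis using f by simp
  qed
  have \<sigma>': "subst \<sigma> (concat (map (\<lambda>i. [LT i, LZ i]) [1..<Suc n])) @ r = q"
  proof -
    have "subst \<sigma> (concat (map (\<lambda>i. [LT i, LZ i]) [1..<Suc n]))
      = concat (map (\<lambda>i. subst \<sigma> [LT i, LZ i]) [1..<Suc n])"
      unfolding subst_def by (rule concat_map_concat_map)
    also have "\<dots> = concat (map (\<lambda>i. (\<lambda>(t, z). t @ [z]) (ps ! i)) [0..<n])"
      unfolding One_nat_def map_Suc_upt [symmetric] map_map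
      by (simp add: \<sigma>_def o_def split_beta del: upt_Suc)
    also have "map (\<lambda>i. (\<lambda>(t, z). t @ [z]) (ps ! i)) [0..<n] = map (\<lambda>(t, z). t @ [z]) ps"
      unfolding n_def by (rule nth_equalityI) auto
    finally show ?thesis by (simp add: q)
  qed
  have "p @ subst \<sigma> (w n \<pi>) @ r \<approx> p @ subst \<sigma> (w' n \<pi>) @ r"
    by (intro ctxt subst) (unfold equ_def, rule ax_w [OF n \<pi>])
  moreover have "\<sigma> LX = [x]" by (simp add: \<sigma>_def)
  ultimately show ?thesis using \<sigma> \<sigma>' by (simp add: w_def w'_def del: upt_Suc)
qed simp

lemma dup: "x \<in> set p \<Longrightarrow> p @ x # q \<approx> p @ x # x # q"
  using ax1 [of _ "[x]" _ q] by (fastforce dest: split_list)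

text \<open>Non-first occurrences can be squared by \<open>dup\<close>, and squares commute by
  \<open>ax2\<close>.\<close>

lemma nonfirst_commute:
  assumes "x \<in> set p" "y \<in> set p"
  shows "p @ x # y # q \<approx> p @ y # x # q"
proof -
  have "p @ x # y # q \<approx> p @ x # x # y # q" by (rule dup) fact
  also have "\<dots> \<approx> p @ x # x # y # y # q" using dup [of y "p @ [x, x]" q] assms by simp
  also have "\<dots> \<approx> p @ y # y # x # x # q" using ax2 [of p "[x]" "[y]"] by simp
  also have "\<dots> \<approx> p @ y # x # x # q" by (rule sym, rule dup) fact
  also have "\<dots> \<approx> p @ y # x # q" using sym [OF dup [of x "p @ [y]" q]] assms by simp
  finally show ?thesis .
qed

lemma insert_between:
  assumes "multiple p x" "x \<in> set q"
  shows "p @ q \<approx> p @ x # q"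
proof -
  obtain p1 p2 p3 where "p = p1 @ x # p2 @ x # p3" using assms(1) by (rule count_list_ge2E)
  moreover obtain q1 q2 where "q = q1 @ x # q2" using assms(2) by (meson split_list)
  ultimately show ?thesis using ax4 [of p1 "[x]" p2 p3 q1 q2] by simp
qed

text \<open>The copy of \<open>x\<close> passes \<open>W\<close> letter by letter. It commutes with
  a letter that has occurred before, and it passes a first occurrence by \<open>w1\<close>, since
  that letter must reappear in \<open>q\<close>.\<close>

lemma insert_block:
  assumes "x \<in> set p" "\<forall>c\<in>set W. multiple (p @ x # W @ q) c"
  shows "p @ x # W @ q \<approx> p @ x # W @ x # q"
  using assms(2)
proof (induction W arbitrary: q rule: rev_induct)
  case Nil
  show ?case using dup [OF assms(1)] by simp
next
  case (snoc c W)
  let ?P = "p @ x # W"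
  have IH: "?P @ c # q \<approx> ?P @ x # c # q" using snoc by auto
  show ?case
  proof (cases "c = x \<or> c \<in> set ?P")
    case True
    then have "?P @ x # c # q \<approx> ?P @ c # x # q"
      using nonfirst_commute [of x ?P c q] by auto
    with IH show ?thesis using trans by fastforce
  next
    case False
    then have "c \<in> set q" using snoc.prems by (auto simp: occ_pos [symmetric])
    then obtain t q' where q: "q = t @ c # q'" by (meson split_list)
    have "?P @ c # q \<approx> ?P @ x # c # q" by (rule IH)
    also have "?P @ x # c # q \<approx> ?P @ x # x # c # q" using dup [of x ?P] by simp
    also have "\<dots> \<approx> ?P @ x # c # x # q"
      using sym [OF w1 [of ?P "[x]" "[c]" t q']] q by simp
    \<comment> \<open>Now \<open>c\<close> has an \<open>x\<close> on both sides; the left one is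
      removed by the induction hypothesis read backwards.\<close>
    also have "\<dots> \<approx> ?P @ c # x # q"
    proof -
      have "occ (p @ x # (W @ [c]) @ q) d \<le> occ (p @ x # W @ c # x # q) d" for d
        by simp
      then have "\<forall>d\<in>set W. multiple (p @ x # W @ c # x # q) d"
        using snoc.prems by (metis (no_types, lifting) UnI1 order_trans set_append)
      from sym [OF snoc.IH [OF this]] show ?thesis by simp
    qed
    finally show ?thesis by simp
  qed
qed

end

section \<open>Inserting copies and swapping adjacent occurrences\<close>

context J_theory
begin

text \<open>If no \<open>x\<close> follows, all letters after the last \<open>x\<close> of
  \<open>p\<close> are multiple, so \<open>insert_block\<close> carries a copy over them; the last
  \<open>x\<close> is not the first one because \<open>p\<close> contains two.\<close>

lemma insert_letter:
  assumes x: "multiple p x"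
    and q: "x \<in> set q \<or> (\<forall>s\<in>set p. simple (p @ q) s \<longrightarrow> cb p s x < occ p x)"
  shows "p @ q \<approx> p @ x # q"
proof (cases "x \<in> set q")
  case True
  then show ?thesis using insert_between x by blast
next
  case False
  have "x \<in> set p" using x by (simp add: occ_pos [symmetric])
  then obtain a W where p: "p = a @ x # W" "x \<notin> set W" by (meson split_list_last)
  have "0 < occ a x" using x p by (simp add: count_notin)
  then have a: "x \<in> set a" by (simp add: occ_pos)
  have "multiple (p @ q) c" if "c \<in> set W" for c
  proof (rule ccontr)
    assume less: "\<not> multiple (p @ q) c"
    have "c \<noteq> x" using p that by blast
    have "0 < occ W c" using that by (simp add: occ_pos)
    then have one: "simple (p @ q) c" "occ a c = 0" using less p \<open>c \<noteq> x\<close> by auto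
    then have "c \<notin> set a" by (simp add: count_list_0_iff)
    then have "cb p c x = occ p x"
      using p that \<open>c \<noteq> x\<close> by (simp add: cb_append cb_notin count_notin) (metis p(2) cb_le_count count_notin le_zero_eq)
    moreover have "c \<in> set p" using p that by simp
    ultimately show False using q False one(1) by auto
  qed
  then show ?thesis using insert_block [OF a, of W q] p by simp
qed

text \<open>The rule \<open>ax3\<close> needs a later factor in which both letters are adjacent. It
  is made by inserting a copy of \<open>a\<close> in front of the second \<open>b\<close>; the only
  obstruction is a simple letter after the last \<open>a\<close> and before that
  \<open>b\<close>.\<close>

lemma swap_via_copy:
  assumes ab: "(a, b) = (x, y) \<or> (a, b) = (y, x)" and xy: "x \<noteq> y"
    and a: "multiple (p @ x # y # q1) a" and b: "occ (p @ x # y # q1) b \<le> 1"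
    and mult: "multiple (p @ x # y # q1 @ b # q2) b"
    and R: "\<not> parted (p @ x # y # q1 @ b # q2) a b"
  shows "p @ x # y # q1 @ b # q2 \<approx> p @ y # x # q1 @ b # q2"
proof -
  let ?P = "p @ x # y # q1" and ?P' = "p @ y # x # q1" and ?Q = "b # q2"
  have c: "occ ?P' = occ ?P" by auto
  have sp: "set ?P' = set ?P" by auto
  have ma: "multiple (?P @ ?Q) a" using a by (auto split: if_splits)
  have ne: "s \<noteq> x" "s \<noteq> y" if "simple (?P @ ?Q) s" for s
    using that ma mult ab by auto
  have cb': "cb ?P' s z = cb ?P s z" if "simple (?P @ ?Q) s" for s z
    using ne [OF that] by (simp add: cb_append)
  \<comment> \<open>An obstruction to inserting \<open>a\<close> would be a simple letter witnessing
    \<open>parted\<close>.\<close>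
  have key: "a \<in> set ?Q \<or> (\<forall>s\<in>set ?P. simple (?P @ ?Q) s \<longrightarrow> cb ?P s a < occ ?P a)"
  proof (rule ccontr)
    assume "\<not> ?thesis"
    then obtain s where s: "a \<notin> set ?Q" "s \<in> set ?P" "simple (?P @ ?Q) s"
      "\<not> cb ?P s a < occ ?P a" by blast
    have "cb (?P @ ?Q) s a = cb ?P s a" "cb (?P @ ?Q) s b = cb ?P s b"
      using s(2) by (auto simp: cb_append)
    moreover have "occ (?P @ ?Q) a = occ ?P a"
      using s(1) by (auto simp: count_notin)
    moreover have "cb ?P s b \<le> 1" using b cb_le_count [of ?P s b] by linarith
    ultimately have "parted (?P @ ?Q) a b"
      using s unfolding parted_def by (intro exI [of _ s]) simp
    with R show False by simp
  qed
  have "?P @ ?Q \<approx> ?P @ a # ?Q" by (rule insert_letter) fact+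
  also have "?P @ a # ?Q \<approx> ?P' @ a # ?Q"
    using ab ax3 [of p "[x]" "[y]" q1 q2] sym [OF ax3 [of p "[y]" "[x]" q1 q2]] by auto
  also have "?P' @ a # ?Q \<approx> ?P' @ ?Q"
  proof (rule sym, rule insert_letter)
    show "multiple ?P' a" using a c by simp
    show "a \<in> set ?Q \<or> (\<forall>s\<in>set ?P'. simple (?P' @ ?Q) s \<longrightarrow> cb ?P' s a < occ ?P' a)"
      using key cb' unfolding c sp count_list_append by auto
  qed
  finally show ?thesis by simp
qed

lemma swap_unparted:
  assumes xy: "x \<noteq> y"
    and "multiple (p @ x # y # q) x" "multiple (p @ x # y # q) y"
    and "\<not> parted (p @ x # y # q) x y" "\<not> parted (p @ x # y # q) y x"
  shows "p @ x # y # q \<approx> p @ y # x # q"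
proof -
  have step: ?thesis
    if "(a, b) = (x, y) \<or> (a, b) = (y, x)" "b \<notin> set p" "a \<in> set p \<or> a \<in> set q1"
      "q = q1 @ b # q2" "b \<notin> set q1" for a b q1 q2
  proof -
    have "0 < occ p a \<or> 0 < occ q1 a" using that by (auto simp: occ_pos)
    moreover have "occ p b = 0" "occ q1 b = 0" using that by (auto simp: count_notin)
    ultimately have "multiple (p @ x # y # q1) a" "occ (p @ x # y # q1) b \<le> 1"
      using that(1) xy by auto
    then show ?thesis
      using swap_via_copy [OF that(1) xy] assms that by auto
  qed
  have in_q: "z \<in> set q" if "z = x \<or> z = y" "z \<notin> set p" for z
  proof -
    have "0 < occ q z" using assms(1-3) that by (auto simp: count_notin)
    then show ?thesis by (simp add: occ_pos)
  qed
  consider "x \<in> set p" "y \<in> set p" | "x \<in> set p" "y \<notin> set p" | "x \<notin> set p" "y \<in> set p"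
    | "x \<notin> set p" "y \<notin> set p" by blast
  then show ?thesis
  proof cases
    case 1
    then show ?thesis by (rule nonfirst_commute)
  next
    case 2
    then obtain q1 q2 where "q = q1 @ y # q2" "y \<notin> set q1"
      using in_q [of y] by (meson split_list_first)
    with 2 show ?thesis by (intro step [of x y q1 q2]) auto
  next
    case 3
    then obtain q1 q2 where "q = q1 @ x # q2" "x \<notin> set q1"
      using in_q [of x] by (meson split_list_first)
    with 3 show ?thesis by (intro step [of y x q1 q2]) auto
  next
    case 4
    then obtain q1 q2 where x: "q = q1 @ x # q2" "x \<notin> set q1"
      using in_q [of x] by (meson split_list_first)
    from 4 obtain r1 r2 where y: "q = r1 @ y # r2" "y \<notin> set r1"
      using in_q [of y] by (meson split_list_first)
    \<comment> \<open>The letter that reappears first has occurred twice by the time the other one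
      reappears, so it is the one to be copied.\<close>
    have "y \<in> set q1 \<or> x \<in> set r1"
      using x y xy by (auto simp: append_eq_append_conv2 Cons_eq_append_conv append_eq_Cons_conv)
    with 4 x y show ?thesis using step [of y x q1 q2] step [of x y r1 r2] by blast
  qed
qed

text \<open>A copy of \<open>y\<close> can be inserted to the left of \<open>x\<close> because
  \<open>y\<close> has occurred twice; the \<open>y\<close> after \<open>x\<close> then becomes
  redundant by \<open>insert_block\<close>.\<close>

lemma swap_third:
  assumes "multiple p y" "multiple (p @ x # y # q) x"
  shows "p @ x # y # q \<approx> p @ y # x # q"
proof (cases "x = y")
  case False
  have "y \<in> set p" using assms(1) by (simp add: occ_pos [symmetric])
  have "p @ x # y # q \<approx> p @ y # x # y # q"
    using insert_between [OF assms(1), of "x # y # q"] by simp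
  also have "\<dots> \<approx> p @ y # x # q"
    using sym [OF insert_block [of y p "[x]" q]] assms(2) \<open>y \<in> set p\<close> False by simp
  finally show ?thesis .
qed simp

text \<open>The last occurrence of a letter of \<open>G\<close> in \<open>p @ V\<close> lies in
  \<open>V\<close> and is not its first one, so \<open>insert_block\<close> carries a copy to the
  end of \<open>V\<close>.\<close>

lemma insert_copies:
  assumes "\<forall>c\<in>set G. c \<in> set V \<and> multiple (p @ V) c" "\<forall>c\<in>set V. multiple (p @ V @ q) c"
  shows "p @ V @ q \<approx> p @ V @ G @ q"
  using assms
proof (induction G arbitrary: V)
  case (Cons g G)
  have "p @ V @ q \<approx> p @ V @ g # q"
  proof -
    have "g \<in> set V" using Cons.prems by simp
    then obtain V1 V2 where V: "V = V1 @ g # V2" "g \<notin> set V2" by (meson split_list_last)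
    have "0 < occ (p @ V1) g" using Cons.prems(1) V by (auto simp: count_notin)
    then have "g \<in> set (p @ V1)" by (simp only: occ_pos)
    then show ?thesis using insert_block [of g "p @ V1" V2 q] V Cons.prems(2) by auto
  qed
  also have "p @ V @ g # q \<approx> p @ V @ g # G @ q"
  proof -
    have le: "occ (p @ V) c \<le> occ (p @ V @ [g]) c"
      "occ (p @ V @ q) c \<le> occ (p @ (V @ [g]) @ q) c" for c by auto
    have "p @ (V @ [g]) @ q \<approx> p @ (V @ [g]) @ G @ q"
    proof (rule Cons.IH)
      show "\<forall>c\<in>set G. c \<in> set (V @ [g]) \<and> multiple (p @ V @ [g]) c"
        using Cons.prems(1) le(1) by (auto intro: order_trans)
      show "\<forall>c\<in>set (V @ [g]). multiple (p @ (V @ [g]) @ q) c"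
      proof
        fix c assume "c \<in> set (V @ [g])"
        then have "c \<in> set V" using Cons.prems(1) by auto
        then show "multiple (p @ (V @ [g]) @ q) c" using Cons.prems(2) le(2) order_trans by blast
      qed
    qed
    then show ?thesis by simp
  qed
  finally show ?case by simp
qed simp

text \<open>Further copies of letters of \<open>W\<close> are inserted after the second \<open>y\<close> until \<open>w_general\<close> applies.\<close>

lemma pull_second:
  assumes W: "\<forall>c\<in>set W. multiple (p @ y # W @ y # q) c"
  shows "p @ y # W @ y # q \<approx> p @ y # y # W @ q"
proof -
  \<comment> \<open>Letters of \<open>W\<close> seen only once before the second \<open>y\<close>
    reappear in \<open>q\<close> anyway; only the others need an extra copy.\<close>
  define G where "G = filter (\<lambda>c. multiple (p @ y # W) c) W"
  have y: "multiple (p @ y # W @ y # q) y" by simp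
  have "occ W c \<le> occ (G @ q) c" for c
  proof (cases "multiple (p @ y # W) c \<or> c \<notin> set W")
    case True
    then show ?thesis by (auto simp: G_def count_list_filter count_notin)
  next
    case False
    then have "multiple (p @ y # W @ y # q) c" "0 < occ W c"
      using W by (auto simp: occ_pos)
    with False show ?thesis by (auto split: if_splits)
  qed
  then have sub: "mset W \<subseteq># mset (G @ q)" by (intro mset_subset_eqI) (simp add: count_mset)
  have G: "c \<in> set W" "multiple (p @ y # W) c" if "c \<in> set G" for c
    using that by (auto simp: G_def)
  have "p @ y # W @ y # q \<approx> p @ y # W @ y # G @ q"
  proof -
    have "multiple (p @ y # W @ [y]) c" if "c \<in> set G" for c
      using G(2) [OF that] by simp
    moreover have "\<forall>c\<in>set (y # W @ [y]). multiple (p @ (y # W @ [y]) @ q) c"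
      using W by simp
    ultimately show ?thesis using insert_copies [of G "y # W @ [y]" p q] G(1) by simp
  qed
  also have "\<dots> \<approx> p @ y # y # W @ G @ q" by (rule w_general [OF sub])
  also have "\<dots> \<approx> p @ y # y # W @ q"
  proof -
    have "multiple (p @ y # y # W) c" if "c \<in> set G" for c
      using G(2) [OF that] by simp
    moreover have "\<forall>c\<in>set (y # y # W). multiple (p @ (y # y # W) @ q) c"
      using W by auto
    ultimately show ?thesis using sym [OF insert_copies [of G "y # y # W" p q]] G(1) by simp
  qed
  finally show ?thesis .
qed

text \<open>With no simple letter between the first two \<open>y\<close>, the second one can be
  pulled back to the first and then released again in front of \<open>x\<close>.\<close>

lemma swap_second:
  assumes "x \<notin> set p" "y \<in> set p" "multiple (p @ x # y # q) x"
    and "\<not> spread (p @ x # y # q) y"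
  shows "p @ x # y # q \<approx> p @ y # x # q"
proof (cases "multiple p y")
  case True
  then show ?thesis using swap_third assms(3) by blast
next
  case False
  obtain p1 W where p: "p = p1 @ y # W" "y \<notin> set p1" using assms(2) by (meson split_list_first)
  have p1: "occ p1 y = 0" using p by (simp add: count_notin)
  have yW: "y \<notin> set W" using False p by (simp add: occ_pos [symmetric])
  have W: "multiple (p @ x # y # q) c" if "c \<in> set (W @ [x])" for c
  proof (rule ccontr)
    assume less: "\<not> multiple (p @ x # y # q) c"
    then have "c \<noteq> x" using assms(3) by blast
    then have c: "c \<in> set W" "c \<noteq> y" using that yW by auto
    then have "0 < occ W c" by (simp add: occ_pos)
    then have 1: "simple (p @ x # y # q) c" "occ p1 c = 0"
      using less p \<open>c \<noteq> x\<close> \<open>c \<noteq> y\<close> by auto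
    then have "c \<notin> set p1" by (simp add: count_list_0_iff)
    then have "cb (p @ x # y # q) c y = 1"
      using c p p1 yW cb_le_count [of W c y] by (simp add: cb_append count_notin)
    with 1 assms(4) show False by (auto simp: spread_def)
  qed
  have "\<forall>c\<in>set (W @ [x]). multiple (p1 @ y # (W @ [x]) @ y # q) c"
    using W p by (simp add: add_ac)
  from pull_second [OF this] have "p @ x # y # q \<approx> p1 @ y # y # W @ x # q"
    using p by simp
  also have "\<dots> \<approx> p1 @ y # W @ y # x # q"
    using sym [OF pull_second [of W p1 y "x # q"]] W p by (auto simp: add_ac)
  finally show ?thesis using p by simp
qed

section \<open>Reduction to at most three occurrences of a letter\<close>

lemma delete_agree:
  assumes x: "multiple p x"
    and q: "x \<in> set q \<or> (\<forall>s\<in>set p. simple (p @ q) s \<longrightarrow> cb p s x < occ p x)"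
  shows "agree0 (p @ x # q) (p @ q)" "min 2 (cb (p @ x # q) y z) = min 2 (cb (p @ q) y z)"
proof -
  have "x \<in> set p" using x by (simp add: occ_pos [symmetric])
  then show cb: "min 2 (cb (p @ x # q) y z) = min 2 (cb (p @ q) y z)" for y z
    using x by (auto simp: cb_append)
  show "agree0 (p @ x # q) (p @ q)"
    unfolding agree0_def
  proof (intro conjI allI impI cb)
    fix z show "min 2 (occ (p @ x # q) z) = min 2 (occ (p @ q) z)"
      using x by auto
    fix s assume s: "simple (p @ x # q) s"
    then have "s \<noteq> x" using x by auto
    then have s': "simple (p @ q) s" using s by simp
    have "cb p s x < occ p x \<or> x \<in> set q" if "s \<in> set p"
      using q s' that by auto
    then show "cb (p @ x # q) s z < occ (p @ x # q) z \<longleftrightarrow> cb (p @ q) s z < occ (p @ q) z"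
      using \<open>s \<noteq> x\<close> cb_le_count [of p s x] by (auto simp: cb_append occ_pos [symmetric])
  qed
qed

text \<open>Past the second occurrence only one thing stays visible: after which simple letters
  \<open>x\<close> still occurs. The last occurrence alone records this, as a third one, and it is
  kept only if a simple letter separates it from the second.\<close>

lemma reduce:
  "\<exists>u'. u \<approx> u' \<and> agree0 u u' \<and> (\<forall>x y. min 2 (cb u y x) = min 2 (cb u' y x)) \<and>
    (\<forall>x. occ u' x \<le> 3 \<and>
      (occ u' x = 3 \<longrightarrow> (\<exists>s. simple u' s \<and> cb u' s x = 2)))"
proof (induction u rule: length_induct)
  case (1 u)
  show ?case
  proof (cases "\<forall>x. occ u x \<le> 3 \<and>
      (occ u x = 3 \<longrightarrow> (\<exists>s. simple u s \<and> cb u s x = 2))")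
    case True
    then show ?thesis by (intro exI [of _ u]) auto
  next
    case False
    then obtain x where x: "3 < occ u x \<or>
      occ u x = 3 \<and> (\<forall>s. simple u s \<longrightarrow> cb u s x \<noteq> 2)"
      by (metis not_le)
    then have "multiple u x" by auto
    then obtain p1 p2 p3 where u: "u = p1 @ x # p2 @ x # p3" "x \<notin> set p1" "x \<notin> set p2"
      by (rule count_list_ge2E)
    then have p3: "occ u x = 2 + occ p3 x" by (simp add: count_notin)
    then have "0 < occ p3 x" using x by auto
    then have "x \<in> set p3" by (simp add: occ_pos)
    then obtain r q where r: "p3 = r @ x # q" "x \<notin> set r" by (meson split_list_first)
    define p where "p = p1 @ x # p2 @ x # r"
    have up: "u = p @ x # q" using u r by (simp add: p_def)
    have px: "occ p x = 2" using u r by (simp add: p_def count_notin)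
    have key: "x \<in> set q \<or> (\<forall>s\<in>set p. simple (p @ q) s \<longrightarrow> cb p s x < occ p x)"
    proof (rule ccontr)
      assume *: "\<not> ?thesis"
      then obtain s where s: "s \<in> set p" "simple (p @ q) s" "\<not> cb p s x < occ p x"
        by blast
      have "occ u x = 3" using px up * by (simp add: count_notin)
      moreover have "s \<noteq> x" using s px by auto
      then have "simple u s" "cb u s x = 2"
        using s px up cb_le_count [of p s x] by (auto simp: cb_append)
      ultimately show False using x by auto
    qed
    have 2: "multiple p x" using px by simp
    have "length (p @ q) < length u" using up by simp
    with 1 obtain u' where u': "p @ q \<approx> u'" "agree0 (p @ q) u'"
      "\<forall>x y. min 2 (cb (p @ q) y x) = min 2 (cb u' y x)"
      "\<forall>x. occ u' x \<le> 3 \<and>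
        (occ u' x = 3 \<longrightarrow> (\<exists>s. simple u' s \<and> cb u' s x = 2))" by blast
    have "u \<approx> u'" using trans [OF sym [OF insert_letter [OF 2 key]] u'(1)] up by simp
    moreover have "agree0 u u'" using agree0_trans [OF delete_agree(1) [OF 2 key] u'(2)] up by simp
    moreover have "\<forall>x y. min 2 (cb u y x) = min 2 (cb u' y x)"
      using delete_agree(2) [OF 2 key] u'(3) up by simp
    ultimately show ?thesis using u'(4) by blast
  qed
qed

end

text \<open>
  \<open>K1\<close> and \<open>K2\<close> tell for which letters \<open>x\<close>, \<open>y\<close> the first, respectively the second, occurrence of \<open>x\<close>
  cannot be moved over the first occurrence of \<open>y\<close>.
\<close>

locale sortable = J_theory +
  fixes K1 K2 :: "word \<Rightarrow> letter \<Rightarrow> letter \<Rightarrow> bool"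
  assumes K1_agree0: "agree0 u v \<Longrightarrow> K1 u x y = K1 v x y"
    and K2_agree0: "agree0 u v \<Longrightarrow> K2 u x y = K2 v x y"
    and swap_first: "x \<noteq> y \<Longrightarrow> x \<notin> set p \<Longrightarrow> y \<notin> set p \<Longrightarrow> x \<in> set q \<Longrightarrow> y \<in> set q \<Longrightarrow>
      \<not> K1 (p @ x # y # q) x y \<Longrightarrow> \<not> K1 (p @ x # y # q) y x \<Longrightarrow> p @ x # y # q \<approx> p @ y # x # q"
    and swap_nonfirst: "x \<noteq> y \<Longrightarrow> x \<notin> set p \<Longrightarrow> y \<in> set p \<Longrightarrow> x \<in> set q \<Longrightarrow>
      \<not> K2 (p @ x # y # q) y x \<Longrightarrow> p @ x # y # q \<approx> p @ y # x # q"
begin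

text \<open>One step of bubble sort: \<open>b\<close>, which comes next in \<open>v\<close>, passes
  the \<open>c\<close> in front of it. If a guard holds, agreement with \<open>v\<close> forces so
  many occurrences into \<open>p\<close> that the swap does not touch the guarded ones.\<close>

lemma sort_step:
  assumes u: "u = p @ e @ c # b # f" and v: "v = p @ b # v'" and "b \<noteq> c" "b \<notin> set e"
    and cnt: "\<And>x. occ u x = occ v x" "\<And>x. occ u x \<le> 3"
    and agr: "agree K1 K2 u v"
  shows "u \<approx> p @ e @ b # c # f" "agree K1 K2 (p @ e @ b # c # f) v"
proof -
  let ?P = "p @ e" and ?u' = "p @ e @ b # c # f"
  have a0: "agree0 u v" using agr by (simp add: agree_def)
  have e: "occ e b = 0" using \<open>b \<notin> set e\<close> by (simp add: count_notin)
  have cb_ub: "cb u b c = (if b \<in> set p then cb p b c else occ ?P c + 1)"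
    using u \<open>b \<notin> set e\<close> \<open>b \<noteq> c\<close> by (auto simp: cb_append)
  have cb_vb: "cb v b c = (if b \<in> set p then cb p b c else occ p c)"
    using v by (auto simp: cb_append)
  have "cb e c b = 0" using cb_le_count [of e c b] e by simp
  then have cb_uc: "cb u c b = (if c \<in> set p then cb p c b else occ p b)"
    using u by (auto simp: cb_append e)
  have cb_vc: "cb v c b = (if c \<in> set p then cb p c b else occ p b + 1 + cb v' c b)"
    using v \<open>b \<noteq> c\<close> by (auto simp: cb_append)
  have cu: "occ u c = occ p c + occ e c + 1 + occ f c"
    "occ u b = occ p b + 1 + occ f b"
    using u e \<open>b \<noteq> c\<close> by auto
  have cv: "occ v c = occ p c + occ v' c"
    using v \<open>b \<noteq> c\<close> by auto
  \<comment> \<open>Here the bound 3 enters. If \<open>b\<close> were simple, agreement up to 2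
    would put two \<open>c\<close> into \<open>p\<close>; the \<open>c\<close> before
    \<open>b\<close> in \<open>u\<close> would then be the third and last one, whereas
    \<open>v\<close> has a \<open>c\<close> after \<open>b\<close>.\<close>
  have mb: "multiple u b"
  proof (rule ccontr)
    assume "\<not> multiple u b"
    then have b: "simple u b" "occ p b = 0" using cu by auto
    then have "b \<notin> set p" by (simp add: count_list_0_iff)
    then have "min 2 (occ p c + occ e c + 1) = min 2 (occ p c)"
      and "occ p c + occ e c + 1 < occ u c \<longleftrightarrow> occ p c < occ v c"
      using agree0_cb [OF a0 b(1), of c] agree0_after [OF a0 b(1), of c] cb_ub cb_vb by auto
    then show False using cnt(1) [of c] cnt(2) [of c] cu(1) by (auto simp: min_def split: if_splits)
  qed
  have mc: "multiple u c"
  proof (rule ccontr)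
    assume "\<not> multiple u c"
    then have c: "simple u c" "occ p c = 0" using cu by auto
    then have "c \<notin> set p" by (simp add: count_list_0_iff)
    then have "min 2 (occ p b) = min 2 (occ p b + 1 + cb v' c b)"
      and "occ p b < occ u b \<longleftrightarrow> occ p b + 1 + cb v' c b < occ v b"
      using agree0_cb [OF a0 c(1), of b] agree0_after [OF a0 c(1), of b] cb_uc cb_vc by auto
    then show False using cnt(1) [of b] cnt(2) [of b] cu(2) by (auto simp: min_def split: if_splits)
  qed
  have sw0: "agree0 u ?u'" using agree0_swap [of ?P c b f] mb mc u by simp
  \<comment> \<open>Under a guard the counts in \<open>u\<close> and \<open>v\<close> agree, which
    forces the relevant occurrences of \<open>c\<close> or \<open>b\<close> to lie in
    \<open>p\<close> already. The next three facts are the variants of this.\<close>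
  have K1cb: "occ p c \<noteq> 0" if "K1 u c b" "b \<notin> set p"
  proof -
    have "cb u b c = 0 \<longleftrightarrow> cb v b c = 0"
      using agree_first [OF agr _ mc mb that(1)] \<open>b \<noteq> c\<close> by blast
    then show ?thesis using cb_ub cb_vb that(2) by simp
  qed
  have K2cb: "multiple p c" if "K2 u c b" "b \<notin> set p"
  proof -
    have "min 2 (cb u b c) = min 2 (cb v b c)"
      using agree_second [OF agr _ mc mb that(1)] \<open>b \<noteq> c\<close> by blast
    then show ?thesis using cb_ub cb_vb that(2) by (auto simp: min_def split: if_splits)
  qed
  have K1bc: "occ p b \<noteq> 0" if "K1 u b c" "c \<notin> set p"
  proof -
    have "cb u c b = 0 \<longleftrightarrow> cb v c b = 0"
      using agree_first [OF agr _ mb mc that(1)] \<open>b \<noteq> c\<close> by blast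
    then show ?thesis using cb_uc cb_vc that(2) by simp
  qed
  have K2bc: "multiple p b" if "K2 u b c" "c \<notin> set p"
  proof -
    have "min 2 (cb u c b) = min 2 (cb v c b)"
      using agree_second [OF agr _ mb mc that(1)] \<open>b \<noteq> c\<close> by blast
    then show ?thesis using cb_uc cb_vc that(2) by (auto simp: min_def split: if_splits)
  qed
  have ge: "occ p z \<le> occ ?P z" for z by simp
  have in_f: "z \<in> set f" if "z = b \<or> z = c" "z \<notin> set ?P" for z
  proof -
    have "occ p z = 0" "occ e z = 0" using that(2) by (auto simp: count_notin)
    then have "0 < occ f z" using that(1) mb mc cu by auto
    then show ?thesis by (simp add: occ_pos)
  qed
  show "u \<approx> ?u'"
  proof -
    consider "b \<in> set ?P" "c \<in> set ?P" | "b \<in> set ?P" "c \<notin> set ?P" | "b \<notin> set ?P" "c \<in> set ?P"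
      | "b \<notin> set ?P" "c \<notin> set ?P" by blast
    then have "?P @ c # b # f \<approx> ?P @ b # c # f"
    proof cases
      case 1
      then show ?thesis by (intro nonfirst_commute)
    next
      case 2
      show ?thesis
      proof (cases "K2 u b c")
        case True
        then have "multiple ?P b" using K2bc 2 ge [of b] by auto
        then show ?thesis using swap_third [of ?P b c f] mc u by simp
      next
        case False
        then show ?thesis using swap_nonfirst [of c b ?P f] 2 in_f \<open>b \<noteq> c\<close> u by auto
      qed
    next
      case 3
      show ?thesis
      proof (cases "K2 u c b")
        case True
        then have "multiple ?P c" using K2cb 3 ge [of c] by auto
        then show ?thesis using sym [OF swap_third [of ?P c b f]] mb u by simp
      next
        case False
        then have "\<not> K2 ?u' c b" using K2_agree0 [OF sw0] by simp
        then show ?thesis using sym [OF swap_nonfirst [of b c ?P f]] 3 in_f \<open>b \<noteq> c\<close> by auto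
      qed
    next
      case 4
      then have "\<not> K1 u b c" "\<not> K1 u c b" using K1bc K1cb by (auto simp: count_notin)
      then show ?thesis using swap_first [of c b ?P f] 4 in_f \<open>b \<noteq> c\<close> u by auto
    qed
    then show ?thesis using u by simp
  qed
  show "agree K1 K2 ?u' v"
    unfolding agree_def
  proof (intro conjI allI impI)
    show "agree0 ?u' v" using agree0_trans [OF agree0_sym [OF sw0] a0] .
    fix x y assume xy: "x \<noteq> y" "multiple ?u' x" "multiple ?u' y"
    then have m: "multiple u x" "multiple u y"
      using agree0_multiple [OF sw0] by auto
    have bc: "b \<notin> set p \<Longrightarrow> cb ?u' b c = occ ?P c" "c \<notin> set ?P \<Longrightarrow> cb ?u' c b = occ p b + 1"
      using \<open>b \<notin> set e\<close> \<open>b \<noteq> c\<close> e by (auto simp: cb_append)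
    \<comment> \<open>The swap changes a count only if it involves the first \<open>b\<close> or the
      first \<open>c\<close>.\<close>
    have same: "cb ?u' y x = cb u y x"
      if "\<not> (y = b \<and> x = c \<and> b \<notin> set p)" "\<not> (y = c \<and> x = b \<and> c \<notin> set ?P)"
      using that u \<open>b \<notin> set e\<close> \<open>b \<noteq> c\<close> by (auto simp: cb_append)
    show "cb ?u' y x = 0 \<longleftrightarrow> cb v y x = 0" if "K1 ?u' x y"
    proof -
      have K: "K1 u x y" using that K1_agree0 [OF sw0] by simp
      then have "cb u y x = 0 \<longleftrightarrow> cb v y x = 0" by (rule agree_first [OF agr xy(1) m])
      moreover have ?thesis if h: "y = b" "x = c" "b \<notin> set p"
      proof -
        have "cb ?u' y x = occ ?P c" "cb v y x = occ p c"
          using bc(1) cb_vb h by simp_all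
        moreover have "occ p c \<noteq> 0" using K1cb K h by simp
        ultimately show ?thesis by simp
      qed
      moreover have ?thesis if h: "y = c" "x = b" "c \<notin> set ?P"
        using bc(2) cb_vc h by simp
      ultimately show ?thesis using same by metis
    qed
    show "min 2 (cb ?u' y x) = min 2 (cb v y x)" if "K2 ?u' x y"
    proof -
      have K: "K2 u x y" using that K2_agree0 [OF sw0] by simp
      then have "min 2 (cb u y x) = min 2 (cb v y x)" by (rule agree_second [OF agr xy(1) m])
      moreover have ?thesis if h: "y = b" "x = c" "b \<notin> set p"
      proof -
        have "cb ?u' y x = occ ?P c" "cb v y x = occ p c"
          using bc(1) cb_vb h by simp_all
        moreover have "multiple p c" using K2cb K h by simp
        ultimately show ?thesis by (simp add: min_def)
      qed
      moreover have ?thesis if h: "y = c" "x = b" "c \<notin> set ?P"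
      proof -
        have "cb ?u' y x = occ p b + 1" "cb v y x = occ p b + 1 + cb v' c b"
          using bc(2) cb_vc h by simp_all
        moreover have "multiple p b" using K2bc K h by simp
        ultimately show ?thesis by (simp add: min_def)
      qed
      ultimately show ?thesis using same by metis
    qed
  qed
qed

text \<open>The common prefix \<open>p\<close> grows: the next letter of \<open>v\<close> is carried
  to it from its first occurrence in \<open>u\<close>.\<close>

lemma sort:
  assumes "\<And>x. occ (p @ u) x = occ (p @ v) x" "\<And>x. occ (p @ u) x \<le> 3"
    and "agree K1 K2 (p @ u) (p @ v)"
  shows "p @ u \<approx> p @ v"
  using assms
proof (induction v arbitrary: p u)
  case Nil
  have "occ u (hd u) = 0" using Nil.prems(1) [of "hd u"] by simp
  then have "u = []" by (cases u) auto
  then show ?case by simp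
next
  case (Cons b v)
  have "0 < occ u b" using Cons.prems(1) [of b] by simp
  then have "b \<in> set u" by (simp add: occ_pos)
  then obtain e f where ef: "u = e @ b # f" "b \<notin> set e" by (meson split_list_first)
  have *: "p @ e @ b # f \<approx> p @ b # e @ f \<and> agree K1 K2 (p @ b # e @ f) (p @ b # v)"
    if "\<And>x. occ (p @ e @ b # f) x = occ (p @ b # v) x"
      "\<And>x. occ (p @ e @ b # f) x \<le> 3"
      "agree K1 K2 (p @ e @ b # f) (p @ b # v)" "b \<notin> set e" for e f
    using that
  proof (induction e arbitrary: f rule: rev_induct)
    case (snoc c e)
    note step = sort_step [OF HOL.refl HOL.refl, of b c e p f v]
    have 1: "p @ e @ c # b # f \<approx> p @ e @ b # c # f" "agree K1 K2 (p @ e @ b # c # f) (p @ b # v)"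
      using snoc.prems by (auto intro!: step simp: add_ac)
    have "p @ e @ b # c # f \<approx> p @ b # e @ c # f \<and> agree K1 K2 (p @ b # e @ c # f) (p @ b # v)"
      using snoc.prems 1 by (intro snoc.IH) (auto simp: add_ac)
    with trans [OF 1(1)] show ?case by simp
  qed simp
  have 2: "p @ u \<approx> (p @ [b]) @ e @ f" "agree K1 K2 ((p @ [b]) @ e @ f) ((p @ [b]) @ v)"
    using * [of e f] Cons.prems ef by simp_all
  have c: "occ ((p @ [b]) @ e @ f) x = occ (p @ u) x" for x using ef by simp
  have "(p @ [b]) @ e @ f \<approx> (p @ [b]) @ v"
  proof (rule Cons.IH)
    show "occ ((p @ [b]) @ e @ f) x = occ ((p @ [b]) @ v) x" for x
      using Cons.prems(1) [of x] unfolding c by simp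
    show "occ ((p @ [b]) @ e @ f) x \<le> 3" for x
      using Cons.prems(2) unfolding c .
  qed fact
  with trans [OF 2(1)] show ?case by simp
qed

theorem complete:
  assumes "agree K1 K2 u v"
  shows "u \<approx> v"
proof -
  from reduce [of u] obtain u' where u': "u \<approx> u'" "agree0 u u'" "\<And>x y. min 2 (cb u y x) = min 2 (cb u' y x)"
    "\<And>x. occ u' x \<le> 3"
    "\<And>x. occ u' x = 3 \<Longrightarrow> \<exists>s. simple u' s \<and> cb u' s x = 2"
    by (elim exE conjE) auto
  from reduce [of v] obtain v' where v': "v \<approx> v'" "agree0 v v'" "\<And>x y. min 2 (cb v y x) = min 2 (cb v' y x)"
    "\<And>x. occ v' x \<le> 3"
    "\<And>x. occ v' x = 3 \<Longrightarrow> \<exists>s. simple v' s \<and> cb v' s x = 2"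
    by (elim exE conjE) auto
  have uv: "agree0 u v" using assms by (simp add: agree_def)
  have a0: "agree0 u' v'"
    using agree0_trans [OF agree0_trans [OF agree0_sym [OF u'(2)] uv] v'(2)] .
  \<comment> \<open>In a reduced word a third occurrence is separated from the second by a simple
    letter, and \<open>agree0\<close> transfers this to the other word. Hence the two reduced words
    have equal counts, as sorting requires.\<close>
  have three: "occ b x = 3"
    if "agree0 a b" "\<And>x. occ a x = 3 \<Longrightarrow> \<exists>s. simple a s \<and> cb a s x = 2"
      "occ b x \<le> 3" "occ a x = 3" for a b :: word and x
  proof -
    from that(2) [OF that(4)] obtain s where s: "simple a s" "cb a s x = 2" by blast
    then have "2 \<le> cb b s x" using agree0_cb [OF that(1) s(1), of x] by (auto simp: min_def split: if_splits)
    moreover have "cb b s x < occ b x" using agree0_after [OF that(1) s(1), of x] that s by simp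
    ultimately show ?thesis using that(3) by simp
  qed
  have cnt: "occ u' x = occ v' x" for x
  proof -
    have "occ v' x = 3" if "occ u' x = 3"
      using three [OF a0 _ v'(4) that] u'(5) by blast
    moreover have "occ u' x = 3" if "occ v' x = 3"
      using three [OF agree0_sym [OF a0] _ u'(4) that] v'(5) by blast
    moreover note agree0_count [OF a0, of x] u'(4) [of x] v'(4) [of x]
    ultimately show ?thesis by linarith
  qed
  have "agree K1 K2 u' v'"
    unfolding agree_def
  proof (intro conjI allI impI a0)
    fix x y assume xy: "x \<noteq> y" "multiple u' x" "multiple u' y"
    then have m: "multiple u x" "multiple u y"
      using agree0_multiple [OF u'(2)] by auto
    show "cb u' y x = 0 \<longleftrightarrow> cb v' y x = 0" if "K1 u' x y"
    proof -
      have "K1 u x y" using that K1_agree0 [OF u'(2)] by blast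
      then have "cb u y x = 0 \<longleftrightarrow> cb v y x = 0" by (rule agree_first [OF assms xy(1) m])
      then show ?thesis using min2_eq [OF u'(3) [of y x]] min2_eq [OF v'(3) [of y x]] by simp
    qed
    show "min 2 (cb u' y x) = min 2 (cb v' y x)" if "K2 u' x y"
    proof -
      have "K2 u x y" using that K2_agree0 [OF u'(2)] by blast
      then have "min 2 (cb u y x) = min 2 (cb v y x)" by (rule agree_second [OF assms xy(1) m])
      then show ?thesis using u'(3) v'(3) by simp
    qed
  qed
  then have "u' \<approx> v'" using sort [of "[]" u' v'] cnt u'(4) by simp
  then show ?thesis using u'(1) sym [OF v'(1)] trans by blast
qed

end

subsection \<open>Axioms and inclusions\<close>

definition ax_T :: "identity set" where "ax_T = {([LX], [])}"

definition ax_SL :: "identity set" where "ax_SL = {([LX], [LX,LX]), ([LX,LY], [LY,LX])}"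

definition ax_C :: "identity set" where
  "ax_C = {([LX,LX], [LX,LX,LX]), ([LX,LY], [LY,LX])}"

definition ax_D :: "identity set" where
  "ax_D = {([LX,LX], [LX,LX,LX]), ([LX,LX,LY], [LX,LY,LX]), ([LX,LY,LX], [LY,LX,LX])}"

definition ax_E :: "identity set" where
  "ax_E = {([LX,LX], [LX,LX,LX]), ([LX,LX,LY], [LX,LY,LX]), ([LX,LX,LY,LY], [LY,LY,LX,LX])}"

definition ax_dE :: "identity set" where
  "ax_dE = {([LX,LX], [LX,LX,LX]), ([LY,LX,LX], [LX,LY,LX]), ([LY,LY,LX,LX], [LX,LX,LY,LY])}"

definition ax_F :: "identity set" where
  "ax_F = Phi \<union> {([LX,LY,LX,LZ 0], [LX,LY,LX,LZ 0,LX])}"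

definition ax_H :: "identity set" where
  "ax_H = Phi \<union> {([LX,LY,LX,LZ 0,LT 0,LX], [LX,LY,LX,LZ 0,LX,LT 0,LX]),
                   ([LX,LX,LY,LT 0,LY], [LX,LY,LX,LT 0,LY]),
                   ([LX,LY,LX,LT 0,LY], [LY,LX,LX,LT 0,LY])}"

definition ax_I :: "identity set" where
  "ax_I = Phi \<union> {([LX,LY,LX,LZ 0,LT 0,LX], [LX,LY,LX,LZ 0,LX,LT 0,LX]),
                   ([LX,LZ 0,LX,LY,LT 0,LY], [LX,LZ 0,LY,LX,LT 0,LY])}"

lemma var_eqs:
  "var_C = var ax_C" "var_D = var ax_D" "var_E = var ax_E" "dual (var ax_E) = var ax_dE"
  "var_F = var ax_F" "var_H = var ax_H" "var_I = var ax_I"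
  by (simp_all add: var_C_def var_D_def var_E_def var_F_def var_H_def var_I_def dual_var
      ax_C_def ax_D_def ax_E_def ax_dE_def ax_F_def ax_H_def ax_I_def)

section \<open>Derivations between the axiom systems\<close>

context fic
begin

lemma inst0:
  "(u, v) \<in> \<Sigma> \<Longrightarrow> \<Sigma> \<subseteq> \<theta> \<Longrightarrow>
    p @ subst (pat X Y Z T) u @ q \<approx> p @ subst (pat X Y Z T) v @ q"
  by (rule inst) blast

lemma T_all: "ax_T \<subseteq> \<theta> \<Longrightarrow> u \<approx> v"
proof -
  assume T: "ax_T \<subseteq> \<theta>"
  have "u \<approx> []" for u using inst0 [of "[LX]" "[]" _ "[]" u "[]" "[]" "[]" "[]"] T by (simp add: ax_T_def)
  then show "u \<approx> v" using sym trans by blast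
qed

lemma T_imp: "ax_T \<subseteq> \<theta> \<Longrightarrow> \<Sigma> \<subseteq> \<theta>"
  using T_all unfolding equ_def by auto

lemma comm_perm:
  assumes comm: "([LX,LY], [LY,LX]) \<in> \<theta>" and "mset u = mset v"
  shows "u \<approx> v"
  using assms(2)
proof (induction u arbitrary: v)
  case (Cons c u)
  then have "c \<in> set v" by (metis list.set_intros(1) mset_eq_setD)
  then obtain v1 v2 where v: "v = v1 @ c # v2" by (meson split_list)
  then have "u \<approx> v1 @ v2" using Cons by simp
  then have "c # u \<approx> c # v1 @ v2" using ctxt [of u "v1 @ v2" "[c]" "[]"] by simp
  also have "\<dots> \<approx> v1 @ c # v2" using inst [OF comm, of "[]" "[c]" v1 "[]" "[]" v2] by simp
  finally show ?case using v by simp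
qed simp

lemma SL_imp_C: "ax_SL \<subseteq> \<theta> \<Longrightarrow> ax_C \<subseteq> \<theta>"
proof -
  assume SL: "ax_SL \<subseteq> \<theta>"
  then have "[LX,LX] \<approx> [LX,LX,LX]"
    using inst0 [of "[LX]" "[LX,LX]" ax_SL "[LX]" "[LX]" "[]" "[]" "[]" "[]"] by (simp add: ax_SL_def)
  with SL show "ax_C \<subseteq> \<theta>" by (simp add: ax_SL_def ax_C_def equ_def)
qed

lemma C_imp_D: "ax_C \<subseteq> \<theta> \<Longrightarrow> ax_D \<subseteq> \<theta>"
  using comm_perm by (auto simp: ax_C_def ax_D_def equ_def)

lemma D_rules:
  assumes "ax_D \<subseteq> \<theta>"
  shows "p @ X @ X @ q \<approx> p @ X @ X @ X @ q" "p @ X @ X @ Y @ q \<approx> p @ X @ Y @ X @ q"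
    "p @ X @ Y @ X @ q \<approx> p @ Y @ X @ X @ q"
  using inst0 [OF _ assms, of _ _ p X Y "[]" "[]" q] by (fastforce simp: ax_D_def)+

lemma E_rules:
  assumes "ax_E \<subseteq> \<theta>"
  shows "p @ X @ X @ q \<approx> p @ X @ X @ X @ q" "p @ X @ X @ Y @ q \<approx> p @ X @ Y @ X @ q"
    "p @ X @ X @ Y @ Y @ q \<approx> p @ Y @ Y @ X @ X @ q"
  using inst0 [OF _ assms, of _ _ p X Y "[]" "[]" q] by (fastforce simp: ax_E_def)+

lemma dE_rules:
  assumes "ax_dE \<subseteq> \<theta>"
  shows "p @ X @ X @ q \<approx> p @ X @ X @ X @ q" "p @ X @ Y @ X @ q \<approx> p @ Y @ X @ X @ q"
    "p @ X @ X @ Y @ Y @ q \<approx> p @ Y @ Y @ X @ X @ q"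
  using inst0 [OF _ assms, of _ _ p X Y "[]" "[]" q] inst0 [OF _ assms, of _ _ p Y X "[]" "[]" q]
  by (fastforce simp: ax_dE_def intro: sym)+

lemma D_imp_E: "ax_D \<subseteq> \<theta> \<Longrightarrow> ax_E \<subseteq> \<theta>"
proof -
  assume D: "ax_D \<subseteq> \<theta>"
  have "[LX,LX,LY,LY] \<approx> [LY,LY,LX,LX]"
    using trans [OF D_rules(2,3) [OF D, of "[]" "[LX]" "[LY,LY]" "[]"]] by simp
  with D show "ax_E \<subseteq> \<theta>" by (simp add: ax_E_def ax_D_def equ_def)
qed

lemma D_imp_dE: "ax_D \<subseteq> \<theta> \<Longrightarrow> ax_dE \<subseteq> \<theta>"
proof -
  assume D: "ax_D \<subseteq> \<theta>"
  have "[LY,LY,LX,LX] \<approx> [LX,LX,LY,LY]"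
    using trans [OF D_rules(2,3) [OF D, of "[]" "[LY]" "[LX,LX]" "[]"]] by simp
  with D show "ax_dE \<subseteq> \<theta>" by (simp add: ax_dE_def ax_D_def equ_def sym_in)
qed

text \<open>In E all occurrences of a letter can be gathered at its first one.\<close>

lemma E_imp_F: "ax_E \<subseteq> \<theta> \<Longrightarrow> ax_F \<subseteq> \<theta>"
proof -
  assume E: "ax_E \<subseteq> \<theta>"
  note e = E_rules [OF E]
  have xxxy: "[LX,LX,LX,LY] \<approx> [LX,LY,LX]"
    using trans [OF sym [OF e(1) [of "[]" "[LX]" "[LY]", simplified]]
        e(2) [of "[]" "[LX]" "[LY]" "[]", simplified]] by simp
  have 1: "[LX,LY,LX] \<approx> [LX,LY,LX,LX]"
  proof -
    have "[LX,LY,LX] \<approx> [LX,LX,LX,LY]" by (rule sym [OF xxxy])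
    also have "\<dots> \<approx> [LX,LX,LY,LX]" using e(2) [of "[]" "[LX]" "[LX,LY]" "[]"] by simp
    also have "\<dots> \<approx> [LX,LY,LX,LX]" using e(2) [of "[]" "[LX]" "[LY,LX]" "[]"] by simp
    finally show ?thesis .
  qed
  have 2: "[LX,LX,LY,LY] \<approx> [LY,LY,LX,LX]" using e(3) [of "[]" "[LX]" "[LY]" "[]"] by simp
  have 3: "[LX,LY,LZ 0,LX,LY] \<approx> [LY,LX,LZ 0,LX,LY]"
  proof -
    have "[LX,LY,LZ 0,LX,LY] \<approx> [LX,LX,LY,LZ 0,LY]"
      using sym [OF e(2) [of "[]" "[LX]" "[LY,LZ 0]" "[LY]"]] by simp
    also have "\<dots> \<approx> [LX,LX,LY,LY,LZ 0]"
      using sym [OF e(2) [of "[LX,LX]" "[LY]" "[LZ 0]" "[]"]] by simp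
    also have "\<dots> \<approx> [LY,LY,LX,LX,LZ 0]" using e(3) [of "[]" "[LX]" "[LY]" "[LZ 0]"] by simp
    also have "\<dots> \<approx> [LY,LY,LX,LZ 0,LX]" using e(2) [of "[LY,LY]" "[LX]" "[LZ 0]" "[]"] by simp
    also have "\<dots> \<approx> [LY,LX,LZ 0,LX,LY]" using e(2) [of "[]" "[LY]" "[LX,LZ 0,LX]" "[]"] by simp
    finally show ?thesis .
  qed
  have 4: "[LX,LY,LX,LZ 0] \<approx> [LX,LY,LX,LZ 0,LX]"
  proof -
    have "[LX,LY,LX,LZ 0] \<approx> [LX,LX,LX,LY,LZ 0]"
      using ctxt [OF sym [OF xxxy], of "[]" "[LZ 0]"] by simp
    also have "\<dots> \<approx> [LX,LX,LY,LX,LZ 0]" using e(2) [of "[]" "[LX]" "[LX,LY]" "[LZ 0]"] by simp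
    also have "\<dots> \<approx> [LX,LY,LX,LZ 0,LX]" using e(2) [of "[]" "[LX]" "[LY,LX,LZ 0]" "[]"] by simp
    finally show ?thesis .
  qed
  from 1 2 3 4 show "ax_F \<subseteq> \<theta>" by (simp add: ax_F_def Phi_def equ_def)
qed

text \<open>In dual E all occurrences of a letter can be gathered at its last one.\<close>

lemma dE_imp_H: "ax_dE \<subseteq> \<theta> \<Longrightarrow> ax_H \<subseteq> \<theta>"
proof -
  assume dE: "ax_dE \<subseteq> \<theta>"
  note e = dE_rules [OF dE]
  have 1: "[LX,LY,LX] \<approx> [LX,LY,LX,LX]"
  proof -
    have "[LX,LY,LX] \<approx> [LY,LX,LX]" using e(2) [of "[]" "[LX]" "[LY]" "[]"] by simp
    also have "\<dots> \<approx> [LY,LX,LX,LX]" using e(1) [of "[LY]" "[LX]" "[]"] by simp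
    also have "\<dots> \<approx> [LX,LY,LX,LX]" using sym [OF e(2) [of "[]" "[LX]" "[LY,LX]" "[]"]] by simp
    finally show ?thesis .
  qed
  have 2: "[LX,LX,LY,LY] \<approx> [LY,LY,LX,LX]" using e(3) [of "[]" "[LX]" "[LY]" "[]"] by simp
  have 3: "[LX,LY,LZ 0,LX,LY] \<approx> [LY,LX,LZ 0,LX,LY]"
  proof -
    have "[LX,LY,LZ 0,LX,LY] \<approx> [LY,LZ 0,LX,LX,LY]"
      using e(2) [of "[]" "[LX]" "[LY,LZ 0]" "[LY]"] by simp
    also have "\<dots> \<approx> [LZ 0,LX,LX,LY,LY]" using e(2) [of "[]" "[LY]" "[LZ 0,LX,LX]" "[]"] by simp
    also have "\<dots> \<approx> [LX,LZ 0,LX,LY,LY]" using sym [OF e(2) [of "[]" "[LX]" "[LZ 0]" "[LY,LY]"]] by simp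
    also have "\<dots> \<approx> [LY,LX,LZ 0,LX,LY]" using sym [OF e(2) [of "[]" "[LY]" "[LX,LZ 0,LX]" "[]"]] by simp
    finally show ?thesis .
  qed
  have 4: "[LX,LY,LX,LZ 0,LT 0,LX] \<approx> [LX,LY,LX,LZ 0,LX,LT 0,LX]"
  proof -
    have "[LX,LY,LX,LZ 0,LT 0,LX] \<approx> [LX,LY,LZ 0,LT 0,LX,LX]"
      using e(2) [of "[LX,LY]" "[LX]" "[LZ 0,LT 0]" "[]"] by simp
    also have "\<dots> \<approx> [LX,LY,LZ 0,LT 0,LX,LX,LX]"
      using e(1) [of "[LX,LY,LZ 0,LT 0]" "[LX]" "[]"] by simp
    also have "\<dots> \<approx> [LX,LY,LX,LZ 0,LT 0,LX,LX]"
      using sym [OF e(2) [of "[LX,LY]" "[LX]" "[LZ 0,LT 0]" "[LX]"]] by simp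
    also have "\<dots> \<approx> [LX,LY,LX,LZ 0,LX,LT 0,LX]"
      using sym [OF e(2) [of "[LX,LY,LX,LZ 0]" "[LX]" "[LT 0]" "[]"]] by simp
    finally show ?thesis .
  qed
  have a: "[LX,LX,LY,LT 0,LY] \<approx> [LX,LX,LT 0,LY,LY]" using e(2) [of "[LX,LX]" "[LY]" "[LT 0]" "[]"] by simp
  have b: "[LX,LY,LX,LT 0,LY] \<approx> [LX,LX,LT 0,LY,LY]" using e(2) [of "[LX]" "[LY]" "[LX,LT 0]" "[]"] by simp
  have c: "[LY,LX,LX,LT 0,LY] \<approx> [LX,LX,LT 0,LY,LY]" using e(2) [of "[]" "[LY]" "[LX,LX,LT 0]" "[]"] by simp
  from 1 2 3 4 trans [OF a sym [OF b]] trans [OF b sym [OF c]]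
  show "ax_H \<subseteq> \<theta>" by (simp add: ax_H_def Phi_def equ_def)
qed

lemma Phi_rules:
  assumes "Phi \<subseteq> \<theta>"
  shows "p @ X @ Y @ X @ q \<approx> p @ X @ Y @ X @ X @ q" "p @ X @ X @ Y @ Y @ q \<approx> p @ Y @ Y @ X @ X @ q"
    "p @ X @ Y @ Z @ X @ Y @ q \<approx> p @ Y @ X @ Z @ X @ Y @ q"
  using inst0 [OF _ assms, of _ _ p X Y Z "[]" q] by (fastforce simp: Phi_def)+

text \<open>In F a letter that has occurred twice can be inserted anywhere later, which creates the
  second factor required by the swap rule \<open>phi(3)\<close>.\<close>

lemma F_imp_H: "ax_F \<subseteq> \<theta> \<Longrightarrow> ax_H \<subseteq> \<theta>"
proof -
  assume F: "ax_F \<subseteq> \<theta>"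
  have f: "p @ X @ Y @ X @ Z @ q \<approx> p @ X @ Y @ X @ Z @ X @ q" for p X Y Z q
    using inst0 [OF _ F, of _ _ p X Y Z "[]" q] by (fastforce simp: ax_F_def)
  have Phi: "Phi \<subseteq> \<theta>" using F by (simp add: ax_F_def)
  note phi = Phi_rules [OF Phi]
  have 4: "[LX,LY,LX,LZ 0,LT 0,LX] \<approx> [LX,LY,LX,LZ 0,LX,LT 0,LX]"
    using f [of "[]" "[LX]" "[LY]" "[LZ 0]" "[LT 0,LX]"] by simp
  have 5: "[LX,LX,LY,LT 0,LY] \<approx> [LX,LY,LX,LT 0,LY]"
  proof -
    have "[LX,LX,LY,LT 0,LY] \<approx> [LX,LX,LY,LT 0,LX,LY]"
      using f [of "[]" "[LX]" "[]" "[LY,LT 0]" "[LY]"] by simp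
    also have "\<dots> \<approx> [LX,LY,LX,LT 0,LX,LY]" using phi(3) [of "[LX]" "[LX]" "[LY]" "[LT 0]" "[]"] by simp
    also have "\<dots> \<approx> [LX,LY,LX,LT 0,LY]"
      using sym [OF f [of "[]" "[LX]" "[LY]" "[LT 0]" "[LY]"]] by simp
    finally show ?thesis .
  qed
  have 6: "[LX,LY,LX,LT 0,LY] \<approx> [LY,LX,LX,LT 0,LY]"
  proof -
    have "[LX,LY,LX,LT 0,LY] \<approx> [LX,LY,LX,LT 0,LX,LY]"
      using f [of "[]" "[LX]" "[LY]" "[LT 0]" "[LY]"] by simp
    also have "\<dots> \<approx> [LY,LX,LX,LT 0,LX,LY]" using phi(3) [of "[]" "[LX]" "[LY]" "[LX,LT 0]" "[]"] by simp
    also have "\<dots> \<approx> [LY,LX,LX,LT 0,LY]"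
      using sym [OF f [of "[LY]" "[LX]" "[]" "[LT 0]" "[LY]"]] by simp
    finally show ?thesis .
  qed
  from 4 5 6 Phi show "ax_H \<subseteq> \<theta>" by (simp add: ax_H_def equ_def)
qed

lemma H_imp_I: "ax_H \<subseteq> \<theta> \<Longrightarrow> ax_I \<subseteq> \<theta>"
proof -
  assume H: "ax_H \<subseteq> \<theta>"
  have h: "p @ X @ X @ Y @ T @ Y @ q \<approx> p @ Y @ X @ X @ T @ Y @ q" for p X Y T q
    by (rule trans [of _ "p @ X @ Y @ X @ T @ Y @ q"];
      use inst0 [OF _ H, of _ _ p X Y "[]" T q] in \<open>fastforce simp: ax_H_def\<close>)
  have Phi: "Phi \<subseteq> \<theta>" using H by (simp add: ax_H_def)
  note phi = Phi_rules [OF Phi]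
  have "[LX,LZ 0,LX,LY,LT 0,LY] \<approx> [LX,LZ 0,LX,LX,LY,LT 0,LY]"
    using phi(1) [of "[]" "[LX]" "[LZ 0]" "[LY,LT 0,LY]"] by simp
  also have "\<dots> \<approx> [LX,LZ 0,LY,LX,LX,LT 0,LY]" using h [of "[LX,LZ 0]" "[LX]" "[LY]" "[LT 0]" "[]"] by simp
  also have "\<dots> \<approx> [LX,LZ 0,LY,LX,LT 0,LY]"
    using sym [OF phi(1) [of "[]" "[LX]" "[LZ 0,LY]" "[LT 0,LY]"]] by simp
  finally show "ax_I \<subseteq> \<theta>" using H by (simp add: ax_H_def ax_I_def equ_def)
qed

lemma I_rule:
  assumes "ax_I \<subseteq> \<theta>"
  shows "p @ X @ Z @ X @ Y @ T @ Y @ q \<approx> p @ X @ Z @ Y @ X @ T @ Y @ q"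
  using inst0 [OF _ assms, of _ _ p X Y Z T q] by (fastforce simp: ax_I_def)

text \<open>The second \<open>x\<close> passes the letters of \<open>W\<close> one at a time,
  whatever their order, since each reappears in \<open>q\<close>; so a single identity of I implies
  the w-identities for all permutations.\<close>

lemma I_imp_J: "ax_I \<subseteq> \<theta> \<Longrightarrow> ax_J \<subseteq> \<theta>"
proof -
  assume I: "ax_I \<subseteq> \<theta>"
  have pull: "x # W @ x # q \<approx> x # x # W @ q" if "set W \<subseteq> set q" for x W q
    using that
  proof (induction W arbitrary: q rule: rev_induct)
    case (snoc z W)
    then obtain t r where q: "q = t @ z # r" using split_list [of z q] by auto
    have "x # (W @ [z]) @ x # q \<approx> x # W @ x # z # q"
      using sym [OF I_rule [OF I, of "[]" "[x]" W "[z]" t r]] q by simp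
    also have "\<dots> \<approx> x # x # W @ z # q" using snoc by (intro snoc.IH) auto
    finally show ?case by simp
  qed simp
  have "w n \<pi> \<approx> w' n \<pi>" if "\<pi> permutes {1..n}" for n \<pi>
  proof -
    have "1 \<le> \<pi> i \<and> \<pi> i \<le> n" if "1 \<le> i" "i < Suc n" for i
      using permutes_in_image [OF \<open>\<pi> permutes {1..n}\<close>, of i] that by simp
    then have "set (map (\<lambda>i. LZ (\<pi> i)) [1..<Suc n]) \<subseteq> set (concat (map (\<lambda>i. [LT i, LZ i]) [1..<Suc n]))"
      by (fastforce simp del: upt_Suc simp: less_Suc_eq_le)
    from pull [OF this, of LX] show ?thesis by (simp add: w_def w'_def del: upt_Suc)
  qed
  then show "ax_J \<subseteq> \<theta>" using I unfolding ax_J_def ax_I_def equ_def by blast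
qed

end

subsection \<open>Word problems\<close>

context J_theory
begin

text \<open>A second \<open>y\<close> can pass the first \<open>x\<close> by
  \<open>swap_second\<close> if \<open>y\<close> is not spread, and by \<open>swap_unparted\<close>
  if the two letters are not parted. The second guard is the case in which both rules fail.\<close>

lemma sortable_J: "sortable \<theta> parted (\<lambda>u x y. parted u x y \<and> spread u x)"
proof
  fix p q :: word and x y :: letter
  show "p @ x # y # q \<approx> p @ y # x # q"
    if "x \<noteq> y" "x \<in> set q" "y \<in> set q"
      "\<not> parted (p @ x # y # q) x y" "\<not> parted (p @ x # y # q) y x"
    using that by (intro swap_unparted) (auto simp: occ_pos [symmetric])
  show "p @ x # y # q \<approx> p @ y # x # q"
    if "x \<noteq> y" "x \<notin> set p" "y \<in> set p" "x \<in> set q"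
      "\<not> (parted (p @ x # y # q) y x \<and> spread (p @ x # y # q) y)"
  proof (cases "spread (p @ x # y # q) y")
    case True
    have "0 < occ q x" "0 < occ p y" using that by (simp_all add: occ_pos)
    then have m: "multiple (p @ x # y # q) x" "multiple (p @ x # y # q) y" by auto
    \<comment> \<open>A witness would have to come before the second \<open>y\<close>, hence lie in
      \<open>p\<close>, where no \<open>x\<close> has occurred yet.\<close>
    have "\<not> parted (p @ x # y # q) x y"
    proof
      assume "parted (p @ x # y # q) x y"
      then obtain s where s: "simple (p @ x # y # q) s"
        "\<not> cb (p @ x # y # q) s x < occ (p @ x # y # q) x" "cb (p @ x # y # q) s y \<le> 1"
        by (auto simp: parted_def)
      then have "s \<noteq> x" "s \<noteq> y" using m by auto
      with s \<open>0 < occ p y\<close> have "s \<in> set p" by (auto simp: cb_append split: if_splits)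
      then have "cb (p @ x # y # q) s x \<le> occ p x" by (simp add: cb_append cb_le_count)
      with s(2) m(1) that(2) show False by (simp add: count_notin)
    qed
    with True that m show ?thesis by (intro swap_unparted) auto
  next
    case False
    have "0 < occ q x" using that by (simp add: occ_pos)
    with False that show ?thesis by (intro swap_second) auto
  qed
qed (simp_all add: agree0_parted agree0_spread)

lemma I_swap_nonfirst:
  assumes "ax_I \<subseteq> \<theta>" "y \<in> set p" "x \<in> set q"
  shows "p @ x # y # q \<approx> p @ y # x # q"
proof -
  obtain p1 p2 q1 q2 where "p = p1 @ y # p2" "q = q1 @ x # q2" using assms by (meson split_list)
  then show ?thesis using sym [OF I_rule [OF assms(1), of p1 "[y]" p2 "[x]" q1 q2]] by simp
qed

lemma sortable_I: "ax_I \<subseteq> \<theta> \<Longrightarrow> sortable \<theta> parted (\<lambda>_ _ _. False)"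
proof -
  assume I: "ax_I \<subseteq> \<theta>"
  interpret s: sortable \<theta> parted "\<lambda>u x y. parted u x y \<and> spread u x" by (rule sortable_J)
  show ?thesis
    by unfold_locales (auto simp: agree0_parted intro: s.swap_first I_swap_nonfirst [OF I])
qed

text \<open>With no simple letter between the first two \<open>x\<close>, the second is pulled next
  to the first; the axioms of H move both over \<open>y\<close>, and the second \<open>x\<close> is
  released again.\<close>

lemma H_swap_first:
  assumes H: "ax_H \<subseteq> \<theta>" and q: "x \<in> set q" "y \<in> set q" and xy: "x \<notin> set p" "x \<noteq> y"
    and A: "\<not> spread (p @ x # y # q) x"
  shows "p @ x # y # q \<approx> p @ y # x # q"
proof -
  obtain q1 q2 where q1: "q = q1 @ x # q2" "x \<notin> set q1" using q(1) by (meson split_list_first)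
  have "y \<in> set (q1 @ q2)" using q xy q1 by auto
  then obtain t r where t: "q1 @ q2 = t @ y # r" by (meson split_list)
  have W: "multiple (p @ x # y # q) c" if "c \<in> set (y # q1)" for c
  proof (rule ccontr)
    assume *: "\<not> multiple (p @ x # y # q) c"
    moreover have "0 < occ q y" using q by (simp add: occ_pos)
    ultimately have c: "c \<in> set q1" "c \<noteq> x" "c \<noteq> y" using that q1 by auto
    then have "0 < occ q1 c" by (simp add: occ_pos)
    then have one: "simple (p @ x # y # q) c" "occ p c = 0" using * q1 c by auto
    then have "c \<notin> set p" by (simp add: count_list_0_iff)
    then have "cb (p @ x # y # q) c x = 1"
      using xy c q1 cb_le_count [of q1 c x] by (simp add: cb_append count_notin)
    with one A show False by (auto simp: spread_def)
  qed
  have "p @ x # (y # q1) @ x # q2 \<approx> p @ x # x # (y # q1) @ q2"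
    using W q1 by (intro pull_second) auto
  also have "\<dots> \<approx> p @ x # y # x # t @ y # r"
    using inst0 [OF _ H, of "[LX,LX,LY,LT 0,LY]" "[LX,LY,LX,LT 0,LY]" p "[x]" "[y]" "[]" t r] t
    by (simp add: ax_H_def)
  also have "\<dots> \<approx> p @ y # x # x # t @ y # r"
    using inst0 [OF _ H, of "[LX,LY,LX,LT 0,LY]" "[LY,LX,LX,LT 0,LY]" p "[x]" "[y]" "[]" t r] t
    by (simp add: ax_H_def)
  also have "\<dots> \<approx> (p @ [y]) @ x # q1 @ x # q2"
    using sym [OF pull_second [of q1 "p @ [y]" x q2]] W q1 t by (simp add: add_ac)
  finally show ?thesis using q1 by simp
qed

lemma sortable_H:
  "ax_H \<subseteq> \<theta> \<Longrightarrow> sortable \<theta> (\<lambda>u x y. parted u x y \<and> spread u x) (\<lambda>_ _ _. False)"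
proof -
  assume H: "ax_H \<subseteq> \<theta>"
  interpret s: sortable \<theta> parted "\<lambda>u x y. parted u x y \<and> spread u x" by (rule sortable_J)
  show ?thesis
  proof
    fix p q :: word and x y :: letter
    show "p @ x # y # q \<approx> p @ y # x # q"
      if h: "x \<noteq> y" "x \<notin> set p" "y \<notin> set p" "x \<in> set q" "y \<in> set q"
        "\<not> (parted (p @ x # y # q) x y \<and> spread (p @ x # y # q) x)"
        "\<not> (parted (p @ x # y # q) y x \<and> spread (p @ x # y # q) y)"
    proof -
      have "0 < occ q x" "0 < occ q y" using h by (simp_all add: occ_pos)
      then have "agree0 (p @ x # y # q) (p @ y # x # q)" by (intro agree0_swap) auto
      then have sp: "spread (p @ x # y # q) y = spread (p @ y # x # q) y" by (rule agree0_spread)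
      consider "\<not> parted (p @ x # y # q) x y" "\<not> parted (p @ x # y # q) y x"
        | "\<not> spread (p @ x # y # q) x" | "\<not> spread (p @ x # y # q) y" using h by blast
      then show ?thesis
      proof cases
        case 1
        then show ?thesis using h by (intro s.swap_first) auto
      next
        case 2
        then show ?thesis using h by (intro H_swap_first [OF H]) auto
      next
        case 3
        then show ?thesis using h sp by (intro sym [OF H_swap_first [OF H]]) auto
      qed
    qed
    show "p @ x # y # q \<approx> p @ y # x # q"
      if "x \<noteq> y" "x \<notin> set p" "y \<in> set p" "x \<in> set q"
      using that H_imp_I [OF H] by (intro I_swap_nonfirst) auto
  qed (auto simp: agree0_parted agree0_spread)
qed

lemma sigma1_imp_H:
  assumes s: "id_swap \<in> \<theta>"
  shows "ax_H \<subseteq> \<theta>"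
proof -
  have 1: "[LX,LY,LX,LT 0,LY] \<approx> [LY,LX,LX,LT 0,LY]"
    using inst [OF s, of "[]" "[LX]" "[LY]" "[]" "[LT 0]" "[]"] by simp
  have 2: "[LX,LX,LY,LT 0,LY] \<approx> [LX,LY,LX,LT 0,LY]"
    using sym [OF w1 [of "[]" "[LX]" "[LY]" "[LT 0]" "[]"]] by simp
  note ax_common
  with 1 2 show ?thesis by (simp add: ax_H_def equ_def)
qed

text \<open>Under \<open>id_swap\<close> no order between multiple letters survives, so both guards
  become \<open>False\<close> and \<open>agree\<close> shrinks to \<open>agree0\<close>.\<close>

lemma complete_FE:
  assumes s: "id_swap \<in> \<theta>" and uv: "agree0 u v"
  shows "u \<approx> v"
proof -
  have I: "ax_I \<subseteq> \<theta>" by (rule H_imp_I [OF sigma1_imp_H [OF s]])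
  interpret s: sortable \<theta> "\<lambda>_ _ _. False" "\<lambda>_ _ _. False"
  proof
    fix p q :: word and x y :: letter
    have step: "p @ x # y # q1 @ x # q2 \<approx> p @ y # x # q1 @ x # q2" if "y \<in> set q2"
      for p q1 q2 and x y :: letter
    proof -
      obtain t r where "q2 = t @ y # r" using \<open>y \<in> set q2\<close> by (meson split_list)
      then show ?thesis using inst [OF s, of p "[x]" "[y]" q1 t r] by simp
    qed
    show "p @ x # y # q \<approx> p @ y # x # q" if "x \<noteq> y" "x \<in> set q" "y \<in> set q"
    proof -
      obtain q1 q2 where q: "q = q1 @ x # q2" using \<open>x \<in> set q\<close> by (meson split_list)
      show ?thesis
      proof (cases "y \<in> set q2")
        case True
        then show ?thesis using step q by blast
      next
        case False
        then have "y \<in> set q1" using that q by auto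
        then obtain r1 r2 where "q1 = r1 @ y # r2" by (meson split_list)
        then show ?thesis using sym [OF step [of x "r2 @ x # q2" p y r1]] q by simp
      qed
    qed
    show "p @ x # y # q \<approx> p @ y # x # q" if "y \<in> set p" "x \<in> set q"
      using that by (rule I_swap_nonfirst [OF I])
  qed simp_all
  show ?thesis by (rule s.complete) (simp add: agree_def uv)
qed

end

text \<open>The description used for C is \<open>agree_count\<close>; joined with
  \<open>agree_simple\<close>, \<open>agree_fst\<close>, \<open>agree_snd\<close> or
  \<open>agree_last\<close> it becomes the one for D, E, F or dual E.\<close>

definition agree_count :: "'b list \<Rightarrow> 'b list \<Rightarrow> bool" where
  "agree_count u v \<longleftrightarrow> (\<forall>x. min 2 (occ u x) = min 2 (occ v x))"

definition agree_simple :: "'b list \<Rightarrow> 'b list \<Rightarrow> bool" where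
  "agree_simple u v \<longleftrightarrow>
    (\<forall>s t. simple u s \<longrightarrow> simple u t \<longrightarrow> (cb u s t = 0 \<longleftrightarrow> cb v s t = 0))"

definition agree_fst :: "'b list \<Rightarrow> 'b list \<Rightarrow> bool" where
  "agree_fst u v \<longleftrightarrow> (\<forall>s x. simple u s \<longrightarrow> (cb u s x = 0 \<longleftrightarrow> cb v s x = 0))"

definition agree_snd :: "'b list \<Rightarrow> 'b list \<Rightarrow> bool" where
  "agree_snd u v \<longleftrightarrow> (\<forall>s x. simple u s \<longrightarrow> min 2 (cb u s x) = min 2 (cb v s x))"

definition agree_last :: "'b list \<Rightarrow> 'b list \<Rightarrow> bool" where
  "agree_last u v \<longleftrightarrow> (\<forall>s x. simple u s \<longrightarrow>
    (cb u s x < occ u x \<longleftrightarrow> cb v s x < occ v x))"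

lemma agree0_iff: "agree0 u v \<longleftrightarrow> agree_count u v \<and> agree_snd u v \<and> agree_last u v"
  unfolding agree0_def agree_count_def agree_snd_def agree_last_def by blast

section \<open>Completeness up to F join dual E by padding words\<close>

definition dbl :: "letter set \<Rightarrow> letter \<Rightarrow> word" where
  "dbl M c = (if c \<in> M then [c, c] else [c])"

lemma count_dbl: "occ (subst (dbl M) u) x = (if x \<in> M then 2 else 1) * occ u x"
  by (induction u) (auto simp: dbl_def)

lemma cb_dbl: "cb (subst (dbl M) u) y x = (if x \<in> M then 2 else 1) * cb u y x"
  by (induction u) (auto simp: dbl_def)

lemma set_dbl: "set (subst (dbl M) u) = set u"
  by (induction u) (auto simp: dbl_def)

lemma agree_countD: "agree_count u v \<Longrightarrow> min 2 (occ u x) = min 2 (occ v x)"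
  by (simp add: agree_count_def)

lemma agree_count_simple: "agree_count u v \<Longrightarrow> simple u x \<longleftrightarrow> simple v x"
  using min2_eq [OF agree_countD [of u v x]] by simp

lemma agree_count_multiple: "agree_count u v \<Longrightarrow> multiple u x \<longleftrightarrow> multiple v x"
  using min2_eq [OF agree_countD [of u v x]] by simp

lemma agree_count_zero: "agree_count u v \<Longrightarrow> occ u x = 0 \<longleftrightarrow> occ v x = 0"
  using min2_eq [OF agree_countD [of u v x]] by simp

text \<open>After doubling, a multiple letter occurs before a simple one either not at all or at
  least twice, so \<open>agree_fst\<close> already yields \<open>agree_snd\<close>.\<close>

lemma dbl_agree:
  fixes u v :: word
  defines "M \<equiv> {c. multiple u c}"
  assumes c: "agree_count u v" and f: "agree_fst u v"
  shows "agree_count (subst (dbl M) u) (subst (dbl M) v)" "agree_snd (subst (dbl M) u) (subst (dbl M) v)"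
    "agree_last u v \<Longrightarrow> agree_last (subst (dbl M) u) (subst (dbl M) v)"
proof -
  have mem: "x \<in> M \<longleftrightarrow> multiple u x" "x \<in> M \<longleftrightarrow> multiple v x" for x
    using agree_count_multiple [OF c, of x] by (simp_all add: M_def)
  have simple: "simple u s" if "simple (subst (dbl M) u) s" for s
    using that by (auto simp: count_dbl split: if_splits)
  have "min 2 (occ (subst (dbl M) u) x) = min 2 (occ (subst (dbl M) v) x)" for x
    using agree_countD [OF c, of x] mem [of x] by (auto simp: count_dbl min_def split: if_splits)
  then show "agree_count (subst (dbl M) u) (subst (dbl M) v)" unfolding agree_count_def by blast
  have "min 2 (cb (subst (dbl M) u) s x) = min 2 (cb (subst (dbl M) v) s x)" if "simple u s" for s x
  proof -
    have "x \<in> M \<or> cb u s x \<le> 1 \<and> cb v s x \<le> 1"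
      using cb_le_count [of u s x] cb_le_count [of v s x] mem [of x] by linarith
    moreover have "cb u s x = 0 \<longleftrightarrow> cb v s x = 0" using f that by (simp add: agree_fst_def)
    ultimately show ?thesis by (cases "cb u s x = 0") (auto simp: cb_dbl min_def)
  qed
  with simple show "agree_snd (subst (dbl M) u) (subst (dbl M) v)" unfolding agree_snd_def by blast
  show "agree_last (subst (dbl M) u) (subst (dbl M) v)" if "agree_last u v"
    unfolding agree_last_def
  proof (intro allI impI)
    fix s x assume "simple (subst (dbl M) u) s"
    then have "cb u s x < occ u x \<longleftrightarrow> cb v s x < occ v x"
      using that simple by (simp add: agree_last_def)
    then show "cb (subst (dbl M) u) s x < occ (subst (dbl M) u) x \<longleftrightarrow>
        cb (subst (dbl M) v) s x < occ (subst (dbl M) v) x"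
      by (auto simp: cb_dbl count_dbl)
  qed
qed

lemma le2_cases: obtains "(n :: nat) = 0" | "n = 1" | "2 \<le> n"
  by linarith

context J_theory
begin

lemma dbl_equ:
  assumes e: "id_double \<in> \<theta>"
    and "\<forall>c\<in>M. multiple (p @ u) c"
  shows "p @ u \<approx> p @ subst (dbl M) u"
  using assms(2)
proof (induction u arbitrary: p)
  case (Cons c u)
  let ?U = "subst (dbl M) u"
  have "p @ c # u \<approx> p @ c # ?U" using Cons.IH [of "p @ [c]"] Cons.prems by simp
  moreover have "p @ c # ?U \<approx> p @ c # c # ?U" if "c \<in> M"
  proof (cases "c \<in> set p")
    case True
    then show ?thesis by (rule dup)
  next
    case False
    have "multiple (p @ c # u) c" using Cons.prems that by blast
    then have "0 < occ u c" using False by (simp add: count_notin)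
    then have "c \<in> set ?U" by (simp add: set_dbl occ_pos)
    then obtain t r where "?U = t @ c # r" by (meson split_list)
    then show ?thesis using sym [OF inst [OF e, of p "[c]" "[]" "[]" t r]] by simp
  qed
  moreover have "dbl M c = (if c \<in> M then [c, c] else [c])" by (simp add: dbl_def)
  ultimately show ?case using trans by auto
qed simp

lemma dbl_both:
  assumes "id_double \<in> \<theta>" "agree_count u v"
  shows "u \<approx> subst (dbl {c. multiple u c}) u" "v \<approx> subst (dbl {c. multiple u c}) v"
  using dbl_equ [OF assms(1), of "{c. multiple u c}" "[]"] agree_count_multiple [OF assms(2)] by simp_all

text \<open>\<open>id_double\<close> allows every multiple letter to be squared. Squares commute,
  which gives \<open>id_swap\<close>, and the doubled words satisfy \<open>agree0\<close>.\<close>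

lemma complete_EE:
  assumes e: "id_double \<in> \<theta>"
    and uv: "agree_count u v" "agree_fst u v" "agree_last u v"
  shows "u \<approx> v"
proof -
  have d: "p @ X @ T @ X @ q \<approx> p @ X @ X @ T @ X @ q" for p X T q
    using sym [OF inst [OF e, of p X "[]" "[]" T q]] by simp
  have "[LX,LY,LZ 0,LX,LT 0,LY] \<approx> [LX,LX,LY,LZ 0,LX,LT 0,LY]"
    using d [of "[]" "[LX]" "[LY,LZ 0]" "[LT 0,LY]"] by simp
  also have "\<dots> \<approx> [LX,LX,LY,LY,LZ 0,LX,LT 0,LY]"
    using d [of "[LX,LX]" "[LY]" "[LZ 0,LX,LT 0]" "[]"] by simp
  also have "\<dots> \<approx> [LY,LY,LX,LX,LZ 0,LX,LT 0,LY]" using ax2 [of "[]" "[LX]" "[LY]"] by simp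
  also have "\<dots> \<approx> [LY,LY,LX,LZ 0,LX,LT 0,LY]"
    using sym [OF d [of "[LY,LY]" "[LX]" "[LZ 0]" "[LT 0,LY]"]] by simp
  also have "\<dots> \<approx> [LY,LX,LZ 0,LX,LT 0,LY]"
    using sym [OF d [of "[]" "[LY]" "[LX,LZ 0,LX,LT 0]" "[]"]] by simp
  finally have s: "id_swap \<in> \<theta>" by (simp add: equ_def)
  have "agree0 (subst (dbl {c. multiple u c}) u) (subst (dbl {c. multiple u c}) v)"
    using dbl_agree [OF uv(1,2)] uv(3) by (simp add: agree0_iff)
  then show ?thesis using dbl_both [OF e uv(1)] complete_FE [OF s] trans sym by blast
qed

text \<open>Multiple letters may be appended at the end. Each of them then follows every simple
  letter, so \<open>agree_last\<close> holds for the padded words and \<open>complete_FE\<close>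
  applies.\<close>

lemma complete_F:
  assumes f: "([LX,LX,LT 0], [LX,LX,LT 0,LX]) \<in> \<theta>" and uv: "agree_count u v" "agree_snd u v"
  shows "u \<approx> v"
proof -
  have F: "p @ X @ Y @ X @ T @ q \<approx> p @ X @ Y @ X @ T @ X @ q" for p X Y T q
  proof -
    have "p @ X @ Y @ X @ T @ q \<approx> p @ X @ Y @ X @ X @ T @ q" by (rule ax1)
    also have "\<dots> \<approx> p @ X @ Y @ X @ X @ T @ X @ q"
      using inst [OF f, of "p @ X @ Y" X "[]" "[]" T q] by simp
    also have "\<dots> \<approx> p @ X @ Y @ X @ T @ X @ q" by (rule sym [OF ax1])
    finally show ?thesis .
  qed
  have "[LX,LY,LZ 0,LX,LT 0,LY] \<approx> [LX,LY,LZ 0,LX,LT 0,LX,LY]"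
    using F [of "[]" "[LX]" "[LY,LZ 0]" "[LT 0]" "[LY]"] by simp
  also have "\<dots> \<approx> [LY,LX,LZ 0,LX,LT 0,LX,LY]"
    using ax3 [of "[]" "[LX]" "[LY]" "[LZ 0,LX,LT 0]" "[]"] by simp
  also have "\<dots> \<approx> [LY,LX,LZ 0,LX,LT 0,LY]"
    using sym [OF F [of "[LY]" "[LX]" "[LZ 0]" "[LT 0]" "[LY]"]] by simp
  finally have s: "id_swap \<in> \<theta>" by (simp add: equ_def)
  have app: "u \<approx> u @ g" if "\<forall>c\<in>set g. multiple u c" for u g
    using that
  proof (induction g arbitrary: u)
    case (Cons c g)
    then have "multiple u c" by simp
    then obtain p1 p2 p3 where "u = p1 @ c # p2 @ c # p3" by (rule count_list_ge2E)
    then have "u \<approx> u @ [c]" using F [of p1 "[c]" p2 p3 "[]"] by simp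
    moreover have "u @ [c] \<approx> (u @ [c]) @ g" using Cons by (intro Cons.IH) auto
    ultimately show ?case using trans by fastforce
  qed simp
  define g where "g = filter (\<lambda>c. multiple u c) u"
  have g: "multiple u c" "multiple v c" if "c \<in> set g" for c
    using that agree_count_multiple [OF uv(1)] by (auto simp: g_def)
  have small: "occ u x \<le> 1" "occ v x \<le> 1" if "x \<notin> set g" for x
    using that agree_count_multiple [OF uv(1), of x]
    by (auto simp: g_def count_list_0_iff [symmetric] simp del: count_list_0_iff)
  have "agree0 (u @ g) (v @ g)"
    unfolding agree0_def
  proof (intro conjI allI impI)
    fix x show "min 2 (occ (u @ g) x) = min 2 (occ (v @ g) x)"
      using agree_countD [OF uv(1), of x] by (auto simp: min_def split: if_splits)
    fix s assume s: "simple (u @ g) s"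
    then have "s \<notin> set g" using g(1) [of s] by auto
    then have s: "simple u s" "simple v s"
      using s agree_count_simple [OF uv(1)] by (auto simp: count_notin)
    then have "0 < occ u s" "0 < occ v s" by simp_all
    then have in_uv: "s \<in> set u" "s \<in> set v" by (simp_all only: occ_pos)
    then have cb: "cb (u @ g) s x = cb u s x" "cb (v @ g) s x = cb v s x" by (simp_all add: cb_append)
    have snd: "min 2 (cb u s x) = min 2 (cb v s x)" using uv(2) s by (simp add: agree_snd_def)
    then show "min 2 (cb (u @ g) s x) = min 2 (cb (v @ g) s x)" by (simp add: cb)
    show "cb (u @ g) s x < occ (u @ g) x \<longleftrightarrow> cb (v @ g) s x < occ (v @ g) x"
    proof (cases "x \<in> set g")
      case True
      then have "0 < occ g x" by (simp add: occ_pos)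
      then show ?thesis using cb_le_count [of u s x] cb_le_count [of v s x] by (simp add: cb)
    next
      case False
      then show ?thesis
        using small [of x] min2_eq [OF snd] agree_count_zero [OF uv(1), of x] cb_le_count [of u s x] cb_le_count [of v s x]
        by (simp add: cb count_notin) linarith
    qed
  qed
  then have "u @ g \<approx> v @ g" by (rule complete_FE [OF s])
  moreover have "u \<approx> u @ g" "v \<approx> v @ g" using app g by auto
  ultimately show ?thesis using trans sym by blast
qed

end

context fic
begin

text \<open>E satisfies both \<open>id_double\<close> and the appending identity of F; doubling
  therefore reduces its description to that of F.\<close>

lemma complete_E:
  assumes E: "ax_E \<subseteq> \<theta>" and uv: "agree_count u v" "agree_fst u v"
  shows "u \<approx> v"
proof -
  interpret J_theory \<theta>
    by unfold_locales (intro I_imp_J H_imp_I F_imp_H E_imp_F E)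
  note e = E_rules [OF E]
  have 1: "id_double \<in> \<theta>"
  proof -
    have "[LX,LX,LT 0,LX] \<approx> [LX,LX,LX,LT 0]" using sym [OF e(2) [of "[]" "[LX]" "[LX,LT 0]" "[]"]] e(2) [of "[LX]" "[LX]" "[LT 0]" "[]"] sym [OF e(2) [of "[LX]" "[LX]" "[LT 0]" "[]"]] by simp
    also have "\<dots> \<approx> [LX,LX,LT 0]" using sym [OF e(1) [of "[]" "[LX]" "[LT 0]"]] by simp
    also have "\<dots> \<approx> [LX,LT 0,LX]" using e(2) [of "[]" "[LX]" "[LT 0]" "[]"] by simp
    finally show ?thesis by (simp add: equ_def)
  qed
  have 2: "([LX,LX,LT 0], [LX,LX,LT 0,LX]) \<in> \<theta>"
  proof -
    have "[LX,LX,LT 0] \<approx> [LX,LX,LX,LT 0]" using e(1) [of "[]" "[LX]" "[LT 0]"] by simp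
    also have "\<dots> \<approx> [LX,LX,LT 0,LX]" using e(2) [of "[LX]" "[LX]" "[LT 0]" "[]"] by simp
    finally show ?thesis by (simp add: equ_def)
  qed
  have "subst (dbl {c. multiple u c}) u \<approx> subst (dbl {c. multiple u c}) v"
    using complete_F [OF 2] dbl_agree [OF uv] by blast
  then show ?thesis using dbl_both [OF 1 uv(1)] trans sym by blast
qed

lemma dE_prepend:
  assumes dE: "ax_dE \<subseteq> \<theta>" and "\<forall>c\<in>set g. multiple u c"
  shows "u \<approx> g @ u"
  using assms(2)
proof (induction g)
  case (Cons x g)
  note e = dE_rules [OF dE]
  have "multiple (g @ u) x" using Cons.prems by simp
  then obtain p1 p2 p3 where u: "g @ u = p1 @ x # p2 @ x # p3" by (rule count_list_ge2E)
  have "p1 @ x # p2 @ x # p3 \<approx> p1 @ p2 @ x # x # p3" using e(2) [of p1 "[x]" p2 p3] by simp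
  also have "\<dots> \<approx> p1 @ p2 @ x # x # x # p3" using e(1) [of "p1 @ p2" "[x]" p3] by simp
  also have "\<dots> \<approx> x # p1 @ p2 @ x # x # p3" using sym [OF e(2) [of "[]" "[x]" "p1 @ p2" "x # p3"]] by simp
  also have "\<dots> \<approx> x # p1 @ x # p2 @ x # p3" using sym [OF e(2) [of "x # p1" "[x]" p2 p3]] by simp
  finally have "g @ u \<approx> x # g @ u" by (simp add: u)
  moreover have "u \<approx> g @ u" using Cons by simp
  ultimately show ?case using trans by fastforce
qed simp

text \<open>With all multiple letters in front, their first occurrences carry no information; of
  \<open>agree_fst\<close> only the order of the simple letters remains.\<close>

lemma agree_prepend:
  assumes uv: "agree_count u v" "agree_simple u v" and g: "set g = {c. multiple u c}"
  shows "agree_count (g @ u) (g @ v)" "agree_fst (g @ u) (g @ v)"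
proof -
  show "agree_count (g @ u) (g @ v)"
    unfolding agree_count_def
  proof
    fix x show "min 2 (occ (g @ u) x) = min 2 (occ (g @ v) x)"
      using agree_countD [OF uv(1), of x] by (auto simp: min_def split: if_splits)
  qed
  show "agree_fst (g @ u) (g @ v)"
    unfolding agree_fst_def
  proof (intro allI impI)
    fix s x assume s: "simple (g @ u) s"
    then have sg: "s \<notin> set g" using g by auto
    then have s1: "simple u s" using s by (simp add: count_notin)
    have cb: "cb (g @ z) s x = occ g x + cb z s x" for z using sg by (simp add: cb_append)
    show "cb (g @ u) s x = 0 \<longleftrightarrow> cb (g @ v) s x = 0"
    proof (cases "occ u x" rule: le2_cases)
      case 1
      then show ?thesis using agree_count_zero [OF uv(1), of x] cb_le_count [of u s x] cb_le_count [of v s x]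
        by (simp add: cb)
    next
      case 2
      then show ?thesis using uv(2) s1 by (simp add: cb agree_simple_def)
    next
      case 3
      then have "x \<in> set g" using g by simp
      then have "0 < occ g x" by (simp add: occ_pos)
      then show ?thesis by (simp add: cb)
    qed
  qed
qed

lemma set_filter_multiple: "set (filter (\<lambda>c. multiple u c) u) = {c. multiple u c}"
  by (auto simp: occ_pos [symmetric])

lemma agree_last_imp_simple: "agree_count u v \<Longrightarrow> agree_last u v \<Longrightarrow> agree_simple u v"
  unfolding agree_simple_def
proof (intro allI impI)
  fix s t assume h: "agree_count u v" "agree_last u v" "simple u s" "simple u t"
  have "cb u s t < occ u t \<longleftrightarrow> cb v s t < occ v t"
    using h(2,3) by (simp add: agree_last_def)
  moreover have "simple v t" using agree_count_simple [OF h(1), of t] h(4) by blast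
  ultimately show "cb u s t = 0 \<longleftrightarrow> cb v s t = 0"
    using h(4) by (simp only: less_one)
qed

text \<open>Prepending the multiple letters, possible in dual E, leaves last occurrences alone and
  supplies \<open>agree_fst\<close>, so \<open>complete_EE\<close> applies.\<close>

lemma complete_dE:
  assumes dE: "ax_dE \<subseteq> \<theta>" and uv: "agree_count u v" "agree_last u v"
  shows "u \<approx> v"
proof -
  interpret J_theory \<theta>
    by unfold_locales (intro I_imp_J H_imp_I dE_imp_H dE)
  note e = dE_rules [OF dE]
  have 1: "id_double \<in> \<theta>"
  proof -
    have "[LX,LX,LT 0,LX] \<approx> [LX,LT 0,LX,LX]" using e(2) [of "[]" "[LX]" "[LX,LT 0]" "[]"] by simp
    also have "\<dots> \<approx> [LX,LT 0,LX]" using sym [OF ax1 [of "[]" "[LX]" "[LT 0]" "[]"]] by simp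
    finally show ?thesis by (simp add: equ_def)
  qed
  define g where "g = filter (\<lambda>c. multiple u c) u"
  have g: "set g = {c. multiple u c}" unfolding g_def by (rule set_filter_multiple)
  note a = agree_prepend [OF uv(1) agree_last_imp_simple [OF uv] g]
  have "agree_last (g @ u) (g @ v)"
    unfolding agree_last_def
  proof (intro allI impI)
    fix s x assume s: "simple (g @ u) s"
    then have sg: "s \<notin> set g" using g by auto
    then have "simple u s" using s by (simp add: count_notin)
    then have "cb u s x < occ u x \<longleftrightarrow> cb v s x < occ v x"
      using uv(2) by (simp add: agree_last_def)
    then show "cb (g @ u) s x < occ (g @ u) x \<longleftrightarrow> cb (g @ v) s x < occ (g @ v) x"
      using sg by (simp add: cb_append)
  qed
  then have "g @ u \<approx> g @ v" by (rule complete_EE [OF 1 a])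
  moreover have "u \<approx> g @ u" "v \<approx> g @ v"
    using dE_prepend [OF dE] g agree_count_multiple [OF uv(1)] by auto
  ultimately show ?thesis using trans sym by blast
qed

lemma complete_D:
  assumes D: "ax_D \<subseteq> \<theta>" and uv: "agree_count u v" "agree_simple u v"
  shows "u \<approx> v"
proof -
  define g where "g = filter (\<lambda>c. multiple u c) u"
  have g: "set g = {c. multiple u c}" unfolding g_def by (rule set_filter_multiple)
  have "g @ u \<approx> g @ v" by (rule complete_E [OF D_imp_E [OF D] agree_prepend [OF uv g]])
  moreover have "u \<approx> g @ u" "v \<approx> g @ v"
    using dE_prepend [OF D_imp_dE [OF D]] g agree_count_multiple [OF uv(1)] by auto
  ultimately show ?thesis using trans sym by blast
qed

lemma complete_C:
  assumes C: "ax_C \<subseteq> \<theta>" and uv: "agree_count u v"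
  shows "u \<approx> v"
proof -
  have comm: "([LX,LY], [LY,LX]) \<in> \<theta>" using C by (simp add: ax_C_def)
  define M where "M z = filter (\<lambda>c. multiple u c) z" for z
  \<comment> \<open>The same \<open>S\<close> ends both rearranged words, so their simple letters
    stand in the same order and the description for D applies.\<close>
  define S where "S = filter (\<lambda>c. simple u c) u"
  have cM: "occ (M z) x = (if multiple u x then occ z x else 0)" for z x
    by (simp add: M_def count_list_filter)
  have cS: "occ S x = (if simple u x then 1 else 0)" for x
    by (simp add: S_def count_list_filter)
  have cu: "occ (M u @ S) x = occ u x" for x
    by (cases "occ u x" rule: le2_cases) (simp_all add: cM cS)
  have cv: "occ (M v @ S) x = occ v x" for x
    using agree_count_simple [OF uv, of x] agree_count_zero [OF uv, of x] agree_count_multiple [OF uv, of x]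
    by (cases "occ u x" rule: le2_cases) (simp_all add: cM cS)
  have "M u @ S \<approx> M v @ S"
  proof (rule complete_D [OF C_imp_D [OF C]])
    show "agree_count (M u @ S) (M v @ S)" using uv unfolding agree_count_def cu cv .
    show "agree_simple (M u @ S) (M v @ S)"
      unfolding agree_simple_def
    proof (intro allI impI)
      fix s t assume "simple (M u @ S) s" "simple (M u @ S) t"
      then have st: "simple u s" "simple u t" by (simp_all only: cu)
      then have "s \<notin> set (M z)" for z by (simp add: M_def)
      then show "cb (M u @ S) s t = 0 \<longleftrightarrow> cb (M v @ S) s t = 0" using st by (simp add: cb_append cM)
    qed
  qed
  moreover have "u \<approx> M u @ S" "v \<approx> M v @ S"
    by (rule comm_perm [OF comm], rule multiset_eqI, simp only: count_mset cu cv)+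
  ultimately show ?thesis using trans sym by blast
qed

text \<open>In a square every letter is multiple, so for \<open>u @ u\<close> and
  \<open>v @ v\<close> equal content is all that \<open>agree_count\<close> asks.\<close>

lemma complete_SL:
  assumes SL: "ax_SL \<subseteq> \<theta>" and uv: "set u = set v"
  shows "u \<approx> v"
proof -
  have "u @ u \<approx> v @ v"
  proof (rule complete_C [OF SL_imp_C [OF SL]])
    have "min 2 (occ (u @ u) x) = min 2 (occ (v @ v) x)" for x
    proof -
      have "occ u x = 0 \<longleftrightarrow> occ v x = 0" using uv by (simp add: count_list_0_iff)
      then show ?thesis unfolding count_list_append by linarith
    qed
    then show "agree_count (u @ u) (v @ v)" by (simp add: agree_count_def)
  qed
  moreover have "u \<approx> u @ u" for u
    using inst0 [OF _ SL, of "[LX]" "[LX,LX]" "[]" u "[]" "[]" "[]" "[]"] by (simp add: ax_SL_def)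
  ultimately show ?thesis using trans sym by blast
qed

end

subsection \<open>Identities outside of a word problem\<close>

lemma subst_only:
  assumes "\<sigma> y = [l]" "\<And>c. c \<in> set u \<Longrightarrow> c \<noteq> y \<Longrightarrow> \<sigma> c = []"
  shows "subst \<sigma> u = replicate (occ u y) l"
  using assms by (induction u) auto

lemma simple_split:
  assumes "simple u s"
  obtains a b where "u = a @ s # b" "s \<notin> set a" "s \<notin> set b"
proof -
  have "0 < occ u s" using assms by simp
  then have "s \<in> set u" by (simp only: occ_pos)
  then obtain a b where u: "u = a @ s # b" "s \<notin> set a" by (meson split_list_first)
  have "occ b s = 0" using assms u by simp
  with that u show thesis by (simp add: count_list_0_iff)
qed

text \<open>Restricts a word to two letters; since one of them is simple, its position determines
  what remains.\<close>

lemma subst_pair: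
  assumes "simple u s" "s \<noteq> x" "\<sigma> s = [m]" "\<sigma> x = [l]"
    "\<And>c. c \<in> set u \<Longrightarrow> c \<noteq> s \<Longrightarrow> c \<noteq> x \<Longrightarrow> \<sigma> c = []"
  shows "subst \<sigma> u = replicate (cb u s x) l @ m # replicate (occ u x - cb u s x) l"
proof -
  obtain a b where u: "u = a @ s # b" "s \<notin> set a" and b: "s \<notin> set b"
    using assms(1) by (rule simple_split)
  have "subst \<sigma> a = replicate (occ a x) l"
    using assms u by (intro subst_only) auto
  moreover have "subst \<sigma> b = replicate (occ b x) l"
    using assms u b by (intro subst_only) auto
  moreover have "cb u s x = occ a x" using u by (simp add: cb_append)
  ultimately show ?thesis using u assms(2,3) by simp
qed

lemma cb_mono: "cb u t y = 0 \<Longrightarrow> y \<noteq> t \<Longrightarrow> cb u t x \<le> cb u y x"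
  by (induction u) (auto split: if_splits)

lemma cb_antimono: "0 < cb u s y \<Longrightarrow> cb u y x \<le> cb u s x"
  by (induction u) (auto split: if_splits)

context J_theory
begin

lemma pow_after:
  assumes "x \<in> set p" "0 < n"
  shows "p @ replicate n x @ q \<approx> p @ x # q"
proof -
  have "p @ x # q \<approx> p @ x # replicate n x @ q" for n
  proof (induction n)
    case (Suc n)
    then show ?case using trans [OF Suc dup [OF assms(1), of "replicate n x @ q"]] by simp
  qed simp
  then show ?thesis using assms(2) sym by (cases n) auto
qed

lemma pow2: "2 \<le> n \<Longrightarrow> p @ replicate n x @ q \<approx> p @ x # x # q"
  using pow_after [of x "p @ [x]" "n - 1" q] by (cases n) simp_all

section \<open>Violated counts and positions relative to simple letters\<close>

lemma content_violation:
  assumes uv: "u \<approx> v" and "set u \<noteq> set v"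
  shows "ax_T \<subseteq> \<theta>"
proof -
  have *: "ax_T \<subseteq> \<theta>" if "a \<approx> b" "x \<in> set a" "x \<notin> set b" for a b x
  proof -
    define n where "n = occ a x"
    have n: "0 < n" using that by (simp add: n_def occ_pos)
    define \<sigma> where "\<sigma> c = (if c = x then [LX] else [])" for c
    have 0: "replicate n LX \<approx> []"
      using subst [OF that(1), of \<sigma>] subst_only [of \<sigma> x LX a] subst_only [of \<sigma> x LX b] that(3)
      by (simp add: \<sigma>_def n_def count_notin)
    have 1: "replicate n LX @ p \<approx> p" for p using ctxt [OF 0, of "[]" p] by simp
    \<comment> \<open>The exponent \<open>n\<close> may be 1; its double is at least 2, so
      \<open>pow2\<close> turns the power into a square.\<close>
    have nn: "replicate (n + n) LX \<approx> []" using trans [OF 1 [of "replicate n LX"]] 1 [of "[]"] by (simp add: replicate_add)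
    have "replicate (n + n) LX \<approx> [LX, LX]" using pow2 [of "n + n" "[]" LX "[]"] n by simp
    then have 2: "[LX, LX] \<approx> []" by (rule trans [OF sym nn])
    have "[LX] \<approx> [LX, LX, LX]" using sym [OF ctxt [OF 2, of "[]" "[LX]"]] by simp
    also have "\<dots> \<approx> [LX, LX]" using sym [OF ax1 [of "[]" "[LX]" "[]" "[]"]] by simp
    also have "\<dots> \<approx> []" by (rule 2)
    finally show ?thesis by (simp add: ax_T_def equ_def)
  qed
  show ?thesis using assms *[OF uv] *[OF sym [OF uv]] by blast
qed

text \<open>The violation gives x \<approx> x^k with k at least 2, hence idempotence; then all
  elements commute because squares do.\<close>

lemma count_violation:
  assumes uv: "u \<approx> v" and "\<not> agree_count u v"
  shows "ax_SL \<subseteq> \<theta>"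
proof (cases "set u = set v")
  case False
  then show ?thesis using T_imp content_violation [OF uv] by blast
next
  case True
  have *: "ax_SL \<subseteq> \<theta>" if "a \<approx> b" "simple a x" "multiple b x" for a b x
  proof -
    define \<sigma> where "\<sigma> c = (if c = x then [LX] else [])" for c
    have "[LX] \<approx> replicate (occ b x) LX"
      using subst [OF that(1), of \<sigma>] subst_only [of \<sigma> x LX a] subst_only [of \<sigma> x LX b] that(2)
      by (simp add: \<sigma>_def)
    also have "\<dots> \<approx> [LX, LX]" using pow2 [OF that(3), of "[]" LX "[]"] by simp
    finally have 1: "[LX] \<approx> [LX, LX]" .
    then have sq: "p @ X @ q \<approx> p @ X @ X @ q" for p X q
      using inst [of "[LX]" "[LX,LX]" p X "[]" "[]" "[]" q] by (simp add: equ_def)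
    have "[LX, LY] \<approx> [LX, LX, LY]" using sq [of "[]" "[LX]" "[LY]"] by simp
    also have "\<dots> \<approx> [LX, LX, LY, LY]" using sq [of "[LX, LX]" "[LY]" "[]"] by simp
    also have "\<dots> \<approx> [LY, LY, LX, LX]" using ax2 [of "[]" "[LX]" "[LY]" "[]"] by simp
    also have "\<dots> \<approx> [LY, LX, LX]" using sym [OF sq [of "[]" "[LY]" "[LX, LX]"]] by simp
    also have "\<dots> \<approx> [LY, LX]" using sym [OF sq [of "[LY]" "[LX]" "[]"]] by simp
    finally show ?thesis using 1 by (simp add: ax_SL_def equ_def)
  qed
  obtain x where x: "min 2 (occ u x) \<noteq> min 2 (occ v x)"
    using assms(2) by (auto simp: agree_count_def)
  moreover have "occ u x = 0 \<longleftrightarrow> occ v x = 0" using True by (simp add: count_list_0_iff)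
  ultimately have "simple u x \<and> multiple v x \<or> simple v x \<and> multiple u x"
    by linarith
  then show ?thesis using *[OF uv] *[OF sym [OF uv]] by blast
qed

lemma pair_identity:
  assumes uv: "u \<approx> v" "simple u s" "simple v s" "s \<noteq> x"
  shows "replicate (cb u s x) l @ m # replicate (occ u x - cb u s x) l \<approx>
    replicate (cb v s x) l @ m # replicate (occ v x - cb v s x) l"
proof -
  define \<sigma> where "\<sigma> c = (if c = s then [m] else if c = x then [l] else [])" for c
  show ?thesis
    using subst [OF uv(1), of \<sigma>] subst_pair [of u s x \<sigma> m l] subst_pair [of v s x \<sigma> m l] assms
    by (simp add: \<sigma>_def)
qed

lemma simple_violation:
  assumes uv: "u \<approx> v" and c: "agree_count u v" and "\<not> agree_simple u v"
  shows "ax_C \<subseteq> \<theta>"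
proof -
  have *: "[LX, LY] \<approx> [LY, LX]"
    if "a \<approx> b" "simple a s" "simple b s" "simple a t" "simple b t"
      "cb a s t = 0" "cb b s t \<noteq> 0" for a b s t
  proof -
    have "s \<noteq> t" using that by auto
    moreover have "cb b s t = 1" using that cb_le_count [of b s t] by simp
    ultimately show ?thesis using pair_identity [OF that(1-3), of t LY LX] that by simp
  qed
  obtain s t where st: "simple u s" "simple u t" "(cb u s t = 0) \<noteq> (cb v s t = 0)"
    using assms(3) by (auto simp: agree_simple_def)
  moreover from st have "simple v s" "simple v t"
    using agree_count_simple [OF c] by blast+
  ultimately have "[LX, LY] \<approx> [LY, LX]" using *[OF uv] *[OF sym [OF uv]] by blast
  moreover have "[LX, LX] \<approx> [LX, LX, LX]" using ax1 [of "[]" "[LX]" "[]" "[]"] by simp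
  ultimately show ?thesis by (simp add: ax_C_def equ_def)
qed

lemma fst_violation:
  assumes uv: "u \<approx> v" and c: "agree_count u v" and "\<not> agree_fst u v"
  shows "ax_dE \<subseteq> \<theta>"
proof (cases "agree_simple u v")
  case False
  then show ?thesis using simple_violation [OF uv c] C_imp_D D_imp_dE by blast
next
  case True
  have *: "[LT 0, LX, LX] \<approx> [LX, LT 0, LX]"
    if ab: "a \<approx> b" "simple a s" "simple b s" "multiple a x" "multiple b x"
      "cb a s x = 0" "cb b s x \<noteq> 0" for a b s x
  proof -
    have "s \<noteq> x" using ab by auto
    define i j where "i = cb b s x" and "j = occ b x - cb b s x"
    have "LT 0 # replicate (occ a x) LX \<approx> replicate i LX @ LT 0 # replicate j LX"
      using pair_identity [OF ab(1-3) \<open>s \<noteq> x\<close>, of LX "LT 0"] ab(6) by (simp add: i_def j_def)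
    \<comment> \<open>The extra \<open>x\<close> at the end is needed because the exponent
      \<open>j\<close> behind \<open>t\<close> may be 0.\<close>
    from ctxt [OF this, of "[]" "[LX]"]
    have 0: "[LT 0] @ replicate (occ a x + 1) LX @ [] \<approx> replicate i LX @ LT 0 # replicate (j + 1) LX"
      by (simp add: replicate_append_same)
    have "[LT 0] @ [LX, LX] \<approx> replicate i LX @ LT 0 # replicate (j + 1) LX"
      using trans [OF sym [OF pow2] 0] ab by simp
    also have "\<dots> \<approx> replicate i LX @ LT 0 # [LX]"
      using pow_after [of LX "replicate i LX @ [LT 0]" "j + 1" "[]"] ab by (simp add: i_def)
    finally have 1: "[LT 0, LX, LX] \<approx> replicate i LX @ [LT 0, LX]" by simp
    show ?thesis
    proof (cases "i = 1")
      case True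
      with 1 show ?thesis by simp
    next
      case False
      then have "2 \<le> i" using ab by (simp add: i_def)
      then have 2: "[LT 0, LX, LX] \<approx> [LX, LX, LT 0, LX]"
        using trans [OF 1] pow2 [of i "[]" LX "[LT 0, LX]"] by simp
      have "[LT 0, LX, LX] \<approx> [LX, LX, LT 0, LX]" by (rule 2)
      also have "\<dots> \<approx> [LX, LX, LX, LT 0, LX]" using ax1 [of "[]" "[LX]" "[]" "[LT 0, LX]"] by simp
      \<comment> \<open>Substitutes \<open>xt\<close> for \<open>t\<close> in the identity just
        obtained.\<close>
      also have "\<dots> \<approx> [LX, LT 0, LX, LX]"
        using sym [OF inst [of _ _ "[]" "[LX]" "[]" "[]" "[LX, LT 0]" "[]", OF 2 [unfolded equ_def]]] by simp
      also have "\<dots> \<approx> [LX, LT 0, LX]" using sym [OF ax1 [of "[]" "[LX]" "[LT 0]" "[]"]] by simp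
      finally show ?thesis .
    qed
  qed
  obtain s x where s: "simple u s" "(cb u s x = 0) \<noteq> (cb v s x = 0)"
    using assms(3) unfolding agree_fst_def by blast
  then have s': "simple v s" using agree_count_simple [OF c, of s] by simp
  have "multiple u x"
  proof (rule ccontr)
    assume *: "\<not> multiple u x"
    have "occ u x \<noteq> 0"
      using s agree_count_zero [OF c, of x] cb_le_count [of u s x] cb_le_count [of v s x] by auto
    then have "simple u x" using * by linarith
    then show False using True s by (simp add: agree_simple_def)
  qed
  moreover from this have "multiple v x" using agree_count_multiple [OF c, of x] by simp
  ultimately have "[LT 0, LX, LX] \<approx> [LX, LT 0, LX]"
    using s s' *[OF uv] *[OF sym [OF uv]] by blast
  then have "[LY, LX, LX] \<approx> [LX, LY, LX]"
    using inst [of "[LT 0, LX, LX]" "[LX, LT 0, LX]" "[]" "[LX]" "[]" "[]" "[LY]" "[]"] by (simp add: equ_def)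
  moreover have "[LX, LX] \<approx> [LX, LX, LX]" using ax1 [of "[]" "[LX]" "[]" "[]"] by simp
  moreover have "[LY, LY, LX, LX] \<approx> [LX, LX, LY, LY]" using ax2 [of "[]" "[LY]" "[LX]" "[]"] by simp
  ultimately show ?thesis by (simp add: ax_dE_def equ_def)
qed

lemma last_violation:
  assumes uv: "u \<approx> v" and c: "agree_count u v" and "\<not> agree_last u v"
  shows "ax_F \<subseteq> \<theta>"
proof (cases "agree_simple u v")
  case False
  then show ?thesis using simple_violation [OF uv c] C_imp_D D_imp_E E_imp_F by blast
next
  case True
  have *: "[LX, LX, LT 0] \<approx> [LX, LX, LT 0, LX]"
    if ab: "a \<approx> b" "simple a s" "simple b s" "multiple a x" "multiple b x"
      "cb a s x < occ a x" "\<not> cb b s x < occ b x" for a b s x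
  proof -
    have "s \<noteq> x" using ab by auto
    define i j k where "i = cb a s x" and "j = occ a x - cb a s x" and "k = occ b x"
    have "cb b s x = k" using ab(7) cb_le_count [of b s x] by (simp add: k_def)
    then have "replicate i LX @ LT 0 # replicate j LX \<approx> replicate k LX @ [LT 0]"
      using pair_identity [OF ab(1-3) \<open>s \<noteq> x\<close>, of LX "LT 0"] ab(6) by (simp add: i_def j_def k_def)
    \<comment> \<open>Two \<open>x\<close> in front absorb the exponents before \<open>t\<close>,
      whatever they are.\<close>
    from ctxt [OF this, of "[LX, LX]" "[]"]
    have 0: "[LX, LX] @ replicate i LX @ LT 0 # replicate j LX \<approx> [LX, LX] @ replicate k LX @ [LT 0]"
      by simp
    have pow: "[LX, LX] @ replicate n LX @ r \<approx> [LX, LX] @ r" for n r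
      using pow_after [of LX "[LX]" "n + 1" r] by simp
    have "[LX, LX, LT 0] \<approx> [LX, LX] @ replicate k LX @ [LT 0]" using sym [OF pow] by simp
    also have "\<dots> \<approx> [LX, LX] @ replicate i LX @ LT 0 # replicate j LX" by (rule sym [OF 0])
    also have "\<dots> \<approx> [LX, LX] @ LT 0 # replicate j LX" by (rule pow)
    also have "\<dots> \<approx> [LX, LX, LT 0, LX]"
      using pow_after [of LX "[LX, LX, LT 0]" j "[]"] ab(6) by (simp add: j_def)
    finally show ?thesis .
  qed
  obtain s x where s: "simple u s"
    "(cb u s x < occ u x) \<noteq> (cb v s x < occ v x)"
    using assms(3) unfolding agree_last_def by blast
  then have s': "simple v s" using agree_count_simple [OF c, of s] by simp
  have "multiple u x"
  proof (rule ccontr)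
    assume *: "\<not> multiple u x"
    have "occ u x \<noteq> 0" using s agree_count_zero [OF c, of x] by auto
    then have x1: "simple u x" using * by linarith
    then have "simple v x" using agree_count_simple [OF c, of x] by simp
    moreover have "cb u s x = 0 \<longleftrightarrow> cb v s x = 0" using True s x1 by (simp add: agree_simple_def)
    ultimately show False using s x1 by auto
  qed
  moreover from this have "multiple v x" using agree_count_multiple [OF c, of x] by simp
  ultimately have f: "([LX, LX, LT 0], [LX, LX, LT 0, LX]) \<in> \<theta>"
    unfolding equ_def [symmetric] using s s' *[OF uv] *[OF sym [OF uv]] by blast
  have "[LX,LY,LX,LZ 0] \<approx> [LX,LY,LX,LX,LZ 0]" using ax1 [of "[]" "[LX]" "[LY]" "[LZ 0]"] by simp
  also have "\<dots> \<approx> [LX,LY,LX,LX,LZ 0,LX]"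
    using inst [OF f, of "[LX, LY]" "[LX]" "[]" "[]" "[LZ 0]" "[]"] by simp
  also have "\<dots> \<approx> [LX,LY,LX,LZ 0,LX]" using sym [OF ax1 [of "[]" "[LX]" "[LY]" "[LZ 0, LX]"]] by simp
  finally show ?thesis using J Phi_ax_J by (auto simp: ax_F_def equ_def)
qed

text \<open>First occurrences agree, so the counts before the simple letter are 1 in one word and at
  least 2 in the other; reducing the exponents leaves \<open>id_double\<close>.\<close>

lemma snd_violation:
  assumes uv: "u \<approx> v" and c: "agree_count u v" and f: "agree_fst u v" and "\<not> agree_snd u v"
  shows "id_double \<in> \<theta>"
proof -
  have *: "[LX,LX,LT 0,LX] \<approx> [LX,LT 0,LX]"
    if ab: "a \<approx> b" "simple a s" "simple b s" "multiple b x"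
      "2 \<le> cb a s x" "cb b s x = 1" for a b s x
  proof -
    have "s \<noteq> x" using ab by auto
    define i j k where "i = cb a s x" and "j = occ a x - cb a s x" and "k = occ b x - 1"
    have "replicate i LX @ LT 0 # replicate j LX \<approx> LX # LT 0 # replicate k LX"
      using pair_identity [OF ab(1-3) \<open>s \<noteq> x\<close>, of LX "LT 0"] ab(6) by (simp add: i_def j_def k_def)
    from ctxt [OF this, of "[]" "[LX]"]
    have 0: "replicate i LX @ LT 0 # replicate (j + 1) LX \<approx> LX # LT 0 # replicate (k + 1) LX"
      by (simp add: replicate_append_same)
    have "[LX,LX,LT 0,LX] \<approx> [LX, LX, LT 0] @ replicate (j + 1) LX"
      using sym [OF pow_after [of LX "[LX, LX, LT 0]" "j + 1" "[]"]] by simp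
    also have "\<dots> \<approx> replicate i LX @ LT 0 # replicate (j + 1) LX"
      using sym [OF pow2 [of i "[]" LX "LT 0 # replicate (j + 1) LX"]] ab(5) by (simp add: i_def)
    also have "\<dots> \<approx> LX # LT 0 # replicate (k + 1) LX" by (rule 0)
    also have "\<dots> \<approx> [LX, LT 0, LX]" using pow_after [of LX "[LX, LT 0]" "k + 1" "[]"] by simp
    finally show ?thesis .
  qed
  obtain s x where s: "simple u s" "min 2 (cb u s x) \<noteq> min 2 (cb v s x)"
    using assms(4) unfolding agree_snd_def by blast
  then have s': "simple v s" using agree_count_simple [OF c, of s] by simp
  have "cb u s x = 0 \<longleftrightarrow> cb v s x = 0" using f s by (simp add: agree_fst_def)
  then have or: "2 \<le> cb u s x \<and> cb v s x = 1 \<or> 2 \<le> cb v s x \<and> cb u s x = 1" using s(2) by linarith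
  then have "multiple u x \<or> multiple v x"
    using cb_le_count [of u s x] cb_le_count [of v s x] by linarith
  then have "multiple u x" "multiple v x" using agree_count_multiple [OF c, of x] by auto
  then show ?thesis unfolding equ_def [symmetric] using or s s' *[OF uv] *[OF sym [OF uv]] by blast
qed

section \<open>Violated order of two multiple letters\<close>

lemma parted_obtain:
  assumes a0: "agree0 u v" and m: "multiple u x" "multiple u y"
    and P: "parted u x y" and diff: "min 2 (cb u y x) \<noteq> min 2 (cb v y x)"
  obtains t where "simple u t" "\<not> cb u t x < occ u x" "cb u t y = 1"
    "simple v t" "\<not> cb v t x < occ v x" "cb v t y = 1" "t \<noteq> x" "t \<noteq> y"
proof -
  obtain t where t: "simple u t" "\<not> cb u t x < occ u x" "cb u t y \<le> 1"
    using P by (auto simp: parted_def)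
  have ne: "t \<noteq> x" "t \<noteq> y" using t m by auto
  have v: "simple v t" "\<not> cb v t x < occ v x" "multiple v x"
    using agree0_simple [OF a0, of t] agree0_after [OF a0 t(1), of x] agree0_multiple [OF a0, of x] t m by auto
  have cb: "cb u t y = 1 \<longleftrightarrow> cb v t y = 1" "cb u t y = 0 \<longleftrightarrow> cb v t y = 0"
    using min2_eq [OF agree0_cb [OF a0 t(1), of y]] by simp_all
  \<comment> \<open>Otherwise, in both words, all \<open>x\<close> precede \<open>t\<close> and
    \<open>t\<close> precedes the first \<open>y\<close>, so the truncated counts would
    agree.\<close>
  have "cb u t y \<noteq> 0"
  proof
    assume 0: "cb u t y = 0"
    then have "2 \<le> cb u y x" "2 \<le> cb v y x"
      using cb_mono [OF 0, of x] cb_mono [of v t y x] cb ne t v m by auto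
    with diff show False by simp
  qed
  with that t v cb ne show thesis by auto
qed

lemma spread_obtain:
  assumes a0: "agree0 u v" and m: "multiple u x" "multiple u y" and P: "spread u x"
  obtains s where "simple u s" "cb u s x = 1" "simple v s" "cb v s x = 1" "s \<noteq> x" "s \<noteq> y"
    "cb u s y = 0 \<longleftrightarrow> cb v s y = 0"
proof -
  obtain s where s: "simple u s" "cb u s x = 1" using P by (auto simp: spread_def)
  have "simple v s" "cb v s x = 1" "cb u s y = 0 \<longleftrightarrow> cb v s y = 0"
    using agree0_simple [OF a0, of s] min2_eq [OF agree0_cb [OF a0 s(1), of x]]
      min2_eq [OF agree0_cb [OF a0 s(1), of y]] s by auto
  moreover have "s \<noteq> x" "s \<noteq> y" using s m by auto
  ultimately show thesis using that [OF s] by simp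
qed

text \<open>Restricted to \<open>x\<close>, \<open>y\<close> and the witness \<open>t\<close>, each
  word becomes x^i y x^j t y^k. If i > 0, \<open>w1\<close> draws the remaining \<open>x\<close> in
  front of \<open>y\<close>, so only the presence of an \<open>x\<close> before \<open>y\<close>
  counts.\<close>

lemma parted_violation:
  assumes uv: "u \<approx> v" and a0: "agree0 u v" and xy: "x \<noteq> y"
    and m: "multiple u x" "multiple u y"
    and P: "parted u x y" and diff: "cb u y x = 0 \<longleftrightarrow> cb v y x \<noteq> 0"
  shows "ax_H \<subseteq> \<theta>"
proof -
  have "min 2 (cb u y x) \<noteq> min 2 (cb v y x)" using diff by linarith
  then obtain t where t: "simple u t" "\<not> cb u t x < occ u x" "cb u t y = 1"
    and v: "simple v t" "\<not> cb v t x < occ v x" "cb v t y = 1" and ne: "t \<noteq> x" "t \<noteq> y"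
    using parted_obtain [OF a0 m P] by metis
  have mv: "multiple v x" "multiple v y"
    using m agree0_multiple [OF a0, of x] agree0_multiple [OF a0, of y] by auto
  define \<sigma> where "\<sigma> c = (if c = x then [LX] else if c = y then [LY] else if c = t then [LT 0] else [])" for c
  have shape: "\<exists>n k. 2 \<le> n \<and> 0 < k \<and> cb a y x \<le> n \<and>
      subst \<sigma> a = replicate (cb a y x) LX @ LY # replicate (n - cb a y x) LX @ LT 0 # replicate k LY"
    if a: "simple a t" "\<not> cb a t x < occ a x" "cb a t y = 1"
      "multiple a x" "multiple a y" for a
  proof -
    obtain b d where bd: "a = b @ t # d" "t \<notin> set b" and td: "t \<notin> set d"
      using a(1) by (rule simple_split)
    have by1: "simple b y" using a bd by (simp add: cb_append)
    then have "0 < occ b y" by simp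
    then have yb: "y \<in> set b" by (simp only: occ_pos)
    have dx: "occ d x = 0" using a bd ne by (simp add: cb_append)
    then have xd: "x \<notin> set d" by (simp add: count_list_0_iff)
    have "subst \<sigma> b = replicate (cb b y x) LX @ LY # replicate (occ b x - cb b y x) LX"
      using bd xy by (intro subst_pair by1) (auto simp: \<sigma>_def)
    moreover have "subst \<sigma> d = replicate (occ d y) LY"
      using td xd xy by (intro subst_only) (auto simp: \<sigma>_def)
    moreover have "cb a y x = cb b y x" using bd yb by (simp add: cb_append)
    ultimately show ?thesis
      using a bd ne by1 dx cb_le_count [of b y x]
      by (intro exI [of _ "occ b x"] exI [of _ "occ d y"]) (auto simp: \<sigma>_def)
  qed
  have nf: "subst \<sigma> a \<approx> (if cb a y x = 0 then [LY,LX,LX,LT 0,LY] else [LX,LX,LY,LT 0,LY])"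
    if a: "simple a t" "\<not> cb a t x < occ a x" "cb a t y = 1"
      "multiple a x" "multiple a y" for a
  proof -
    obtain n k where nk: "2 \<le> n" "0 < k" "cb a y x \<le> n"
      "subst \<sigma> a = replicate (cb a y x) LX @ LY # replicate (n - cb a y x) LX @ LT 0 # replicate k LY"
      using shape [OF a] by blast
    define i where "i = cb a y x"
    have "subst \<sigma> a \<approx> replicate i LX @ LY # replicate (n - i) LX @ [LT 0, LY]"
      using pow_after [of LY "replicate i LX @ LY # replicate (n - i) LX @ [LT 0]" k "[]"] nk i_def by simp
    also have "\<dots> \<approx> (if i = 0 then [LY,LX,LX,LT 0,LY] else [LX,LX,LY,LT 0,LY])"
    proof (cases "i = 0")
      case True
      then show ?thesis using pow2 [of n "[LY]" LX "[LT 0, LY]"] nk by simp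
    next
      case False
      show ?thesis
      proof (cases "n = i")
        case True
        then show ?thesis using pow2 [of n "[]" LX "[LY, LT 0, LY]"] nk by simp
      next
        case ni: False
        have "replicate i LX @ LY # replicate (n - i) LX @ [LT 0, LY] \<approx> replicate i LX @ [LY, LX, LT 0, LY]"
          using pow_after [of LX "replicate i LX @ [LY]" "n - i" "[LT 0, LY]"] ni False nk i_def by simp
        also have "\<dots> = replicate (i - 1) LX @ [LX, LY, LX, LT 0, LY]"
          using False by (cases i) (simp_all add: replicate_app_Cons_same)
        also have "\<dots> \<approx> replicate (i - 1) LX @ [LX, LX, LY, LT 0, LY]"
          using w1 [of "replicate (i - 1) LX" "[LX]" "[LY]" "[LT 0]" "[]"] by simp
        also have "\<dots> = replicate (i + 1) LX @ [LY, LT 0, LY]"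
          using False by (cases i) (simp_all add: replicate_app_Cons_same)
        also have "\<dots> \<approx> [LX, LX, LY, LT 0, LY]"
          using pow2 [of "i + 1" "[]" LX "[LY, LT 0, LY]"] False by simp
        finally show ?thesis using False by simp
      qed
    qed
    finally show ?thesis by (simp add: i_def)
  qed
  have "subst \<sigma> u \<approx> subst \<sigma> v" by (rule subst [OF uv])
  with nf [OF t m] nf [OF v mv]
  have "(if cb u y x = 0 then [LY,LX,LX,LT 0,LY] else [LX,LX,LY,LT 0,LY]) \<approx>
    (if cb v y x = 0 then [LY,LX,LX,LT 0,LY] else [LX,LX,LY,LT 0,LY])"
    using sym trans by meson
  then have 1: "[LX,LX,LY,LT 0,LY] \<approx> [LY,LX,LX,LT 0,LY]" using diff sym by (auto split: if_splits)
  have 2: "[LX,LX,LY,LT 0,LY] \<approx> [LX,LY,LX,LT 0,LY]"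
    using sym [OF w1 [of "[]" "[LX]" "[LY]" "[LT 0]" "[]"]] by simp
  note ax_common
  with 2 trans [OF sym [OF 2] 1] show ?thesis by (simp add: ax_H_def equ_def)
qed

lemma spread_decomposition:
  assumes "simple u s" "simple u t" "cb u s x = 1"
    "\<not> cb u t x < occ u x" "multiple u x"
  obtains a b d where "u = a @ s # b @ t # d" "s \<notin> set (a @ b @ d)" "t \<notin> set (a @ b @ d)" "s \<noteq> t"
    "simple a x" "occ b x = occ u x - 1" "x \<notin> set d" "s \<noteq> x" "t \<noteq> x"
proof -
  have ne: "s \<noteq> x" "t \<noteq> x" "s \<noteq> t" using assms by auto
  obtain a r where u: "u = a @ s # r" "s \<notin> set a" and sr: "s \<notin> set r"
    using assms(1) by (rule simple_split)
  have ax: "simple a x" using assms(3) u by (simp add: cb_append)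
  have ta: "t \<notin> set a"
  proof
    assume "t \<in> set a"
    then have "cb u t x \<le> 1" using u ax cb_le_count [of a t x] by (simp add: cb_append)
    with assms show False by simp
  qed
  then have "simple r t" using assms(2) u ne by (simp add: count_notin)
  then obtain b d where r: "r = b @ t # d" "t \<notin> set b" and td: "t \<notin> set d" by (rule simple_split)
  have "occ d x = 0" using assms(4) u r ta ne by (simp add: cb_append)
  then have "x \<notin> set d" "occ b x = occ u x - 1"
    using u r ax ne by (simp_all add: count_list_0_iff)
  with that u r sr ta td ax ne show thesis by simp
qed

text \<open>Two witnesses are kept, \<open>s\<close> for \<open>spread\<close> and \<open>t\<close>
  for \<open>parted\<close>. They pin each word to \<open>xy\<close> or \<open>yx\<close> followed
  by s x^k t y^m with positive exponents.\<close>

lemma spread_violation: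
  assumes uv: "u \<approx> v" and a0: "agree0 u v" and xy: "x \<noteq> y"
    and m: "multiple u x" "multiple u y"
    and P: "parted u x y" "spread u x" and diff: "cb u y x = 0 \<longleftrightarrow> cb v y x \<noteq> 0"
  shows "id_swap \<in> \<theta>"
proof -
  have "min 2 (cb u y x) \<noteq> min 2 (cb v y x)" using diff by linarith
  then obtain t where t: "simple u t" "\<not> cb u t x < occ u x" "cb u t y = 1"
    and vt: "simple v t" "\<not> cb v t x < occ v x" "cb v t y = 1" and tne: "t \<noteq> x" "t \<noteq> y"
    using parted_obtain [OF a0 m P(1)] by metis
  obtain s where s: "simple u s" "cb u s x = 1" and vs: "simple v s" "cb v s x = 1"
    and sne: "s \<noteq> x" "s \<noteq> y" and sy: "cb u s y = 0 \<longleftrightarrow> cb v s y = 0"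
    using spread_obtain [OF a0 m P(2)] by metis
  note ne = tne sne
  have mv: "multiple v x" "multiple v y"
    using m agree0_multiple [OF a0, of x] agree0_multiple [OF a0, of y] by auto
  \<comment> \<open>Otherwise the \<open>x\<close> before \<open>s\<close> would precede the first
    \<open>y\<close> in both words.\<close>
  have usy: "cb u s y \<noteq> 0"
  proof
    assume 0: "cb u s y = 0"
    then have "1 \<le> cb u y x" "1 \<le> cb v y x"
      using cb_mono [OF 0, of x] cb_mono [of v s y x] ne s vs sy by auto
    with diff show False by simp
  qed
  then have vsy: "cb v s y \<noteq> 0" using sy by simp
  define \<sigma> where "\<sigma> c = (if c = x then [LX] else if c = y then [LY] else if c = s then [LZ 0]
    else if c = t then [LT 0] else [])" for c
  have nf: "subst \<sigma> a \<approx> (if cb a y x = 0 then [LY,LX,LZ 0,LX,LT 0,LY] else [LX,LY,LZ 0,LX,LT 0,LY])"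
    if a: "simple a s" "simple a t" "cb a s x = 1" "\<not> cb a t x < occ a x"
      "multiple a x" "multiple a y" "cb a t y = 1" "cb a s y \<noteq> 0" for a
  proof -
    obtain b c d where bcd: "a = b @ s # c @ t # d" "s \<notin> set (b @ c @ d)" "t \<notin> set (b @ c @ d)" "s \<noteq> t"
      "simple b x" "occ c x = occ a x - 1" "x \<notin> set d"
      using spread_decomposition [OF a(1-5)] by metis
    have "cb a s y = occ b y" "cb a t y = occ b y + occ c y"
      using bcd ne by (auto simp: cb_append)
    then have y: "simple b y" "occ c y = 0" using a by simp_all
    then have yc: "y \<notin> set c" by (simp add: count_list_0_iff)
    have "0 < occ b y" using y by simp
    then have yb: "y \<in> set b" by (simp only: occ_pos)
    have "subst \<sigma> b = replicate (cb b y x) LX @ LY # replicate (occ b x - cb b y x) LX"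
      using bcd xy by (intro subst_pair y) (auto simp: \<sigma>_def)
    moreover have "subst \<sigma> c = replicate (occ c x) LX"
      using bcd yc by (intro subst_only) (auto simp: \<sigma>_def)
    moreover have "subst \<sigma> d = replicate (occ d y) LY"
      using bcd xy by (intro subst_only) (auto simp: \<sigma>_def)
    moreover have cby: "cb a y x = cb b y x" using bcd yb by (simp add: cb_append)
    ultimately have eq: "subst \<sigma> a = replicate (cb a y x) LX @ LY # replicate (1 - cb a y x) LX @ LZ 0 #
      replicate (occ c x) LX @ LT 0 # replicate (occ d y) LY"
      using bcd(1,4,5) ne by (simp add: \<sigma>_def)
    have "occ a y = occ b y + occ c y + occ d y" using bcd(1) ne by simp
    then have pos: "0 < occ c x" "0 < occ d y" using a(5,6) bcd(6) y by linarith+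
    have le: "cb a y x \<le> 1" using cb_le_count [of b y x] bcd cby by simp
    define i where "i = cb a y x"
    let ?p = "replicate i LX @ LY # replicate (1 - i) LX @ [LZ 0]"
    have i: "i = 0 \<or> i = 1" using le by (auto simp: i_def)
    have "subst \<sigma> a \<approx> ?p @ LX # LT 0 # replicate (occ d y) LY"
      using pow_after [of LX ?p "occ c x" "LT 0 # replicate (occ d y) LY"] pos i
      unfolding eq i_def [symmetric] by auto
    also have "\<dots> \<approx> ?p @ [LX, LT 0, LY]"
      using pow_after [of LY "?p @ [LX, LT 0]" "occ d y" "[]"] pos by simp
    finally show ?thesis using i by (auto simp: i_def)
  qed
  have "subst \<sigma> u \<approx> subst \<sigma> v" by (rule subst [OF uv])
  with nf [OF s(1) t(1) s(2) t(2) m t(3) usy] nf [OF vs(1) vt(1) vs(2) vt(2) mv vt(3) vsy]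
  have "(if cb u y x = 0 then [LY,LX,LZ 0,LX,LT 0,LY] else [LX,LY,LZ 0,LX,LT 0,LY]) \<approx>
    (if cb v y x = 0 then [LY,LX,LZ 0,LX,LT 0,LY] else [LX,LY,LZ 0,LX,LT 0,LY])"
    using sym trans by meson
  then have "[LX,LY,LZ 0,LX,LT 0,LY] \<approx> [LY,LX,LZ 0,LX,LT 0,LY]" using diff sym by (auto split: if_splits)
  then show ?thesis by (simp add: equ_def)
qed

text \<open>Here \<open>s\<close> comes before the first \<open>y\<close>: the words become x s x^i
  y x^j t y^k, and after an application of \<open>w1\<close> only i = 0 or i > 0 matters.\<close>

lemma second_violation:
  assumes uv: "u \<approx> v" and a0: "agree0 u v" and xy: "x \<noteq> y"
    and m: "multiple u x" "multiple u y"
    and P: "parted u x y" "spread u x" and diff: "2 \<le> cb u y x \<longleftrightarrow> cb v y x = 1" "2 \<le> cb v y x \<longleftrightarrow> cb u y x = 1"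
    and nz: "cb u y x \<noteq> 0"
  shows "ax_I \<subseteq> \<theta>"
proof -
  have "min 2 (cb u y x) \<noteq> min 2 (cb v y x)" using diff nz by linarith
  then obtain t where t: "simple u t" "\<not> cb u t x < occ u x" "cb u t y = 1"
    and vt: "simple v t" "\<not> cb v t x < occ v x" "cb v t y = 1" and tne: "t \<noteq> x" "t \<noteq> y"
    using parted_obtain [OF a0 m P(1)] by metis
  obtain s where s: "simple u s" "cb u s x = 1" and vs: "simple v s" "cb v s x = 1"
    and sne: "s \<noteq> x" "s \<noteq> y" and sy: "cb u s y = 0 \<longleftrightarrow> cb v s y = 0"
    using spread_obtain [OF a0 m P(2)] by metis
  note ne = tne sne
  have mv: "multiple v x" "multiple v y"
    using m agree0_multiple [OF a0, of x] agree0_multiple [OF a0, of y] by auto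
  \<comment> \<open>In the word with two \<open>x\<close> before the first \<open>y\<close>, that
    \<open>y\<close> cannot precede \<open>s\<close>, since only one \<open>x\<close> does.\<close>
  have usy: "cb u s y = 0" and vsy: "cb v s y = 0"
  proof -
    have "cb u s y = 0 \<or> cb v s y = 0"
      using cb_antimono [of u s y x] cb_antimono [of v s y x] s vs diff nz by linarith
    with sy show "cb u s y = 0" "cb v s y = 0" by auto
  qed
  define \<sigma> where "\<sigma> c = (if c = x then [LX] else if c = y then [LY] else if c = s then [LZ 0]
    else if c = t then [LT 0] else [])" for c
  have nf: "subst \<sigma> a \<approx> (if cb a y x = 1 then [LX,LZ 0,LY,LX,LT 0,LY] else [LX,LZ 0,LX,LY,LT 0,LY])"
    if a: "simple a s" "simple a t" "cb a s x = 1" "\<not> cb a t x < occ a x"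
      "multiple a x" "multiple a y" "cb a t y = 1" "cb a s y = 0" "cb a y x \<noteq> 0" for a
  proof -
    obtain b c d where bcd: "a = b @ s # c @ t # d" "s \<notin> set (b @ c @ d)" "t \<notin> set (b @ c @ d)" "s \<noteq> t"
      "simple b x" "occ c x = occ a x - 1" "x \<notin> set d"
      using spread_decomposition [OF a(1-5)] by metis
    have "cb a s y = occ b y" "cb a t y = occ b y + occ c y"
      using bcd ne by (auto simp: cb_append)
    then have y: "occ b y = 0" "simple c y" using a by simp_all
    then have yb: "y \<notin> set b" by (simp add: count_list_0_iff)
    have "0 < occ c y" using y by simp
    then have yc: "y \<in> set c" by (simp only: occ_pos)
    have "subst \<sigma> b = replicate (occ b x) LX"
      using bcd yb by (intro subst_only) (auto simp: \<sigma>_def)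
    then have sb: "subst \<sigma> b = [LX]" using bcd(5) by simp
    have sc: "subst \<sigma> c = replicate (cb c y x) LX @ LY # replicate (occ c x - cb c y x) LX"
      using bcd xy by (intro subst_pair y) (auto simp: \<sigma>_def)
    have sd: "subst \<sigma> d = replicate (occ d y) LY"
      using bcd xy by (intro subst_only) (auto simp: \<sigma>_def)
    have cby: "cb a y x = 1 + cb c y x" using bcd yb yc ne by (simp add: cb_append)
    define i where "i = cb c y x"
    define j where "j = occ c x - i"
    have "occ a y = occ b y + occ c y + occ d y" using bcd(1) ne by simp
    then have pos: "0 < i + j" "0 < occ d y"
      using a(5,6) bcd(6) y cb_le_count [of c y x] by (simp_all add: i_def j_def)
    have "subst \<sigma> a = [LX, LZ 0] @ replicate i LX @ LY # replicate j LX @ LT 0 # replicate (occ d y) LY"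
      using bcd(1,4) ne sb sc sd by (simp add: \<sigma>_def i_def j_def)
    also have "\<dots> \<approx> [LX, LZ 0] @ replicate i LX @ LY # replicate j LX @ [LT 0, LY]"
      using pow_after [of LY "[LX, LZ 0] @ replicate i LX @ LY # replicate j LX @ [LT 0]" "occ d y" "[]"]
        pos by simp
    also have "\<dots> \<approx> (if i = 0 then [LX,LZ 0,LY,LX,LT 0,LY] else [LX,LZ 0,LX,LY,LT 0,LY])"
    proof (cases "i = 0")
      case True
      then show ?thesis using pow_after [of LX "[LX, LZ 0, LY]" j "[LT 0, LY]"] pos by simp
    next
      case False
      have "[LX, LZ 0] @ replicate i LX @ LY # replicate j LX @ [LT 0, LY]
        \<approx> [LX, LZ 0] @ LX # LY # replicate j LX @ [LT 0, LY]"
        using pow_after [of LX "[LX, LZ 0]" i "LY # replicate j LX @ [LT 0, LY]"] False by simp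
      also have "\<dots> \<approx> [LX,LZ 0,LX,LY,LT 0,LY]"
      proof (cases "j = 0")
        case j: False
        have "[LX, LZ 0] @ LX # LY # replicate j LX @ [LT 0, LY] \<approx> [LX,LZ 0,LX,LY,LX,LT 0,LY]"
          using pow_after [of LX "[LX, LZ 0, LX, LY]" j "[LT 0, LY]"] j by simp
        also have "\<dots> \<approx> [LX,LZ 0,LX,LX,LY,LT 0,LY]"
          using w1 [of "[LX, LZ 0]" "[LX]" "[LY]" "[LT 0]" "[]"] by simp
        also have "\<dots> \<approx> [LX,LZ 0,LX,LY,LT 0,LY]"
          using sym [OF ax1 [of "[]" "[LX]" "[LZ 0]" "[LY, LT 0, LY]"]] by simp
        finally show ?thesis .
      qed simp
      finally show ?thesis using False by simp
    qed
    finally show ?thesis using cby by (auto simp: i_def split: if_splits)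
  qed
  have "cb v y x \<noteq> 0" using diff nz by linarith
  note nf [OF s(1) t(1) s(2) t(2) m t(3) usy nz] nf [OF vs(1) vt(1) vs(2) vt(2) mv vt(3) vsy this]
  moreover have "subst \<sigma> u \<approx> subst \<sigma> v" by (rule subst [OF uv])
  ultimately have "(if cb u y x = 1 then [LX,LZ 0,LY,LX,LT 0,LY] else [LX,LZ 0,LX,LY,LT 0,LY]) \<approx>
    (if cb v y x = 1 then [LX,LZ 0,LY,LX,LT 0,LY] else [LX,LZ 0,LX,LY,LT 0,LY])"
    using sym trans by meson
  moreover have "cb u y x = 1 \<longleftrightarrow> cb v y x \<noteq> 1" using diff nz by linarith
  ultimately have "[LX,LZ 0,LX,LY,LT 0,LY] \<approx> [LX,LZ 0,LY,LX,LT 0,LY]"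
    using sym by (cases "cb u y x = 1"; cases "cb v y x = 1") simp_all
  moreover have "Phi \<union> {([LX,LY,LX,LZ 0,LT 0,LX], [LX,LY,LX,LZ 0,LX,LT 0,LX])} \<subseteq> \<theta>"
    using J unfolding ax_J_def by blast
  ultimately show ?thesis by (simp add: ax_I_def equ_def)
qed

end

subsection \<open>Separating the varieties\<close>

lemma subst_singleton: "subst (\<lambda>c. [c]) u = u"
  by (induction u) auto

lemma not_syn: "(u \<in> L) \<noteq> (v \<in> L) \<Longrightarrow> (u, v) \<notin> syn L"
proof
  assume uL: "(u \<in> L) \<noteq> (v \<in> L)" and "(u, v) \<in> syn L"
  then have "[] @ subst (\<lambda>c. [c]) u @ [] \<in> L \<longleftrightarrow> [] @ subst (\<lambda>c. [c]) v @ [] \<in> L"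
    unfolding syn_def by blast
  with uL show False by (simp add: subst_singleton)
qed

lemma cb_append': "cb (p @ q) y x = (if occ p y = 0 then occ p x + cb q y x else cb p y x)"
  by (simp add: cb_append count_list_0_iff)

lemma SL_not_T: "\<not> (var ax_SL :: 'a::infinite monoid set) \<subseteq> var ax_T"
proof (rule var_not_subset [OF fic_syn])
  let ?L = "{u. LX \<in> set u}"
  show "ax_SL \<subseteq> syn ?L" by (auto simp: ax_SL_def syn_def)
  show "([LX], []) \<in> ax_T" by (simp add: ax_T_def)
  show "([LX], []) \<notin> syn ?L" by (rule not_syn) simp
qed

lemma C_not_SL: "\<not> (var ax_C :: 'a::infinite monoid set) \<subseteq> var ax_SL"
proof (rule var_not_subset [OF fic_syn])
  let ?L = "{u. simple u LX}"
  show "ax_C \<subseteq> syn ?L" by (auto simp: ax_C_def syn_def)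
  show "([LX], [LX,LX]) \<in> ax_SL" by (simp add: ax_SL_def)
  show "([LX], [LX,LX]) \<notin> syn ?L" by (rule not_syn) simp
qed

lemma D_not_C: "\<not> (var ax_D :: 'a::infinite monoid set) \<subseteq> var ax_C"
proof (rule var_not_subset [OF fic_syn])
  let ?L = "{u. simple u LX \<and> simple u LY \<and> cb u LY LX = 1}"
  show "ax_D \<subseteq> syn ?L"
    by (auto simp: ax_D_def syn_def cb_append' add_is_1 split: if_splits)
  show "([LX,LY], [LY,LX]) \<in> ax_C" by (simp add: ax_C_def)
  show "([LX,LY], [LY,LX]) \<notin> syn ?L" by (rule not_syn) simp
qed

text \<open>E sees whether the first \<open>x\<close> precedes a simple \<open>t\<close>. Reversal
  makes the same set serve dual E.\<close>

lemma E_syn: "ax_E \<subseteq> syn {u. simple u (LT 0) \<and> cb u (LT 0) LX = 0}"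
  by (auto simp: ax_E_def syn_def cb_append' add_is_1 split: if_splits)

lemma E_not_dE: "\<not> (var ax_E :: 'a::infinite monoid set) \<subseteq> var ax_dE"
proof (rule var_not_subset [OF fic_syn E_syn])
  show "([LY,LX,LX], [LX,LY,LX]) \<in> ax_dE" by (simp add: ax_dE_def)
  define L where "L = {u. simple u (LT 0) \<and> cb u (LT 0) LX = 0}"
  interpret fic "syn L" by (rule fic_syn)
  have "([LY,LX,LX], [LX,LY,LX]) \<notin> syn L"
  proof
    assume "([LY,LX,LX], [LX,LY,LX]) \<in> syn L"
    from inst [OF this, of "[]" "[LX]" "[LT 0]" "[]" "[]" "[]"]
    have "([LT 0,LX,LX], [LX,LT 0,LX]) \<in> syn L" by (simp add: equ_def)
    then show False using not_syn [of "[LT 0,LX,LX]" L "[LX,LT 0,LX]"] by (simp add: L_def)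
  qed
  then show "([LY,LX,LX], [LX,LY,LX]) \<notin> syn {u. simple u (LT 0) \<and> cb u (LT 0) LX = 0}"
    unfolding L_def .
qed

lemma dE_not_F: "\<not> (var ax_dE :: 'a::infinite monoid set) \<subseteq> var ax_F"
proof -
  define L where "L = {u. simple u (LT 0) \<and> cb u (LT 0) LX = 0}"
  interpret fic "rev_id ` syn L" by (rule fic_rev [OF fic_syn])
  have mem: "(u, v) \<in> rev_id ` syn L \<longleftrightarrow> (rev u, rev v) \<in> syn L" for u v
    by (metis (no_types, lifting) image_iff rev_id_rev_id rev_id_simp)
  show ?thesis
  proof (rule var_not_subset [OF fic_rev [OF fic_syn]])
    show "ax_dE \<subseteq> rev_id ` syn L" using E_syn unfolding L_def [symmetric] by (simp add: ax_dE_def ax_E_def mem)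
    show "([LX,LY,LX,LZ 0], [LX,LY,LX,LZ 0,LX]) \<in> ax_F" by (simp add: ax_F_def)
    show "([LX,LY,LX,LZ 0], [LX,LY,LX,LZ 0,LX]) \<notin> rev_id ` syn L"
    proof
      assume "([LX,LY,LX,LZ 0], [LX,LY,LX,LZ 0,LX]) \<in> rev_id ` syn L"
      \<comment> \<open>Erasing \<open>y\<close> and putting \<open>t\<close> for \<open>z\<close>
        leaves \<open>xxt\<close> and \<open>xxtx\<close>; reversed, these are \<open>txx\<close>
        and \<open>xtxx\<close>, which \<open>L\<close> tells apart.\<close>
      from inst [OF this, of "[]" "[LX]" "[]" "[LT 0]" "[]" "[]"]
      have "([LT 0,LX,LX], [LX,LT 0,LX,LX]) \<in> syn L" by (simp add: equ_def mem)
      then show False using not_syn [of "[LT 0,LX,LX]" L "[LX,LT 0,LX,LX]"] by (simp add: L_def)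
    qed
  qed
qed

text \<open>F also sees whether the second \<open>x\<close> precedes \<open>t\<close>, hence the
  bound 1 in place of 0.\<close>

lemma F_syn: "ax_F \<subseteq> syn {u. simple u (LT 0) \<and> cb u (LT 0) LX \<le> 1}"
  by (auto simp: ax_F_def Phi_def syn_def cb_append' add_is_1 split: if_splits)

text \<open>Membership in \<open>A\<close> on both sides restricts the contexts and substitutions
  for which \<open>B\<close> has to be checked.\<close>

lemma syn_refine:
  assumes "(u, v) \<in> syn A"
    and "\<And>p q \<sigma>. p @ subst \<sigma> u @ q \<in> A \<Longrightarrow> p @ subst \<sigma> v @ q \<in> A \<Longrightarrow>
      p @ subst \<sigma> u @ q \<in> B \<longleftrightarrow> p @ subst \<sigma> v @ q \<in> B"
  shows "(u, v) \<in> syn (A \<inter> B)"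
  using assms unfolding syn_def by blast

lemma syn_Int: "e \<in> syn A \<Longrightarrow> e \<in> syn B \<Longrightarrow> e \<in> syn (A \<inter> B)"
  by (auto simp: syn_def)

lemma cb_eq_count_add: "cb p s x = occ p x + n \<longleftrightarrow> cb p s x = occ p x \<and> n = 0"
  using cb_le_count [of p s x] by linarith

section \<open>Sets of words for H, I and J\<close>

definition zero_before :: "letter \<Rightarrow> letter \<Rightarrow> word set" where
  "zero_before s x = {u. simple u s \<and> cb u s x = 0}"

definition one_before :: "letter \<Rightarrow> letter \<Rightarrow> word set" where
  "one_before s x = {u. simple u s \<and> cb u s x = 1}"

definition all_before :: "letter \<Rightarrow> letter \<Rightarrow> word set" where
  "all_before s x = {u. simple u s \<and> cb u s x = occ u x}"

text \<open>This also serves J, whose axioms other than the w-identities are axioms of I.\<close>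

lemma syn_zero: "ax_I \<union> ax_H \<subseteq> syn (zero_before s x)"
  by (auto simp: zero_before_def ax_I_def ax_H_def Phi_def syn_def cb_append' add_is_1 split: if_splits)

lemma syn_one: "ax_I \<union> ax_H \<subseteq> syn (one_before s x)"
  by (auto simp: one_before_def ax_I_def ax_H_def Phi_def syn_def cb_append' add_is_1 split: if_splits)

lemma syn_all: "ax_I \<union> ax_H \<subseteq> syn (all_before s x)"
  by (auto simp: all_before_def ax_I_def ax_H_def Phi_def syn_def cb_append' add_is_1 cb_eq_count_add
      split: if_splits)

lemma cb_zero: "x \<notin> set u \<Longrightarrow> cb u y x = 0"
  using cb_le_count [of u y x] by (simp add: count_notin)

lemma cb0_skip: "cb (p @ X @ r @ X @ q) y x = 0 \<longleftrightarrow> cb (p @ X @ r @ q) y x = 0"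
  by (auto simp: cb_append count_list_0_iff)

lemma in_count: "z \<in> set u \<longleftrightarrow> 0 < occ u z"
  by (simp add: occ_pos)

lemma cb0_swap:
  "(cb (p @ X @ Y @ q) y x = 0) \<noteq> (cb (p @ Y @ X @ q) y x = 0) \<Longrightarrow>
    x \<notin> set p \<and> y \<notin> set p \<and> (x \<in> set X \<and> y \<in> set Y \<or> y \<in> set X \<and> x \<in> set Y)"
  using cb_le_count [of X y x] cb_le_count [of Y y x] by (auto simp: cb_append' in_count split: if_splits)

text \<open>The letters of \<open>X\<close> occur twice in \<open>p\<close> already, so whatever
  \<open>X\<close> adds lies beyond the threshold.\<close>

lemma cb_le_skip:
  assumes "\<forall>c\<in>set X. multiple p c" "k \<le> 1"
  shows "cb (p @ X @ q) y x \<le> k \<longleftrightarrow> cb (p @ q) y x \<le> k"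
proof (cases "y \<in> set p")
  case False
  then have "y \<notin> set X" using assms by (auto simp: count_notin)
  moreover have "occ X x = 0 \<or> multiple p x"
    using assms by (auto simp: count_list_0_iff)
  ultimately show ?thesis using False assms(2) by (elim disjE) (simp_all add: cb_append)
qed (simp add: cb_append)

definition before_le :: "nat \<Rightarrow> word set" where "before_le k = {u. cb u LY LX \<le> k}"

text \<open>In these words \<open>LT 0\<close> witnesses that \<open>LX\<close> and
  \<open>LY\<close> are parted. Likewise \<open>one_before (LZ 0) LX\<close> will make
  \<open>LZ 0\<close> a witness of \<open>spread\<close>.\<close>

abbreviation base :: "word set" where "base \<equiv> one_before (LT 0) LY \<inter> all_before (LT 0) LX"

text \<open>A simple \<open>s\<close> cannot lie in a repeated factor. In \<open>p\<close> it would
  have no \<open>x\<close> in front, and in \<open>q\<close> at least two if \<open>X\<close> or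
  \<open>Y\<close> contained \<open>x\<close>.\<close>

lemma square_context:
  assumes "p @ X @ X @ Y @ Y @ q \<in> one_before s x" "x \<notin> set p"
  shows "x \<notin> set X \<and> x \<notin> set Y"
proof -
  have "occ p x = 0" "cb p s x = 0" using assms(2) cb_le_count [of p s x] by (simp_all add: count_notin)
  then show ?thesis using assms(1)
    by (auto simp: one_before_def cb_append' in_count add_is_1 split: if_splits)
qed

text \<open>The simple \<open>t\<close> lies in \<open>p\<close>, \<open>Z\<close> or
  \<open>q\<close>; correspondingly no \<open>y\<close> precedes it, some \<open>x\<close> follows
  it, or two \<open>y\<close> precede it, each of which is excluded.\<close>

lemma swap_context:
  assumes m: "p @ X @ Y @ Z @ X @ Y @ q \<in> one_before t y \<inter> all_before t x" and p: "y \<notin> set p"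
    and "x \<in> set X \<and> y \<in> set Y \<or> y \<in> set X \<and> x \<in> set Y"
  shows False
proof -
  have "occ p y = 0" "cb p t y = 0" using p cb_le_count [of p t y] by (simp_all add: count_notin)
  then show ?thesis using assms(3) m
    by (auto simp: one_before_def all_before_def cb_append' in_count add_is_1 cb_eq_count_add split: if_splits)
qed

lemma Phi_cases:
  assumes "e \<in> Phi"
  obtains "e = ([LX,LY,LX], [LX,LY,LX,LX])" | "e = ([LX,LX,LY,LY], [LY,LY,LX,LX])"
    | "e = ([LX,LY,LZ 0,LX,LY], [LY,LX,LZ 0,LX,LY])"
  using assms by (auto simp: Phi_def)

lemma syn_common:
  assumes "e \<in> ax_I \<union> ax_H"
  shows "e \<in> syn (one_before s x)" "e \<in> syn (zero_before s x)" "e \<in> syn base"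
    "e \<in> syn (one_before s x \<inter> base)"
  by (intro syn_Int subsetD [OF syn_one assms] subsetD [OF syn_zero assms] subsetD [OF syn_all assms]
      subsetD [OF syn_one] subsetD [OF syn_zero] subsetD [OF syn_all] assms)+

text \<open>With \<open>LX\<close> and \<open>LY\<close> parted by \<open>LT 0\<close>, no axiom of
  \<open>Phi\<close> can exchange the first \<open>LY\<close> with an occurrence of
  \<open>LX\<close>.\<close>

lemma Phi_syn:
  assumes "e \<in> Phi" "k \<le> 1"
  shows "e \<in> syn (base \<inter> before_le k)"
proof -
  obtain u v where uv: "e = (u, v)" by force
  have "(u, v) \<in> syn (base \<inter> before_le k)"
  proof (rule syn_refine)
    show "(u, v) \<in> syn base" using assms by (intro syn_common) (simp add: ax_I_def uv)
    fix p q \<sigma> assume A: "p @ subst \<sigma> u @ q \<in> base"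
    define X Y Z where "X = \<sigma> LX" and "Y = \<sigma> LY" and "Z = \<sigma> (LZ 0)"
    have "cb (p @ subst \<sigma> u @ q) LY LX \<le> k \<longleftrightarrow> cb (p @ subst \<sigma> v @ q) LY LX \<le> k"
      using assms(1)
    proof (cases rule: Phi_cases)
      case 1
      have "\<forall>c\<in>set X. multiple (p @ X @ Y @ X) c" by (auto simp: in_count)
      then show ?thesis using cb_le_skip [of X "p @ X @ Y @ X" k q LY LX] assms(2) 1
        by (simp add: uv X_def Y_def)
    next
      case 2
      have "p @ X @ X @ Y @ Y @ q \<in> base" using A 2 by (simp add: uv X_def Y_def)
      then have "LY \<notin> set p \<Longrightarrow> LY \<notin> set X \<and> LY \<notin> set Y" using square_context by blast
      then have "cb (p @ X @ X @ Y @ Y @ q) LY LX = cb (p @ Y @ Y @ X @ X @ q) LY LX"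
        by (auto simp: cb_append)
      then show ?thesis using 2 by (simp add: uv X_def Y_def)
    next
      case 3
      have "p @ X @ Y @ Z @ X @ Y @ q \<in> base" using A 3 by (simp add: uv X_def Y_def Z_def)
      then have "LY \<notin> set p \<Longrightarrow> \<not> (LX \<in> set X \<and> LY \<in> set Y \<or> LY \<in> set X \<and> LX \<in> set Y)"
        using swap_context by blast
      then have "cb (p @ X @ Y @ Z @ X @ Y @ q) LY LX = cb (p @ Y @ X @ Z @ X @ Y @ q) LY LX"
        by (auto simp: cb_append count_notin cb_zero)
      then show ?thesis using 3 by (simp add: uv X_def Y_def Z_def)
    qed
    then show "p @ subst \<sigma> u @ q \<in> before_le k \<longleftrightarrow> p @ subst \<sigma> v @ q \<in> before_le k"
      by (simp add: before_le_def)
  qed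
  then show ?thesis by (simp add: uv)
qed

lemma insert_syn:
  assumes "k \<le> 1"
  shows "([LX,LY,LX,LZ 0,LT 0,LX], [LX,LY,LX,LZ 0,LX,LT 0,LX]) \<in> syn (base \<inter> before_le k)" (is "?e \<in> _")
proof (rule syn_refine)
  show "?e \<in> syn base" by (intro syn_common) (simp add: ax_I_def)
  fix p q :: word and \<sigma>
  have "\<forall>c\<in>set (\<sigma> LX). multiple (p @ \<sigma> LX @ \<sigma> LY @ \<sigma> LX @ \<sigma> (LZ 0)) c" by (auto simp: in_count)
  then show "p @ subst \<sigma> [LX,LY,LX,LZ 0,LT 0,LX] @ q \<in> before_le k \<longleftrightarrow>
    p @ subst \<sigma> [LX,LY,LX,LZ 0,LX,LT 0,LX] @ q \<in> before_le k"
    using cb_le_skip [of "\<sigma> LX" "p @ \<sigma> LX @ \<sigma> LY @ \<sigma> LX @ \<sigma> (LZ 0)" k "\<sigma> (LT 0) @ \<sigma> LX @ q"] assms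
    by (simp add: before_le_def)
qed

text \<open>The extra axiom of I moves only the second copy of a block, so whether some
  \<open>LX\<close> precedes the first \<open>LY\<close> is unaffected.\<close>

lemma I_syn: "ax_I \<subseteq> syn (base \<inter> before_le 0)"
proof -
  have "([LX,LZ 0,LX,LY,LT 0,LY], [LX,LZ 0,LY,LX,LT 0,LY]) \<in> syn (base \<inter> before_le 0)" (is "?e \<in> _")
  proof (rule syn_refine)
    show "?e \<in> syn base" by (intro syn_common) (simp add: ax_I_def)
    fix p q :: word and \<sigma>
    show "p @ subst \<sigma> [LX,LZ 0,LX,LY,LT 0,LY] @ q \<in> before_le 0 \<longleftrightarrow>
      p @ subst \<sigma> [LX,LZ 0,LY,LX,LT 0,LY] @ q \<in> before_le 0"
      using cb0_skip [of p "\<sigma> LX" "\<sigma> (LZ 0)" "\<sigma> LY @ \<sigma> (LT 0) @ \<sigma> LY @ q"]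
        cb0_skip [of p "\<sigma> LX" "\<sigma> (LZ 0) @ \<sigma> LY" "\<sigma> (LT 0) @ \<sigma> LY @ q"] by (simp add: before_le_def)
  qed
  then show ?thesis using Phi_syn [of _ 0] insert_syn [of 0] unfolding ax_I_def by auto
qed

text \<open>The only delicate axiom moves the first \<open>X\<close> over \<open>Y\<close>. Since
  only the repeated \<open>Y\<close> stands between the two \<open>X\<close>, a simple letter lies
  before or after both of them; so it cannot have exactly one of two copies in front of it.\<close>

lemma H_syn: "ax_H \<subseteq> syn (one_before (LZ 0) LX \<inter> (base \<inter> before_le 0))"
proof
  fix e assume e: "e \<in> ax_H"
  have h1: "([LX,LX,LY,LT 0,LY], [LX,LY,LX,LT 0,LY]) \<in> syn (one_before (LZ 0) LX \<inter> base \<inter> before_le 0)"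
  proof (rule syn_refine)
    show "([LX,LX,LY,LT 0,LY], [LX,LY,LX,LT 0,LY]) \<in> syn (one_before (LZ 0) LX \<inter> base)"
      by (rule syn_common) (simp add: ax_H_def)
    fix p q :: word and \<sigma>
    show "p @ subst \<sigma> [LX,LX,LY,LT 0,LY] @ q \<in> before_le 0 \<longleftrightarrow>
      p @ subst \<sigma> [LX,LY,LX,LT 0,LY] @ q \<in> before_le 0"
      using cb0_skip [of p "\<sigma> LX" "[]" "\<sigma> LY @ \<sigma> (LT 0) @ \<sigma> LY @ q"]
        cb0_skip [of p "\<sigma> LX" "\<sigma> LY" "\<sigma> (LT 0) @ \<sigma> LY @ q"] by (simp add: before_le_def)
  qed
  have h2: "([LX,LY,LX,LT 0,LY], [LY,LX,LX,LT 0,LY]) \<in>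
    syn (one_before (LZ 0) LX \<inter> base \<inter> before_le 0)"
  proof (rule syn_refine)
    show "([LX,LY,LX,LT 0,LY], [LY,LX,LX,LT 0,LY]) \<in> syn (one_before (LZ 0) LX \<inter> base)"
      by (rule syn_common) (simp add: ax_H_def)
    fix p q :: word and \<sigma> :: "letter \<Rightarrow> word"
    define X Y T where "X = \<sigma> LX" and "Y = \<sigma> LY" and "T = \<sigma> (LT 0)"
    assume "p @ subst \<sigma> [LX,LY,LX,LT 0,LY] @ q \<in> one_before (LZ 0) LX \<inter> base"
    then have m: "p @ X @ Y @ X @ T @ Y @ q \<in> one_before (LZ 0) LX" "p @ X @ Y @ X @ T @ Y @ q \<in> one_before (LT 0) LY"
      by (simp_all add: X_def Y_def T_def)
    have 1: False if "LX \<notin> set p" "LX \<in> set X" "LY \<in> set Y"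
    proof -
      have "occ p LX = 0" "cb p (LZ 0) LX = 0" using that cb_le_count [of p "LZ 0" LX] by (simp_all add: count_notin)
      with that(2) m(1) show False
        by (auto simp: one_before_def cb_append' in_count add_is_1 split: if_splits)
    qed
    have 2: False if "LY \<notin> set p" "LY \<in> set X" "LX \<in> set Y"
    proof -
      have "occ p LY = 0" "cb p (LT 0) LY = 0" using that cb_le_count [of p "LT 0" LY] by (simp_all add: count_notin)
      with that(2) m(2) show False
        by (auto simp: one_before_def cb_append' in_count add_is_1 split: if_splits)
    qed
    have "cb (p @ X @ Y @ X @ T @ Y @ q) LY LX = 0 \<longleftrightarrow> cb (p @ Y @ X @ X @ T @ Y @ q) LY LX = 0"
      using cb0_swap [of p X Y "X @ T @ Y @ q" LY LX] 1 2 by blast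
    then show "p @ subst \<sigma> [LX,LY,LX,LT 0,LY] @ q \<in> before_le 0 \<longleftrightarrow>
      p @ subst \<sigma> [LY,LX,LX,LT 0,LY] @ q \<in> before_le 0"
      by (simp add: X_def Y_def T_def before_le_def)
  qed
  have "e \<in> syn (one_before (LZ 0) LX)" using e by (intro syn_common) blast
  note keep = syn_Int [OF this, of "base \<inter> before_le 0"]
  show "e \<in> syn (one_before (LZ 0) LX \<inter> (base \<inter> before_le 0))"
    using e keep h1 h2 Phi_syn [of e 0] insert_syn [of 0] unfolding ax_H_def by (auto simp: Int_assoc)
qed

lemma J_syn: "ax_J \<subseteq> syn (one_before (LZ 0) LX \<inter> zero_before (LZ 0) LY \<inter> (base \<inter> before_le 1))"
proof
  fix e assume "e \<in> ax_J"
  then consider "e \<in> Phi \<union> {([LX,LY,LX,LZ 0,LT 0,LX], [LX,LY,LX,LZ 0,LX,LT 0,LX])}"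
    | n \<pi> where "e = (w n \<pi>, w' n \<pi>)" "\<pi> permutes {1..n}" unfolding ax_J_def by blast
  then show "e \<in> syn (one_before (LZ 0) LX \<inter> zero_before (LZ 0) LY \<inter> (base \<inter> before_le 1))"
  proof cases
    case 1
    then have "e \<in> ax_I \<union> ax_H" by (auto simp: ax_I_def)
    moreover have "e \<in> syn (base \<inter> before_le 1)" using 1 Phi_syn insert_syn by blast
    ultimately show ?thesis
      by (intro syn_Int [OF syn_Int [OF syn_common(1) syn_common(2)]])
  next
    case (2 n \<pi>)
    define V where "V = map (\<lambda>i. LZ (\<pi> i)) [1..<Suc n]"
    define U where "U = concat (map (\<lambda>i. [LT i, LZ i]) [1..<Suc n])"
    have "1 \<le> \<pi> i \<and> \<pi> i \<le> n" if "1 \<le> i" "i < Suc n" for i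
      using permutes_in_image [OF 2(2), of i] that by simp
    then have VU: "set V \<subseteq> set U"
      unfolding V_def U_def by (fastforce simp del: upt_Suc simp: less_Suc_eq_le)
    have ww: "w n \<pi> = LX # V @ LX # U" "w' n \<pi> = LX # LX # V @ U"
      by (simp_all add: w_def w'_def V_def U_def del: upt_Suc)
    have count: "occ (p @ X @ W @ X @ Q @ q) z = occ (p @ X @ X @ W @ Q @ q) z"
      for p X W Q q and z :: letter by simp
    have cb: "cb (p @ X @ W @ X @ Q @ q) z x = cb (p @ X @ X @ W @ Q @ q) z x"
      if "simple (p @ X @ W @ X @ Q @ q) z" "set W \<subseteq> set Q" for p X W Q q and z x :: letter
    proof -
      have "occ X z = 0" using that(1) by simp
      moreover have "occ W z = 0"
      proof (rule ccontr)
        assume "occ W z \<noteq> 0"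
        moreover from this have "z \<in> set Q" using that(2) by (auto simp: count_list_0_iff)
        ultimately show False using that(1) by (simp add: in_count)
      qed
      ultimately show ?thesis by (simp add: cb_append')
    qed
    let ?A = "one_before (LZ 0) LX \<inter> zero_before (LZ 0) LY \<inter> base"
    have "(w n \<pi>, w' n \<pi>) \<in> syn (?A \<inter> before_le 1)"
      unfolding syn_def
    proof (clarify, goal_cases)
      case (1 p q \<sigma>)
      define X W Q where "X = \<sigma> LX" and "W = subst \<sigma> V" and "Q = subst \<sigma> U"
      have WQ: "set W \<subseteq> set Q" using VU by (auto simp: W_def Q_def subst_def)
      let ?u = "p @ X @ W @ X @ Q @ q" and ?v = "p @ X @ X @ W @ Q @ q"
      have A: "?u \<in> ?A \<longleftrightarrow> ?v \<in> ?A"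
        using cb [OF _ WQ, of p X q] count [of p X W Q q]
        unfolding one_before_def zero_before_def all_before_def by auto
      have "cb ?u LY LX \<le> 1 \<longleftrightarrow> cb ?v LY LX \<le> 1" if "?u \<in> ?A"
      \<comment> \<open>Only if the first \<open>LY\<close> lies in \<open>W\<close> and
        \<open>LX\<close> lies in \<open>X\<close> can the count change. Then \<open>LZ 0\<close>,
        with no \<open>LY\<close> in front, must lie in \<open>p\<close>, together with an
        \<open>LX\<close>; so both counts exceed 1.\<close>
      proof (cases "LY \<notin> set p \<and> LY \<notin> set X \<and> LY \<in> set W \<and> LX \<in> set X")
        case False
        then show ?thesis by (auto simp: cb_append count_notin)
      next
        case True
        have s: "simple ?u (LZ 0)" "cb ?u (LZ 0) LX = 1" "cb ?u (LZ 0) LY = 0"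
          using \<open>?u \<in> ?A\<close> by (auto simp: one_before_def zero_before_def)
        have "LZ 0 \<in> set p"
        proof (rule ccontr)
          assume sp: "LZ 0 \<notin> set p"
          have "occ X (LZ 0) = 0" using s(1) by simp
          then have "LZ 0 \<notin> set X" by (simp add: count_list_0_iff)
          moreover have "LZ 0 \<notin> set W"
          proof
            assume "LZ 0 \<in> set W"
            moreover from this have "LZ 0 \<in> set Q" using WQ by blast
            ultimately show False using s(1) by (simp add: in_count)
          qed
          moreover have "0 < occ W LY" using True by (simp add: in_count)
          ultimately show False using s(3) sp by (simp add: cb_append)
        qed
        then have "0 < occ p LX" using s(2) cb_le_count [of p "LZ 0" LX] by (simp add: cb_append)
        moreover have "0 < occ X LX" using True by (simp add: in_count)
        ultimately show ?thesis using True by (simp add: cb_append)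
      qed
      with A have "?u \<in> ?A \<inter> before_le 1 \<longleftrightarrow> ?v \<in> ?A \<inter> before_le 1" unfolding before_le_def by blast
      then show ?case by (simp add: ww X_def W_def Q_def)
    qed
    then show ?thesis using 2 by (simp add: Int_assoc)
  qed
qed

lemma H_not_sigma: "id_swap \<notin> syn (one_before (LZ 0) LX \<inter> (base \<inter> before_le 0))"
  by (rule not_syn) (simp add: one_before_def all_before_def before_le_def)

lemma I_not_H: "\<not> (var ax_I :: 'a::infinite monoid set) \<subseteq> var ax_H"
proof (rule var_not_subset [OF fic_syn I_syn])
  show "([LX,LY,LX,LT 0,LY], [LY,LX,LX,LT 0,LY]) \<in> ax_H" by (simp add: ax_H_def)
  show "([LX,LY,LX,LT 0,LY], [LY,LX,LX,LT 0,LY]) \<notin>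
    syn (base \<inter> before_le 0)"
    by (rule not_syn) (simp add: one_before_def all_before_def before_le_def)
qed

lemma J_not_I: "\<not> (var ax_J :: 'a::infinite monoid set) \<subseteq> var ax_I"
proof (rule var_not_subset [OF fic_syn J_syn])
  show "([LX,LZ 0,LX,LY,LT 0,LY], [LX,LZ 0,LY,LX,LT 0,LY]) \<in> ax_I" by (simp add: ax_I_def)
  show "([LX,LZ 0,LX,LY,LT 0,LY], [LX,LZ 0,LY,LX,LT 0,LY]) \<notin>
    syn (one_before (LZ 0) LX \<inter> zero_before (LZ 0) LY \<inter> (base \<inter> before_le 1))"
    by (rule not_syn) (simp add: one_before_def zero_before_def all_before_def before_le_def)
qed

subsection \<open>Trivial monoids and semilattices\<close>

text \<open>T and SL are defined by properties of elements; evaluating words at arbitrary elements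
  reads these off the identities.\<close>

lemma monoid_homs_eval:
  assumes "monoid M" "\<And>c. f c \<in> carrier M"
  shows "(\<lambda>u. foldr (\<lambda>c r. f c \<otimes>\<^bsub>M\<^esub> r) u \<one>\<^bsub>M\<^esub>) \<in> monoid_homs free_monoid M"
proof -
  interpret monoid M by fact
  let ?\<phi> = "\<lambda>u. foldr (\<lambda>c r. f c \<otimes>\<^bsub>M\<^esub> r) u \<one>\<^bsub>M\<^esub>"
  have closed: "?\<phi> u \<in> carrier M" for u by (induction u) (use assms(2) in auto)
  have "?\<phi> (u @ v) = ?\<phi> u \<otimes>\<^bsub>M\<^esub> ?\<phi> v" for u v
    by (induction u) (use assms(2) closed in \<open>auto simp: m_assoc\<close>)
  with closed show ?thesis by (auto simp: monoid_homs_free_iff)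
qed

lemma var_T_eq: "var_T = var ax_T"
proof (intro subset_antisym subsetI)
  fix M :: "'a monoid" assume "M \<in> var_T"
  then show "M \<in> var ax_T"
    by (auto simp: var_T_def var_def ax_T_def holds_in_def monoid_homs_free_iff)
next
  fix M :: "'a monoid" assume M: "M \<in> var ax_T"
  then interpret monoid M by (simp add: var_def)
  have "a = \<one>\<^bsub>M\<^esub>" if "a \<in> carrier M" for a
  proof -
    have "holds_in ([LX], []) M" using M by (simp add: var_def ax_T_def)
    from bspec [OF this [unfolded holds_in_def] monoid_homs_eval [OF monoid_axioms, of "\<lambda>_. a"]]
    show ?thesis using that by simp
  qed
  then show "M \<in> var_T" using monoid_axioms by (auto simp: var_T_def)
qed

lemma var_SL_eq: "var_SL = var ax_SL"
proof (intro subset_antisym subsetI)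
  fix M :: "'a monoid" assume "M \<in> var_SL"
  then have M: "comm_monoid M" "\<And>a. a \<in> carrier M \<Longrightarrow> a \<otimes>\<^bsub>M\<^esub> a = a" by (auto simp: var_SL_def)
  interpret comm_monoid M by fact
  have "holds_in ([LX], [LX,LX]) M" "holds_in ([LX,LY], [LY,LX]) M"
    unfolding holds_in_def
  proof (safe, goal_cases)
    case (1 \<phi>)
    then have "\<phi> ([LX] @ [LX]) = \<phi> [LX] \<otimes>\<^bsub>M\<^esub> \<phi> [LX]" "\<phi> [LX] \<in> carrier M"
      unfolding monoid_homs_free_iff by blast+
    then show ?case using M(2) by simp
  next
    case (2 \<phi>)
    then have "\<phi> ([LX] @ [LY]) = \<phi> [LX] \<otimes>\<^bsub>M\<^esub> \<phi> [LY]" "\<phi> ([LY] @ [LX]) = \<phi> [LY] \<otimes>\<^bsub>M\<^esub> \<phi> [LX]"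
      "\<phi> [LX] \<in> carrier M" "\<phi> [LY] \<in> carrier M"
      unfolding monoid_homs_free_iff by blast+
    then show ?case using m_comm by simp
  qed
  then show "M \<in> var ax_SL" using monoid_axioms by (auto simp: var_def ax_SL_def)
next
  fix M :: "'a monoid" assume M: "M \<in> var ax_SL"
  then interpret monoid M by (simp add: var_def)
  have hold: "holds_in ([LX], [LX,LX]) M" "holds_in ([LX,LY], [LY,LX]) M"
    using M by (simp_all add: var_def ax_SL_def)
  have comm: "a \<otimes>\<^bsub>M\<^esub> b = b \<otimes>\<^bsub>M\<^esub> a" and idem: "a = a \<otimes>\<^bsub>M\<^esub> a"
    if "a \<in> carrier M" "b \<in> carrier M" for a b
  proof -
    have f: "(if c = LX then a else b) \<in> carrier M" for c using that by simp
    note \<phi> = monoid_homs_eval [OF monoid_axioms, of "\<lambda>c. if c = LX then a else b", OF f]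
    show "a \<otimes>\<^bsub>M\<^esub> b = b \<otimes>\<^bsub>M\<^esub> a" "a = a \<otimes>\<^bsub>M\<^esub> a"
      using bspec [OF hold(2) [unfolded holds_in_def] \<phi>] bspec [OF hold(1) [unfolded holds_in_def] \<phi>] that
      by simp_all
  qed
  have "comm_monoid M" by (rule monoid_comm_monoidI) (rule comm)
  with idem show "M \<in> var_SL" by (auto simp: var_SL_def)
qed

subsection \<open>Splitting pairs\<close>

lemma var_mono_imp:
  "(\<And>\<theta>. fic \<theta> \<Longrightarrow> \<Sigma> \<subseteq> \<theta> \<Longrightarrow> \<Sigma>' \<subseteq> \<theta>) \<Longrightarrow> var \<Sigma> \<subseteq> var \<Sigma>'"
  using fic_eqth subset_eqth_var by (auto simp: subset_var_iff)

lemma T_SL: "var ax_T \<subseteq> var ax_SL" by (rule var_mono_imp) (rule fic.T_imp)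

lemma SL_C: "var ax_SL \<subseteq> var ax_C" by (rule var_mono_imp) (rule fic.SL_imp_C)

lemma C_D: "var ax_C \<subseteq> var ax_D" by (rule var_mono_imp) (rule fic.C_imp_D)

lemma D_E: "var ax_D \<subseteq> var ax_E" by (rule var_mono_imp) (rule fic.D_imp_E)

lemma D_dE: "var ax_D \<subseteq> var ax_dE" by (rule var_mono_imp) (rule fic.D_imp_dE)

lemma E_F: "var ax_E \<subseteq> var ax_F" by (rule var_mono_imp) (rule fic.E_imp_F)

lemma dE_H: "var ax_dE \<subseteq> var ax_H" by (rule var_mono_imp) (rule fic.dE_imp_H)

lemma F_H: "var ax_F \<subseteq> var ax_H" by (rule var_mono_imp) (rule fic.F_imp_H)

lemma H_I: "var ax_H \<subseteq> var ax_I" by (rule var_mono_imp) (rule fic.H_imp_I)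

lemma I_J: "var ax_I \<subseteq> var ax_J" by (rule var_mono_imp) (rule fic.I_imp_J)

lemmas H_J = order_trans [OF H_I I_J]

lemmas F_J = order_trans [OF F_H H_J]

lemmas C_dE = order_trans [OF C_D D_dE]

lemma not_subset_obtain:
  fixes X :: "'a monoid set"
  assumes "variety X" "\<not> var \<Sigma> \<subseteq> X"
  obtains u v where "(u, v) \<in> eqth X" "(u, v) \<notin> eqth (var \<Sigma> :: 'a monoid set)"
  using assms by (metis subrelI subset_variety_iff variety_var)

lemma in_eqth: "fic.equ (eqth (X :: 'a monoid set)) u v \<longleftrightarrow> (u, v) \<in> eqth X"
  by (rule fic.equ_def [OF fic_eqth])

lemma var_T_least:
  assumes "variety (X :: 'a monoid set)"
  shows "var ax_T \<subseteq> X"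
proof -
  have "(u, v) \<in> eqth (var ax_T :: 'a monoid set)" for u v
    using fic.T_all [OF fic_eqth subset_eqth_var] by (simp add: in_eqth)
  then show ?thesis using assms by (auto simp: subset_variety_iff)
qed

lemma complete_var_SL: "set u = set v \<Longrightarrow> (u, v) \<in> eqth (var ax_SL)"
  unfolding in_eqth [symmetric] by (rule fic.complete_SL [OF fic_eqth subset_eqth_var])

lemma complete_var_C: "agree_count u v \<Longrightarrow> (u, v) \<in> eqth (var ax_C)"
  unfolding in_eqth [symmetric] by (rule fic.complete_C [OF fic_eqth subset_eqth_var])

lemma complete_var_D: "agree_count u v \<and> agree_simple u v \<Longrightarrow> (u, v) \<in> eqth (var ax_D)"
  unfolding in_eqth [symmetric] by (simp add: fic.complete_D [OF fic_eqth subset_eqth_var])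

lemma complete_var_E: "agree_count u v \<and> agree_fst u v \<Longrightarrow> (u, v) \<in> eqth (var ax_E)"
  unfolding in_eqth [symmetric] by (simp add: fic.complete_E [OF fic_eqth subset_eqth_var])

lemma complete_var_dE: "agree_count u v \<and> agree_last u v \<Longrightarrow> (u, v) \<in> eqth (var ax_dE)"
  unfolding in_eqth [symmetric] by (simp add: fic.complete_dE [OF fic_eqth subset_eqth_var])

lemma fic_F_identity: "fic \<theta> \<Longrightarrow> ax_F \<subseteq> \<theta> \<Longrightarrow> ([LX,LX,LT 0], [LX,LX,LT 0,LX]) \<in> \<theta>"
proof -
  assume "fic \<theta>" and F: "ax_F \<subseteq> \<theta>"
  then interpret fic \<theta> by simp
  have "([LX,LY,LX,LZ 0], [LX,LY,LX,LZ 0,LX]) \<in> \<theta>" using F by (simp add: ax_F_def)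
  from inst [OF this, of "[]" "[LX]" "[]" "[LT 0]" "[]" "[]"] show ?thesis by (simp add: equ_def)
qed

lemma fic_J_theory: "fic \<theta> \<Longrightarrow> ax_J \<subseteq> \<theta> \<Longrightarrow> J_theory \<theta>"
  by (intro J_theory.intro J_theory_axioms.intro)

lemma complete_var_F:
  assumes "agree_count u v \<and> agree_snd u v"
  shows "(u, v) \<in> eqth (var ax_F)"
proof -
  have "J_theory (eqth (var ax_F :: 'a monoid set))"
    by (rule fic_J_theory [OF fic_eqth
        fic.I_imp_J [OF fic_eqth fic.H_imp_I [OF fic_eqth fic.F_imp_H [OF fic_eqth subset_eqth_var]]]])
  from J_theory.complete_F [OF this fic_F_identity [OF fic_eqth subset_eqth_var]]
  show ?thesis using assms by (simp add: in_eqth)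
qed

locale J_variety =
  fixes X :: "'a::infinite monoid set"
  assumes variety: "variety X" and sub_J: "X \<subseteq> var ax_J"
begin

sublocale J_theory "eqth X"
  using variety sub_J
  by (intro J_theory.intro fic_eqth J_theory_axioms.intro) (simp add: subset_var_iff)

notation equ (infix "\<approx>" 50)

lemma J_theory_eqth: "J_theory (eqth X)"
  by unfold_locales

lemma below: "\<Sigma> \<subseteq> eqth X \<Longrightarrow> X \<subseteq> var \<Sigma>"
  by (simp add: subset_var_iff variety)

text \<open>If \<open>X\<close> does not contain the variety of \<Sigma>, some identity of
  \<open>X\<close> fails there, hence violates the sufficient condition \<open>P\<close>, and this
  violation is what bounds \<open>X\<close>.\<close>

lemma splitI:
  assumes "\<And>u v. P u v \<Longrightarrow> (u, v) \<in> eqth (var \<Sigma> :: 'a monoid set)"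
    and "\<And>u v. u \<approx> v \<Longrightarrow> \<not> P u v \<Longrightarrow> X \<subseteq> Y" and "\<not> var \<Sigma> \<subseteq> X"
  shows "X \<subseteq> Y"
proof -
  obtain u v where uv: "(u, v) \<in> eqth X" "(u, v) \<notin> eqth (var \<Sigma> :: 'a monoid set)"
    using assms(3) by (rule not_subset_obtain [OF variety])
  with assms(1) have "\<not> P u v" by blast
  with uv(1) show ?thesis by (intro assms(2)) (simp_all add: equ_def)
qed

lemma split_SL: "\<not> var ax_SL \<subseteq> X \<Longrightarrow> X \<subseteq> var ax_T"
  by (rule splitI [OF complete_var_SL below [OF content_violation]])

lemma count_below: "u \<approx> v \<Longrightarrow> \<not> agree_count u v \<Longrightarrow> X \<subseteq> var ax_SL"
  by (intro below count_violation)

lemma simple_below: "u \<approx> v \<Longrightarrow> \<not> (agree_count u v \<and> agree_simple u v) \<Longrightarrow> X \<subseteq> var ax_C"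
  using below [OF simple_violation, of u v] order_trans [OF count_below SL_C, of u v] by metis

lemma fst_below: "u \<approx> v \<Longrightarrow> \<not> (agree_count u v \<and> agree_fst u v) \<Longrightarrow> X \<subseteq> var ax_dE"
  using below [OF fst_violation, of u v] order_trans [OF simple_below C_dE, of u v] by metis

lemma last_below: "u \<approx> v \<Longrightarrow> \<not> (agree_count u v \<and> agree_last u v) \<Longrightarrow> X \<subseteq> var ax_F"
  using below [OF last_violation, of u v]
    order_trans [OF simple_below order_trans [OF C_D order_trans [OF D_E E_F]], of u v] by metis

lemma split_C: "\<not> var ax_C \<subseteq> X \<Longrightarrow> X \<subseteq> var ax_SL"
  by (rule splitI [OF complete_var_C count_below])

lemma split_D: "\<not> var ax_D \<subseteq> X \<Longrightarrow> X \<subseteq> var ax_C"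
  by (rule splitI [OF complete_var_D simple_below])

lemma split_E: "\<not> var ax_E \<subseteq> X \<Longrightarrow> X \<subseteq> var ax_dE"
  by (rule splitI [OF complete_var_E fst_below])

lemma split_dE: "\<not> var ax_dE \<subseteq> X \<Longrightarrow> X \<subseteq> var ax_F"
  by (rule splitI [OF complete_var_dE last_below])

end

lemma J_variety_var:
  "(var \<Sigma> :: 'a::infinite monoid set) \<subseteq> var ax_J \<Longrightarrow> J_variety (var \<Sigma> :: 'a monoid set)"
  by (rule J_variety.intro [OF variety_var])

lemmas J_variety_E = J_variety_var [OF order_trans [OF E_F F_J]]

lemmas J_variety_dE = J_variety_var [OF order_trans [OF dE_H H_J]]

lemmas J_variety_F = J_variety_var [OF F_J]

lemmas J_variety_H = J_variety_var [OF H_J]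

lemmas J_variety_I = J_variety_var [OF I_J]

lemmas J_variety_J = J_variety_var [OF subset_refl]

text \<open>Obtained from a separation instead of from the axioms: a violating identity would put E
  inside dual E by \<open>fst_below\<close>.\<close>

lemma sound_E:
  assumes "(u, v) \<in> eqth (var ax_E :: 'a::infinite monoid set)"
  shows "agree_count u v \<and> agree_fst u v"
proof (rule ccontr)
  assume "\<not> ?thesis"
  then have "(var ax_E :: 'a monoid set) \<subseteq> var ax_dE"
    using assms by (intro J_variety.fst_below [OF J_variety_E]) (simp_all add: in_eqth)
  with E_not_dE show False by contradiction
qed

lemma sound_dE:
  assumes "(u, v) \<in> eqth (var ax_dE :: 'a::infinite monoid set)"
  shows "agree_count u v \<and> agree_last u v"
proof (rule ccontr)
  assume "\<not> ?thesis"
  then have "(var ax_dE :: 'a monoid set) \<subseteq> var ax_F"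
    using assms by (intro J_variety.last_below [OF J_variety_dE]) (simp_all add: in_eqth)
  with dE_not_F show False by contradiction
qed

section \<open>The joins of E and of F with dual E\<close>

abbreviation EE :: "'a monoid set" where "EE \<equiv> variety_join (var ax_E) (var ax_dE)"

abbreviation FE :: "'a monoid set" where "FE \<equiv> variety_join (var ax_F) (var ax_dE)"

lemma eqth_join:
  "eqth (variety_join (var \<Sigma>) (var \<Sigma>' :: 'a monoid set)) =
    eqth (var \<Sigma> :: 'a monoid set) \<inter> eqth (var \<Sigma>' :: 'a monoid set)"
proof
  let ?V = "var \<Sigma> :: 'a monoid set" and ?V' = "var \<Sigma>' :: 'a monoid set"
  show "eqth (variety_join ?V ?V') \<subseteq> eqth ?V \<inter> eqth ?V'"
    by (intro Int_greatest eqth_antimono variety_join_upper)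
  show "eqth ?V \<inter> eqth ?V' \<subseteq> eqth (variety_join ?V ?V')"
    by (simp add: variety_join_eq subset_eqth_var)
qed

lemma variety_joins [simp]: "variety (variety_join (var \<Sigma>) (var \<Sigma>'))"
  by (simp add: variety_join_eq)

lemma EE_identity: "id_double \<in> eqth (EE :: 'a monoid set)"
proof -
  have "id_double \<in> eqth (var ax_E :: 'a monoid set)"
    by (rule complete_var_E) (auto simp: agree_count_def agree_fst_def)
  moreover have "id_double \<in> eqth (var ax_dE :: 'a monoid set)"
    by (rule complete_var_dE) (auto simp: agree_count_def agree_last_def)
  ultimately show ?thesis unfolding eqth_join by blast
qed

lemma F_not_EE: "\<not> (var ax_F :: 'a::infinite monoid set) \<subseteq> EE"
proof -
  have "\<not> (var ax_F :: 'a monoid set) \<subseteq> var {id_double}"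
  proof (rule var_not_subset [OF fic_syn F_syn])
    show "id_double \<notin> syn {u. simple u (LT 0) \<and> cb u (LT 0) LX \<le> 1}"
      by (rule not_syn) simp
  qed simp
  moreover have "(EE :: 'a monoid set) \<subseteq> var {id_double}"
    using EE_identity by (simp add: subset_var_iff)
  ultimately show ?thesis by blast
qed

context J_variety
begin

text \<open>An identity of the join holds in both E and dual E, so the sound descriptions of these
  two supply the hypotheses of \<open>complete_EE\<close>.\<close>

lemma below_EE: "id_double \<in> eqth X \<Longrightarrow> X \<subseteq> EE"
proof -
  assume e: "id_double \<in> eqth X"
  have "(u, v) \<in> eqth X" if "(u, v) \<in> eqth (EE :: 'a monoid set)" for u v
  proof -
    have "(u, v) \<in> eqth (var ax_E :: 'a monoid set)" "(u, v) \<in> eqth (var ax_dE :: 'a monoid set)"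
      using that by (simp_all add: eqth_join)
    from sound_E [OF this(1)] sound_dE [OF this(2)] show ?thesis
      using complete_EE [OF e, of u v] by (simp add: equ_def)
  qed
  then show ?thesis using variety by (auto simp: subset_variety_iff)
qed

lemma snd_below: "u \<approx> v \<Longrightarrow> \<not> (agree_count u v \<and> agree_snd u v) \<Longrightarrow> X \<subseteq> EE"
proof (cases "agree_count u v \<and> agree_fst u v")
  case True
  assume "u \<approx> v" "\<not> (agree_count u v \<and> agree_snd u v)"
  with True show ?thesis by (intro below_EE snd_violation) auto
next
  case False
  assume "u \<approx> v"
  then show ?thesis using False by (rule order_trans [OF fst_below variety_join_upper(2)])
qed

lemma split_F: "\<not> var ax_F \<subseteq> X \<Longrightarrow> X \<subseteq> EE"
  by (rule splitI [OF complete_var_F snd_below])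

end

lemma sound_F:
  assumes "(u, v) \<in> eqth (var ax_F :: 'a::infinite monoid set)"
  shows "agree_count u v \<and> agree_snd u v"
proof (rule ccontr)
  assume "\<not> ?thesis"
  then have "(var ax_F :: 'a monoid set) \<subseteq> EE"
    using assms by (intro J_variety.snd_below [OF J_variety_F]) (simp_all add: in_eqth)
  with F_not_EE show False by contradiction
qed

lemma E_EE: "var ax_E \<subseteq> EE" and dE_EE: "var ax_dE \<subseteq> EE"
  and F_FE: "var ax_F \<subseteq> FE" and dE_FE: "var ax_dE \<subseteq> FE"
  by (rule variety_join_upper)+

lemma EE_FE: "EE \<subseteq> FE"
  by (rule variety_join_least [OF variety_joins order_trans [OF E_F F_FE] dE_FE])

lemma FE_H: "FE \<subseteq> var ax_H"
  by (rule variety_join_least [OF variety_var F_H dE_H])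

context J_variety
begin

lemma below_FE:
  "id_swap \<in> eqth X \<Longrightarrow> X \<subseteq> FE"
proof -
  assume e: "id_swap \<in> eqth X"
  have "(u, v) \<in> eqth X" if "(u, v) \<in> eqth (FE :: 'a monoid set)" for u v
  proof -
    have "(u, v) \<in> eqth (var ax_F :: 'a monoid set)" "(u, v) \<in> eqth (var ax_dE :: 'a monoid set)"
      using that by (simp_all add: eqth_join)
    from sound_F [OF this(1)] sound_dE [OF this(2)] show ?thesis
      using complete_FE [OF e, of u v] by (simp add: equ_def agree0_iff)
  qed
  then show ?thesis using variety by (auto simp: subset_variety_iff)
qed

lemma agree0_below: "u \<approx> v \<Longrightarrow> \<not> agree0 u v \<Longrightarrow> X \<subseteq> FE"
proof (cases "agree_count u v \<and> agree_snd u v")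
  case True
  assume "u \<approx> v" "\<not> agree0 u v"
  with True show ?thesis by (intro order_trans [OF last_below F_FE]) (auto simp: agree0_iff)
next
  case False
  assume "u \<approx> v"
  then show ?thesis using False by (rule order_trans [OF snd_below EE_FE])
qed

end

section \<open>The splitting pairs of F join dual E, H, I and J\<close>

lemma complete_var_H:
  "agree (\<lambda>u x y. parted u x y \<and> spread u x) (\<lambda>_ _ _. False) u v \<Longrightarrow>
    (u, v) \<in> eqth (var ax_H :: 'a::infinite monoid set)"
  using sortable.complete [OF J_theory.sortable_H [OF J_variety.J_theory_eqth [OF J_variety_H] subset_eqth_var]]
  by (simp add: in_eqth)

lemma complete_var_I:
  "agree parted (\<lambda>_ _ _. False) u v \<Longrightarrow> (u, v) \<in> eqth (var ax_I :: 'a::infinite monoid set)"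
  using sortable.complete [OF J_theory.sortable_I [OF J_variety.J_theory_eqth [OF J_variety_I] subset_eqth_var]]
  by (simp add: in_eqth)

lemma complete_var_J:
  "agree parted (\<lambda>u x y. parted u x y \<and> spread u x) u v \<Longrightarrow>
    (u, v) \<in> eqth (var ax_J :: 'a::infinite monoid set)"
  using sortable.complete [OF J_theory.sortable_J [OF J_variety.J_theory_eqth [OF J_variety_J]]]
  by (simp add: in_eqth)

lemma not_agree_cases:
  assumes "\<not> agree K1 K2 u v"
  obtains "\<not> agree0 u v"
  | x y where "agree0 u v" "x \<noteq> y" "multiple u x" "multiple u y" "K1 u x y"
      "cb u y x = 0 \<longleftrightarrow> cb v y x \<noteq> 0"
  | x y where "agree0 u v" "x \<noteq> y" "multiple u x" "multiple u y" "K2 u x y"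
      "min 2 (cb u y x) \<noteq> min 2 (cb v y x)"
  using assms unfolding agree_def by blast

context J_variety
begin

lemma split_H: "\<not> var ax_H \<subseteq> X \<Longrightarrow> X \<subseteq> FE"
proof (rule splitI [OF complete_var_H])
  fix u v assume eq: "u \<approx> v" and "\<not> agree (\<lambda>u x y. parted u x y \<and> spread u x) (\<lambda>_ _ _. False) u v"
  from this(2) show "X \<subseteq> FE"
  proof (cases rule: not_agree_cases)
    case 1
    with eq show ?thesis by (rule agree0_below)
  next
    case (2 x y)
    then show ?thesis by (intro below_FE spread_violation [OF eq, of x y]) auto
  qed simp
qed

lemma agree_first_below:
  assumes "u \<approx> v" "\<not> agree parted (\<lambda>_ _ _. False) u v"
  shows "X \<subseteq> var ax_H"
  using assms(2)
proof (cases rule: not_agree_cases)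
  case 1
  with assms(1) show ?thesis by (rule order_trans [OF agree0_below FE_H])
next
  case (2 x y)
  then show ?thesis by (intro below parted_violation [OF assms(1), of x y]) auto
qed simp

lemma split_I: "\<not> var ax_I \<subseteq> X \<Longrightarrow> X \<subseteq> var ax_H"
  by (rule splitI [OF complete_var_I agree_first_below])

lemma split_J: "\<not> var ax_J \<subseteq> X \<Longrightarrow> X \<subseteq> var ax_I"
proof (rule splitI [OF complete_var_J])
  fix u v assume eq: "u \<approx> v" and "\<not> agree parted (\<lambda>u x y. parted u x y \<and> spread u x) u v"
  from this(2) show "X \<subseteq> var ax_I"
  proof (cases "agree parted (\<lambda>_ _ _. False) u v")
    case False
    with eq show ?thesis by (rule order_trans [OF agree_first_below H_I])
  next
    case True
    assume "\<not> agree parted (\<lambda>u x y. parted u x y \<and> spread u x) u v"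
    then show ?thesis
    proof (cases rule: not_agree_cases)
      case (3 x y)
      \<comment> \<open>The first occurrences agree already, so the counts are 1 in one word and at
        least 2 in the other.\<close>
      have "cb u y x = 0 \<longleftrightarrow> cb v y x = 0" using agree_first [OF True 3(2,3,4)] 3(5) by blast
      then have "2 \<le> cb u y x \<longleftrightarrow> cb v y x = 1" "2 \<le> cb v y x \<longleftrightarrow> cb u y x = 1" "cb u y x \<noteq> 0"
        using 3(6) by linarith+
      then show ?thesis using 3 by (intro below second_violation [OF eq, of x y]) auto
    qed (use True in \<open>auto simp: agree_def\<close>)
  qed
qed

text \<open>If \<open>X\<close> contains neither E nor dual E, the splitting pairs only bound it by
  dual E and F, so the intersection of these two has to be recognized as D.\<close>

lemma meet_D: "X \<subseteq> var ax_dE \<Longrightarrow> X \<subseteq> var ax_F \<Longrightarrow> X \<subseteq> var ax_D"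
proof -
  assume "X \<subseteq> var ax_dE" "X \<subseteq> var ax_F"
  then have ax: "ax_dE \<subseteq> eqth X" "ax_F \<subseteq> eqth X" using variety by (simp_all add: subset_var_iff)
  have f: "[LX,LX,LT 0] \<approx> [LX,LX,LT 0,LX]" using fic_F_identity [OF fic_eqth ax(2)] by (simp add: equ_def)
  note e = dE_rules [OF ax(1)]
  have "[LX,LX,LY] \<approx> [LX,LX,LY,LX]"
    using inst [OF f [unfolded equ_def], of "[]" "[LX]" "[]" "[]" "[LY]" "[]"] by simp
  also have "\<dots> \<approx> [LX,LY,LX,LX]" using e(2) [of "[]" "[LX]" "[LX,LY]" "[]"] by simp
  also have "\<dots> \<approx> [LX,LY,LX]" using sym [OF ax1 [of "[]" "[LX]" "[LY]" "[]"]] by simp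
  finally have "[LX,LX,LY] \<approx> [LX,LY,LX]" .
  moreover have "[LX,LY,LX] \<approx> [LY,LX,LX]" using e(2) [of "[]" "[LX]" "[LY]" "[]"] by simp
  moreover have "[LX,LX] \<approx> [LX,LX,LX]" using ax1 [of "[]" "[LX]" "[]" "[]"] by simp
  ultimately show ?thesis by (intro below) (simp add: ax_D_def equ_def)
qed

text \<open>The analogous step if \<open>X\<close> contains neither dual E nor F: the identities of
  F give xxy \<approx> xxyx, and \<open>id_double\<close> gives xxyx \<approx> xyx.\<close>

lemma meet_E: "X \<subseteq> var ax_F \<Longrightarrow> X \<subseteq> EE \<Longrightarrow> X \<subseteq> var ax_E"
proof -
  assume "X \<subseteq> var ax_F" "X \<subseteq> EE"
  then have ax: "ax_F \<subseteq> eqth X" "id_double \<in> eqth X"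
    using variety EE_identity eqth_antimono [of X EE] by (auto simp: subset_var_iff)
  have "[LX,LX,LY] \<approx> [LX,LX,LY,LX]"
    using inst [OF fic_F_identity [OF fic_eqth ax(1)], of "[]" "[LX]" "[]" "[]" "[LY]" "[]"] by simp
  also have "\<dots> \<approx> [LX,LY,LX]" using inst [OF ax(2), of "[]" "[LX]" "[]" "[]" "[LY]" "[]"] by simp
  finally have "[LX,LX,LY] \<approx> [LX,LY,LX]" .
  moreover have "[LX,LX] \<approx> [LX,LX,LX]" using ax1 [of "[]" "[LX]" "[]" "[]"] by simp
  moreover have "[LX,LX,LY,LY] \<approx> [LY,LY,LX,LX]" using ax2 [of "[]" "[LX]" "[LY]" "[]"] by simp
  ultimately show ?thesis by (intro below) (simp add: ax_E_def equ_def)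
qed

text \<open>The cases are the order ideals formed by the join-irreducible varieties below
  \<open>X\<close>; each case names only the maximal members of the ideal and the minimal varieties
  outside it.\<close>

theorem classification:
  "X \<in> {var ax_T, var ax_SL, var ax_C, var ax_D, var ax_E, var ax_dE, var ax_F, EE, FE,
    var ax_H, var ax_I, var ax_J}"
proof -
  consider "\<not> var ax_SL \<subseteq> X" | "var ax_SL \<subseteq> X" "\<not> var ax_C \<subseteq> X" | "var ax_C \<subseteq> X" "\<not> var ax_D \<subseteq> X"
    | "var ax_D \<subseteq> X" "\<not> var ax_E \<subseteq> X" "\<not> var ax_dE \<subseteq> X" | "\<not> var ax_E \<subseteq> X" "var ax_dE \<subseteq> X"
    | "var ax_E \<subseteq> X" "\<not> var ax_dE \<subseteq> X" "\<not> var ax_F \<subseteq> X" | "\<not> var ax_dE \<subseteq> X" "var ax_F \<subseteq> X"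
    | "var ax_E \<subseteq> X" "var ax_dE \<subseteq> X" "\<not> var ax_F \<subseteq> X" | "var ax_dE \<subseteq> X" "var ax_F \<subseteq> X" "\<not> var ax_H \<subseteq> X"
    | "var ax_H \<subseteq> X" "\<not> var ax_I \<subseteq> X" | "var ax_I \<subseteq> X" "\<not> var ax_J \<subseteq> X" | "var ax_J \<subseteq> X"
    by blast
  then show ?thesis
  proof cases
    case 1
    then have "X = var ax_T" using split_SL var_T_least [OF variety] by blast
    then show ?thesis by simp
  next
    case 2
    then have "X = var ax_SL" using split_C by blast
    then show ?thesis by simp
  next
    case 3
    then have "X = var ax_C" using split_D by blast
    then show ?thesis by simp
  next
    case 4
    then have "X = var ax_D" using split_E split_dE meet_D by blast
    then show ?thesis by simp
  next
    case 5
    then have "X = var ax_dE" using split_E by blast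
    then show ?thesis by simp
  next
    case 6
    then have "X = var ax_E" using split_dE split_F meet_E by blast
    then show ?thesis by simp
  next
    case 7
    then have "X = var ax_F" using split_dE by blast
    then show ?thesis by simp
  next
    case 8
    then have "X = EE" using split_F variety_join_least [OF variety] by blast
    then show ?thesis by simp
  next
    case 9
    then have "X = FE" using split_H variety_join_least [OF variety] by blast
    then show ?thesis by simp
  next
    case 10
    then have "X = var ax_H" using split_I by blast
    then show ?thesis by simp
  next
    case 11
    then have "X = var ax_I" using split_J by blast
    then show ?thesis by simp
  next
    case 12
    then have "X = var ax_J" using sub_J by blast
    then show ?thesis by simp
  qed
qed

end

text \<open>F and dual E satisfy \<open>id_swap\<close> by their descriptions, hence so does the
  join; the set of words for H refutes it there.\<close>

lemma H_not_FE: "\<not> (var ax_H :: 'a::infinite monoid set) \<subseteq> FE"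
proof -
  let ?e = "id_swap"
  have "\<not> (var ax_H :: 'a monoid set) \<subseteq> var {?e}"
    by (rule var_not_subset [OF fic_syn H_syn _ H_not_sigma]) simp
  moreover have "?e \<in> eqth (var ax_F :: 'a monoid set)"
    by (rule complete_var_F) (auto simp: agree_count_def agree_snd_def)
  moreover have "?e \<in> eqth (var ax_dE :: 'a monoid set)"
    by (rule complete_var_dE) (auto simp: agree_count_def agree_last_def)
  ultimately show ?thesis
    using subset_var_iff [of FE "{?e}"] eqth_join [of ax_F ax_dE] by auto
qed

subsection \<open>The order of the twelve varieties\<close>

text \<open>The numbers 0, ..., 11 stand for T, SL, C, D, E, dual E, F, E \<open>\<or>\<close> dual E, F \<open>\<or>\<close> dual E, H, I, J.\<close>

definition edges :: "(nat \<times> nat) list" where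
  "edges = [(0,1), (1,2), (2,3), (3,4), (3,5), (4,6), (4,7), (5,7), (6,8), (7,8), (8,9), (9,10), (10,11)]"

text \<open>Each pair consists of a join-irreducible element and the largest element not above it;
  these nine non-inclusions imply all the others.\<close>

definition splittings :: "(nat \<times> nat) list" where
  "splittings = [(1,0), (2,1), (3,2), (4,5), (5,6), (6,7), (9,8), (10,9), (11,10)]"

text \<open>The numbering is a linear extension of the order, and the three exceptions are its
  incomparable pairs.\<close>

definition le12 :: "nat \<Rightarrow> nat \<Rightarrow> bool" where
  "le12 i j \<longleftrightarrow> i \<le> j \<and> (i, j) \<notin> set [(4,5), (5,6), (6,7)]"

lemma all_less_12: "(\<forall>i<12. P i) \<longleftrightarrow> (\<forall>i\<in>set [0,1,2,3,4,5,6,7,8,9,10,11]. P (i :: nat))"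
proof -
  have "{..<12} = set [0,1,2,3,4,5,6,7,8,9,10,11::nat]"
    by (auto simp: less_Suc_eq numeral_eq_Suc)
  then show ?thesis by (metis lessThan_iff)
qed

lemma le12_step:
  "\<forall>i<12. \<forall>j<12. le12 i j \<longrightarrow> i = j \<or> (\<exists>(a, b)\<in>set edges. a = i \<and> i < b \<and> b < 12 \<and> le12 b j)"
  unfolding all_less_12 by (simp add: le12_def edges_def)

lemma le12_split:
  "\<forall>i<12. \<forall>j<12. le12 i j \<or> (\<exists>(a, b)\<in>set splittings. a < 12 \<and> b < 12 \<and> le12 a i \<and> le12 j b)"
  unfolding all_less_12 by (simp add: le12_def splittings_def)

lemma edges_cover:
  "\<forall>i<12. \<forall>j<12. (i \<noteq> j \<and> le12 i j \<and>
      (\<forall>k<12. \<not> (k \<noteq> i \<and> k \<noteq> j \<and> le12 i k \<and> le12 k j))) \<longleftrightarrow> (i, j) \<in> set edges"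
  unfolding all_less_12 by (simp add: le12_def edges_def)

lemma edges_bound: "(i, j) \<in> set edges \<Longrightarrow> i < 12 \<and> j < 12"
  by (auto simp: edges_def)

text \<open>Separates the finite combinatorics from the algebra: thirteen inclusions and nine
  non-inclusions determine the whole order, and with it distinctness and the covering
  relation.\<close>

theorem twelve_element_lattice:
  fixes Vs :: "'b set list"
  assumes len: "length Vs = 12"
    and edges: "\<forall>(i, j)\<in>set edges. Vs ! i \<subseteq> Vs ! j"
    and splittings: "\<forall>(i, j)\<in>set splittings. \<not> Vs ! i \<subseteq> Vs ! j"
  shows "distinct Vs" and "\<And>X. X \<in> set Vs \<Longrightarrow> X \<subseteq> Vs ! 11"
    and "{(X, Y). X \<in> set Vs \<and> Y \<in> set Vs \<and> X \<subset> Y \<and> \<not> (\<exists>Z\<in>set Vs. X \<subset> Z \<and> Z \<subset> Y)} =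
      (\<lambda>(i, j). (Vs ! i, Vs ! j)) ` set edges"
proof -
  have le: "Vs ! i \<subseteq> Vs ! j" if "le12 i j" "i < 12" "j < 12" for i j
    using that
  \<comment> \<open>Edges lead to larger numbers, so an ascent from \<open>i\<close> to
    \<open>j\<close> terminates.\<close>
  proof (induction "12 - i" arbitrary: i rule: less_induct)
    case less
    show ?case
    proof (cases "i = j")
      case False
      then obtain b where b: "(i, b) \<in> set edges" "i < b" "b < 12" "le12 b j"
        using le12_step less.prems by fast
      then have "Vs ! b \<subseteq> Vs ! j" using less by simp
      with edges b(1) show ?thesis by (blast intro: order_trans)
    qed simp
  qed
  have iff: "Vs ! i \<subseteq> Vs ! j \<longleftrightarrow> le12 i j" if ij: "i < 12" "j < 12" for i j
  proof
    assume sub: "Vs ! i \<subseteq> Vs ! j"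
    show "le12 i j"
    proof (rule ccontr)
      assume "\<not> le12 i j"
      \<comment> \<open>From a \<le> i and j \<le> b, inclusion of the member at \<open>i\<close> in
        the one at \<open>j\<close> would imply an inclusion that the pair (a, b) excludes.\<close>
      then obtain a b where ab: "(a, b) \<in> set splittings" "a < 12" "b < 12" "le12 a i" "le12 j b"
        using le12_split ij by fast
      have "Vs ! a \<subseteq> Vs ! b" using le [OF ab(4)] le [OF ab(5)] ab ij sub by (meson order_trans)
      with splittings ab(1) show False by blast
    qed
  qed (use le ij in blast)
  have eq: "Vs ! i = Vs ! j \<longleftrightarrow> i = j" if ij: "i < 12" "j < 12" for i j
  proof
    assume "Vs ! i = Vs ! j"
    then have "le12 i j" "le12 j i" using iff ij by auto
    then show "i = j" by (simp add: le12_def)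
  qed simp
  then show "distinct Vs" using len by (simp add: distinct_conv_nth)
  show "X \<subseteq> Vs ! 11" if "X \<in> set Vs" for X
    using that le [of _ 11] len by (auto simp: in_set_conv_nth le12_def)
  have less: "Vs ! i \<subset> Vs ! j \<longleftrightarrow> i \<noteq> j \<and> le12 i j" if "i < 12" "j < 12" for i j
    unfolding psubset_eq using iff eq that by blast
  have Vs: "set Vs = (\<lambda>i. Vs ! i) ` {..<12}"
    unfolding len [symmetric] by (auto simp: set_conv_nth)
  have cover: "Vs ! i \<subset> Vs ! j \<and> \<not> (\<exists>Z\<in>set Vs. Vs ! i \<subset> Z \<and> Z \<subset> Vs ! j) \<longleftrightarrow> (i, j) \<in> set edges"
    if ij: "i < 12" "j < 12" for i j
  proof -
    have "(\<exists>Z\<in>set Vs. Vs ! i \<subset> Z \<and> Z \<subset> Vs ! j) \<longleftrightarrow>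
      (\<exists>k<12. k \<noteq> i \<and> k \<noteq> j \<and> le12 i k \<and> le12 k j)"
    proof -
      have "(Vs ! i \<subset> Vs ! k \<and> Vs ! k \<subset> Vs ! j) \<longleftrightarrow> k \<noteq> i \<and> k \<noteq> j \<and> le12 i k \<and> le12 k j"
        if "k < 12" for k
        unfolding less [OF ij(1) that] less [OF that ij(2)] by metis
      then show ?thesis unfolding Vs by (simp add: Bex_def)
    qed
    moreover have "(i \<noteq> j \<and> le12 i j \<and> (\<forall>k<12. \<not> (k \<noteq> i \<and> k \<noteq> j \<and> le12 i k \<and> le12 k j))) \<longleftrightarrow>
        (i, j) \<in> set edges"
      using edges_cover ij by simp
    ultimately show ?thesis unfolding less [OF ij] by metis
  qed
  show "{(X, Y). X \<in> set Vs \<and> Y \<in> set Vs \<and> X \<subset> Y \<and> \<not> (\<exists>Z\<in>set Vs. X \<subset> Z \<and> Z \<subset> Y)} =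
      (\<lambda>(i, j). (Vs ! i, Vs ! j)) ` set edges" (is "?C = ?E")
  proof (rule subset_antisym)
    show "?C \<subseteq> ?E"
    proof
      fix XY assume "XY \<in> ?C"
      then obtain X Y where XY: "XY = (X, Y)" "X \<in> set Vs" "Y \<in> set Vs"
        "X \<subset> Y \<and> \<not> (\<exists>Z\<in>set Vs. X \<subset> Z \<and> Z \<subset> Y)" by blast
      then obtain i j where ij: "i < 12" "j < 12" "X = Vs ! i" "Y = Vs ! j"
        using len by (metis in_set_conv_nth)
      with XY(4) cover [OF ij(1,2)] have "(i, j) \<in> set edges" by simp
      with XY(1) ij(3,4) show "XY \<in> ?E" by (simp add: image_iff) (metis case_prod_conv)
    qed
    show "?E \<subseteq> ?C"
    proof
      fix XY assume "XY \<in> ?E"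
      then obtain i j where ij: "(i, j) \<in> set edges" "XY = (Vs ! i, Vs ! j)" by auto
      then have "i < 12" "j < 12" using edges_bound by blast+
      with ij cover len show "XY \<in> ?C" by simp
    qed
  qed
qed

theorem proposition3p1:
  shows "distinct
      [var_T :: 'a::infinite monoid set, var_SL, var_C, var_D, var_E, dual var_E, var_F,
       variety_join var_E (dual var_E), variety_join var_F (dual var_E), var_H, var_I, var_J] \<and>
    subvarieties (var_J :: 'a monoid set) =
      {var_T, var_SL, var_C, var_D, var_E, dual var_E, var_F,
       variety_join var_E (dual var_E), variety_join var_F (dual var_E), var_H, var_I, var_J} \<and>
    covering (var_J :: 'a monoid set) =
      {(var_T, var_SL), (var_SL, var_C), (var_C, var_D),
       (var_D, var_E), (var_D, dual var_E), (var_E, var_F),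
       (var_E, variety_join var_E (dual var_E)),
       (dual var_E, variety_join var_E (dual var_E)),
       (var_F, variety_join var_F (dual var_E)),
       (variety_join var_E (dual var_E), variety_join var_F (dual var_E)),
       (variety_join var_F (dual var_E), var_H), (var_H, var_I), (var_I, var_J)}"
proof -
  define Vs :: "'a monoid set list" where
    "Vs = [var ax_T, var ax_SL, var ax_C, var ax_D, var ax_E, var ax_dE, var ax_F, EE, FE,
      var ax_H, var ax_I, var ax_J]"
  have edge: "\<forall>(i, j)\<in>set edges. Vs ! i \<subseteq> Vs ! j"
    using T_SL SL_C C_D D_E D_dE E_F E_EE dE_EE F_FE EE_FE FE_H H_I I_J
    unfolding edges_def Vs_def by simp
  have split: "\<forall>(i, j)\<in>set splittings. \<not> Vs ! i \<subseteq> Vs ! j"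
    using SL_not_T C_not_SL D_not_C E_not_dE dE_not_F F_not_EE H_not_FE I_not_H J_not_I
    unfolding splittings_def Vs_def by simp
  have "length Vs = 12" by (simp add: Vs_def)
  note lattice = twelve_element_lattice [OF this edge split]
  have subs: "subvarieties (var ax_J :: 'a monoid set) = set Vs"
  proof (rule subset_antisym; rule subsetI)
    fix X :: "'a monoid set" assume "X \<in> subvarieties (var ax_J)"
    then have "J_variety X" by (simp add: subvarieties_def J_variety_def)
    from J_variety.classification [OF this] show "X \<in> set Vs" by (simp add: Vs_def)
  next
    fix X :: "'a monoid set" assume "X \<in> set Vs"
    then have "variety X" by (auto simp: Vs_def)
    moreover have "X \<subseteq> var ax_J" using lattice(2) [OF \<open>X \<in> set Vs\<close>] by (simp add: Vs_def)
    ultimately show "X \<in> subvarieties (var ax_J)" by (simp add: subvarieties_def)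
  qed
  have "covering (var ax_J :: 'a monoid set) = (\<lambda>(i, j). (Vs ! i, Vs ! j)) ` set edges"
    unfolding covering_def subs by (rule lattice(3))
  then have "covering (var ax_J :: 'a monoid set) =
    {(var ax_T, var ax_SL), (var ax_SL, var ax_C), (var ax_C, var ax_D), (var ax_D, var ax_E),
     (var ax_D, var ax_dE), (var ax_E, var ax_F), (var ax_E, EE), (var ax_dE, EE), (var ax_F, FE),
     (EE, FE), (FE, var ax_H), (var ax_H, var ax_I), (var ax_I, var ax_J)}"
    unfolding Vs_def edges_def by simp
  with lattice(1) subs show ?thesis
    unfolding var_eqs var_T_eq var_SL_eq var_J_eq Vs_def by simp
qed

end
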